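(* Let $u\in\mathcal{W}(I)$ be a solution of the unsteady Bingham pipe flow problem and let $z\in L^2(I;Y^* )$ be an associated dual flux, as described in the context. Then, for every $v\in\mathcal{W}(I)$ with $v(0)=u_0$ in $H$, $$\begin{aligned}&\tfrac\nu2\|\nabla(v-u)\|_Q^2+\bigl(g\|\nabla v\|_{1,Q}-(\Pi_g(z),\nabla v)_Q\bigr)+\tfrac12\|(v-u)(T)\|_H^2\\&\quad+\inf_{y}\bigl\{\tfrac1{2\nu}\|y-\Pi_g(y)-\nu\nabla u\|_Q^2+\bigl(g\|\nabla u\|_{1,Q}-(\Pi_g(y),\nabla u)_Q\bigr)\bigr\}\\&=\inf_{y}\bigl\{\tfrac1{2\nu}\|y-\Pi_g(y)-\nu\nabla v\|_Q^2+\bigl(g\|\nabla v\|_{1,Q}-(\Pi_g(y),\nabla v)_Q\bigr)\bigr\},\end{aligned}$$ where both infima are over all $y\in L^2(I;Y^* )$ with $L^*y=f-\partial_tv$ in $L^2(I;V^* )$.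
   Context: $\Omega\subseteq\mathbb{R}^d$ is a bounded Lipschitz domain with boundary split into disjoint relatively open sets $\Gamma_D\ne\emptyset$ and $\Gamma_N$, $\overline\Gamma_D\cup\overline\Gamma_N=\partial\Omega$; $I=(0,T)$, $0<T<\infty$; $Q=I\times\Omega$; $\nu,g>0$. $V=W^{1,2}_D(\Omega)$ (zero trace on $\Gamma_D$) with norm $\|\nabla\cdot\|_{L^2(\Omega)}$, $H=L^2(\Omega)$, $Y=Y^*=L^2(\Omega;\mathbb{R}^d)$. $V\hookrightarrow H\cong H^*\hookrightarrow V^*$ is the usual evolution triple and $\mathcal{W}(I)=\{v\in L^2(I;V)\mid\partial_tv\in L^2(I;V^* )\}\hookrightarrow C^0(\overline I;H)$. $L=\nabla\colon V\to Y$, $\langle L^*y,v\rangle_V=\int_\Omega y\cdot\nabla v\,dx$ (pointwise in time). $\Pi_g\colon\mathbb{R}^d\to\mathbb{R}^d$ is the orthogonal projection onto the closed ball of radius $g$ centred at $0$, applied pointwise. $\|\cdot\|_Q$, $\|\cdot\|_{1,Q}$, $(\cdot,\cdot)_Q$ are the $L^2(Q)$-norm, the $L^1(Q)$-norm and the $L^2(Q)$ inner product. Problem: $f\in L^2(I;V^* )$, $u_0\in H$, $\phi(a)=\frac\nu2|a|^2+g|a|$ on $\mathbb{R}^d$, $E(t,v)=\int_\Omega\phi(\nabla v)\,dx-\langle f(t),v\rangle_V$ for $v\in V$. It is assumed that there is a solution $u\in\mathcal{W}(I)$ of $\partial_tu(t)+\partial_vE(t,u(t))\ni0$ in $V^*$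 for a.e. $t\in I$, $u(0)=u_0$ in $H$. The dual flux $z\in L^2(I;Y^* )$ (first component of a dual solution) satisfies $z\in\partial\phi(\nabla u)$ a.e. in $Q$ and $\partial_tu+L^*z=f$ in $L^2(I;V^* )$; the first condition is equivalent to $z-\Pi_g(z)=\nu\nabla u$ and $\Pi_g(z)\cdot\nabla u=g|\nabla u|$ a.e. in $Q$. *)

theory Defs
  imports "HOL-Analysis.Analysis"
begin

text \<open>
  Elements of Lebesgue, Sobolev and Bochner spaces are represented by functions; equality in such
  a space is equality almost everywhere. \<open>\<Omega>\<close> is a subset of a Euclidean space of arbitrary
  dimension, and the time interval is \<open>I = {0<..<T}\<close>.
\<close>

section \<open>Domains and surface measure\<close>

text \<open>Near each boundary point, \<open>\<Omega>\<close> is the strict epigraph, in some direction \<open>n\<close>, of a Lipschitz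
  function of the component orthogonal to \<open>n\<close>. As \<open>W\<close> is open, the boundary inside \<open>W\<close> is then
  exactly the graph.\<close>

definition bounded_lipschitz_domain :: "'a::euclidean_space set \<Rightarrow> bool" where
  "bounded_lipschitz_domain \<Omega> \<longleftrightarrow>
     \<Omega> \<noteq> {} \<and> open \<Omega> \<and> connected \<Omega> \<and> bounded \<Omega> \<and>
     (\<forall>p\<in>frontier \<Omega>. \<exists>n W L \<gamma>. norm n = 1 \<and> open W \<and> p \<in> W \<and>
        L-lipschitz_on (UNIV :: 'a set) (\<gamma> :: 'a \<Rightarrow> real) \<and>
        \<Omega> \<inter> W = {x \<in> W. \<gamma> (x - (x \<bullet> n) *\<^sub>R n) < x \<bullet> n})"

definition boundary_partition :: "'a::euclidean_space set \<Rightarrow> 'a set \<Rightarrow> 'a set \<Rightarrow> bool" where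
  "boundary_partition \<Omega> \<Gamma>D \<Gamma>N \<longleftrightarrow>
     openin (top_of_set (frontier \<Omega>)) \<Gamma>D \<and> openin (top_of_set (frontier \<Omega>)) \<Gamma>N \<and>
     \<Gamma>D \<inter> \<Gamma>N = {} \<and> \<Gamma>D \<noteq> {} \<and> closure \<Gamma>D \<union> closure \<Gamma>N = frontier \<Omega>"

text \<open>Normalised \<open>s\<close>-dimensional Hausdorff (outer) measure. Empty covering sets contribute \<open>0\<close>;
  this matters for \<open>s = 0\<close>, where \<open>0 ^ 0 = 1\<close>. The \<open>diameter\<close> of an unbounded set is
  a junk value, hence the boundedness condition.\<close>

definition hausdorff_outer :: "nat \<Rightarrow> 'a::euclidean_space set \<Rightarrow> ennreal" where
  "hausdorff_outer s A =
     (SUP \<delta>\<in>{0<..}. INF U\<in>{U :: nat \<Rightarrow> 'a set. A \<subseteq> (\<Union>i. U i) \<and>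
                                     (\<forall>i. bounded (U i) \<and> diameter (U i) \<le> \<delta>)}.
        (\<Sum>i. if U i = {} then 0
              else ennreal (unit_ball_vol (real s) / 2 ^ s * diameter (U i) ^ s)))"

definition surface_measure :: "'a::euclidean_space set \<Rightarrow> 'a measure" where
  "surface_measure \<Omega> =
     restrict_space (measure_of UNIV (sets borel) (hausdorff_outer (DIM('a) - 1))) (frontier \<Omega>)"

section \<open>Lebesgue and Sobolev spaces\<close>

definition L2 :: "'a measure \<Rightarrow> ('a \<Rightarrow> 'b::euclidean_space) set" where
  "L2 M = {w \<in> borel_measurable M. integrable M (\<lambda>x. (norm (w x))\<^sup>2)}"

definition norm_L2 :: "'a measure \<Rightarrow> ('a \<Rightarrow> 'b::euclidean_space) \<Rightarrow> real" where
  "norm_L2 M w = sqrt (\<integral>x. (norm (w x))\<^sup>2 \<partial>M)"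

primrec C_k :: "nat \<Rightarrow> ('a::euclidean_space \<Rightarrow> real) \<Rightarrow> bool" where
  "C_k 0 h \<longleftrightarrow> continuous_on UNIV h"
| "C_k (Suc k) h \<longleftrightarrow> (\<forall>x. h differentiable (at x)) \<and>
     (\<forall>i\<in>Basis. C_k k (\<lambda>x. frechet_derivative h (at x) i))"

definition C_inf :: "('a::euclidean_space \<Rightarrow> real) \<Rightarrow> bool" where
  "C_inf h \<longleftrightarrow> (\<forall>k. C_k k h)"

definition test_function :: "'a::euclidean_space set \<Rightarrow> ('a \<Rightarrow> real) \<Rightarrow> bool" where
  "test_function S \<psi> \<longleftrightarrow> C_inf \<psi> \<and> (\<exists>K. compact K \<and> K \<subseteq> S \<and> (\<forall>x. x \<notin> K \<longrightarrow> \<psi> x = 0))"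

definition is_weak_grad ::
    "'a::euclidean_space set \<Rightarrow> ('a \<Rightarrow> real) \<Rightarrow> ('a \<Rightarrow> 'a) \<Rightarrow> bool" where
  "is_weak_grad \<Omega> w G \<longleftrightarrow>
     (\<forall>\<psi>. test_function \<Omega> \<psi> \<longrightarrow> (\<forall>i\<in>Basis.
        (\<integral>x. w x * frechet_derivative \<psi> (at x) i \<partial>lebesgue_on \<Omega>) =
        - (\<integral>x. (G x \<bullet> i) * \<psi> x \<partial>lebesgue_on \<Omega>)))"

definition W12 :: "'a::euclidean_space set \<Rightarrow> ('a \<Rightarrow> real) set" where
  "W12 \<Omega> = {w \<in> L2 (lebesgue_on \<Omega>). \<exists>G\<in>L2 (lebesgue_on \<Omega>). is_weak_grad \<Omega> w G}"

definition weak_grad :: "'a::euclidean_space set \<Rightarrow> ('a \<Rightarrow> real) \<Rightarrow> 'a \<Rightarrow> 'a" where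
  "weak_grad \<Omega> w = (SOME G. G \<in> L2 (lebesgue_on \<Omega>) \<and> is_weak_grad \<Omega> w G)"

definition norm_W12 :: "'a::euclidean_space set \<Rightarrow> ('a \<Rightarrow> real) \<Rightarrow> real" where
  "norm_W12 \<Omega> w =
     sqrt ((norm_L2 (lebesgue_on \<Omega>) w)\<^sup>2 + (norm_L2 (lebesgue_on \<Omega>) (weak_grad \<Omega> w))\<^sup>2)"

text \<open>The trace operator is the continuous extension of the restriction to the boundary of functions
  that are smooth up to the boundary. Such functions automatically lie in \<open>W12 \<Omega>\<close>.
  Convergence in \<open>L\<^sup>2\<close> of the boundary is stated with the nonnegative integral, which makes sense
  without an integrability requirement.\<close>

definition has_trace :: "'a::euclidean_space set \<Rightarrow> ('a \<Rightarrow> real) \<Rightarrow> ('a \<Rightarrow> real) \<Rightarrow> bool" where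
  "has_trace \<Omega> w h \<longleftrightarrow> h \<in> L2 (surface_measure \<Omega>) \<and>
     (\<exists>\<phi> :: nat \<Rightarrow> 'a \<Rightarrow> real. (\<forall>k. C_inf (\<phi> k) \<and> \<phi> k \<in> W12 \<Omega>) \<and>
        (\<lambda>k. norm_W12 \<Omega> (\<phi> k - w)) \<longlonglongrightarrow> 0 \<and>
        (\<lambda>k. \<integral>\<^sup>+ x. ennreal ((\<phi> k x - h x)\<^sup>2) \<partial>surface_measure \<Omega>) \<longlonglongrightarrow> 0)"

text \<open>The space \<open>V\<close>, its norm, and the dual \<open>V\<^sup>*\<close>. Only the values on \<open>V\<close> of an
  element of \<open>V\<^sup>*\<close> are meaningful.\<close>

definition W12_D :: "'a::euclidean_space set \<Rightarrow> 'a set \<Rightarrow> ('a \<Rightarrow> real) set" where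
  "W12_D \<Omega> \<Gamma>D =
     {w \<in> W12 \<Omega>. \<exists>h. has_trace \<Omega> w h \<and> (AE x in surface_measure \<Omega>. x \<in> \<Gamma>D \<longrightarrow> h x = 0)}"

definition norm_V :: "'a::euclidean_space set \<Rightarrow> ('a \<Rightarrow> real) \<Rightarrow> real" where
  "norm_V \<Omega> w = norm_L2 (lebesgue_on \<Omega>) (weak_grad \<Omega> w)"

definition V_dual :: "'a::euclidean_space set \<Rightarrow> 'a set \<Rightarrow> (('a \<Rightarrow> real) \<Rightarrow> real) set" where
  "V_dual \<Omega> \<Gamma>D = {l.
     (\<forall>v\<in>W12_D \<Omega> \<Gamma>D. \<forall>w\<in>W12_D \<Omega> \<Gamma>D. \<forall>a b.
        l (\<lambda>x. a * v x + b * w x) = a * l v + b * l w) \<and>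
     (\<exists>C. \<forall>v\<in>W12_D \<Omega> \<Gamma>D. \<bar>l v\<bar> \<le> C * norm_V \<Omega> v)}"

definition norm_V_dual ::
    "'a::euclidean_space set \<Rightarrow> 'a set \<Rightarrow> (('a \<Rightarrow> real) \<Rightarrow> real) \<Rightarrow> real" where
  "norm_V_dual \<Omega> \<Gamma>D l = (SUP v\<in>{v \<in> W12_D \<Omega> \<Gamma>D. norm_V \<Omega> v \<le> 1}. \<bar>l v\<bar>)"

definition V_dual_eq ::
    "'a::euclidean_space set \<Rightarrow> 'a set \<Rightarrow> (('a \<Rightarrow> real) \<Rightarrow> real) \<Rightarrow> (('a \<Rightarrow> real) \<Rightarrow> real) \<Rightarrow> bool" where
  "V_dual_eq \<Omega> \<Gamma>D l m \<longleftrightarrow> (\<forall>w\<in>W12_D \<Omega> \<Gamma>D. l w = m w)"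

section \<open>Bochner spaces\<close>

text \<open>\<open>L\<^sup>2(I; X)\<close> for a space \<open>X\<close> of functions with norm \<open>n\<close>: strongly measurable functions
  (a.e. limits of \<open>X\<close>-valued simple functions) with square-integrable norm. The library's Bochner
  integral needs \<open>X\<close> to be a type and is therefore not applicable.\<close>

definition bochner_L2 ::
    "real \<Rightarrow> ('x \<Rightarrow> 'y::minus) set \<Rightarrow> (('x \<Rightarrow> 'y) \<Rightarrow> real) \<Rightarrow> (real \<Rightarrow> 'x \<Rightarrow> 'y) set" where
  "bochner_L2 T X n = {u.
     (AE t in lebesgue_on {0<..<T}. u t \<in> X) \<and>
     (\<exists>s. (\<forall>k::nat. simple_function (lebesgue_on {0<..<T}) (s k) \<and> s k ` {0<..<T} \<subseteq> X) \<and>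
          (AE t in lebesgue_on {0<..<T}. (\<lambda>k. n (u t - s k t)) \<longlonglongrightarrow> 0)) \<and>
     integrable (lebesgue_on {0<..<T}) (\<lambda>t. (n (u t))\<^sup>2)}"

definition L2_V :: "'a::euclidean_space set \<Rightarrow> 'a set \<Rightarrow> real \<Rightarrow> (real \<Rightarrow> 'a \<Rightarrow> real) set" where
  "L2_V \<Omega> \<Gamma>D T = bochner_L2 T (W12_D \<Omega> \<Gamma>D) (norm_V \<Omega>)"

definition L2_V_dual ::
    "'a::euclidean_space set \<Rightarrow> 'a set \<Rightarrow> real \<Rightarrow> (real \<Rightarrow> ('a \<Rightarrow> real) \<Rightarrow> real) set" where
  "L2_V_dual \<Omega> \<Gamma>D T = bochner_L2 T (V_dual \<Omega> \<Gamma>D) (norm_V_dual \<Omega> \<Gamma>D)"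

definition L2_Y :: "'a::euclidean_space set \<Rightarrow> real \<Rightarrow> (real \<Rightarrow> 'a \<Rightarrow> 'a) set" where
  "L2_Y \<Omega> T = bochner_L2 T (L2 (lebesgue_on \<Omega>)) (norm_L2 (lebesgue_on \<Omega>))"

text \<open>Distributional time derivative in the evolution triple: \<open>v t\<close> acts on \<open>V\<close> through the
  \<open>L\<^sup>2(\<Omega>)\<close> inner product. The identity of Bochner integrals in \<open>V\<^sup>*\<close> is evaluated at each
  \<open>w \<in> V\<close>.\<close>

definition is_time_deriv ::
    "'a::euclidean_space set \<Rightarrow> 'a set \<Rightarrow> real \<Rightarrow>
     (real \<Rightarrow> 'a \<Rightarrow> real) \<Rightarrow> (real \<Rightarrow> ('a \<Rightarrow> real) \<Rightarrow> real) \<Rightarrow> bool" where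
  "is_time_deriv \<Omega> \<Gamma>D T v F \<longleftrightarrow>
     (\<forall>\<psi>. test_function {0<..<T} \<psi> \<longrightarrow> (\<forall>w\<in>W12_D \<Omega> \<Gamma>D.
        (\<integral>t. deriv \<psi> t * (\<integral>x. v t x * w x \<partial>lebesgue_on \<Omega>) \<partial>lebesgue_on {0<..<T}) =
        - (\<integral>t. \<psi> t * F t w \<partial>lebesgue_on {0<..<T})))"

definition W_space :: "'a::euclidean_space set \<Rightarrow> 'a set \<Rightarrow> real \<Rightarrow> (real \<Rightarrow> 'a \<Rightarrow> real) set" where
  "W_space \<Omega> \<Gamma>D T =
     {v \<in> L2_V \<Omega> \<Gamma>D T. \<exists>F\<in>L2_V_dual \<Omega> \<Gamma>D T. is_time_deriv \<Omega> \<Gamma>D T v F}"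

definition time_deriv ::
    "'a::euclidean_space set \<Rightarrow> 'a set \<Rightarrow> real \<Rightarrow>
     (real \<Rightarrow> 'a \<Rightarrow> real) \<Rightarrow> real \<Rightarrow> ('a \<Rightarrow> real) \<Rightarrow> real" where
  "time_deriv \<Omega> \<Gamma>D T v =
     (SOME F. F \<in> L2_V_dual \<Omega> \<Gamma>D T \<and> is_time_deriv \<Omega> \<Gamma>D T v F)"

text \<open>Point values in time are those of the representative in \<open>C\<^sup>0([0,T]; H)\<close>:
  \<open>has_value \<Omega> T v t h\<close> says that \<open>v(t) = h\<close> in \<open>H\<close>.\<close>

definition has_value ::
    "'a::euclidean_space set \<Rightarrow> real \<Rightarrow> (real \<Rightarrow> 'a \<Rightarrow> real) \<Rightarrow> real \<Rightarrow> ('a \<Rightarrow> real) \<Rightarrow> bool" where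
  "has_value \<Omega> T v t h \<longleftrightarrow>
     (\<exists>w. (\<forall>s\<in>{0..T}. w s \<in> L2 (lebesgue_on \<Omega>)) \<and>
          (\<forall>s\<in>{0..T}. ((\<lambda>r. norm_L2 (lebesgue_on \<Omega>) (w r - w s)) \<longlongrightarrow> 0) (at s within {0..T})) \<and>
          (AE s in lebesgue_on {0<..<T}. AE x in lebesgue_on \<Omega>. v s x = w s x) \<and>
          (AE x in lebesgue_on \<Omega>. w t x = h x))"

definition value_at ::
    "'a::euclidean_space set \<Rightarrow> real \<Rightarrow> (real \<Rightarrow> 'a \<Rightarrow> real) \<Rightarrow> real \<Rightarrow> 'a \<Rightarrow> real" where
  "value_at \<Omega> T v t = (SOME h. has_value \<Omega> T v t h)"

text \<open>Integrals over \<open>Q = I \<times> \<Omega>\<close> are iterated integrals (\<open>L\<^sup>2(Q) = L\<^sup>2(I; L\<^sup>2(\<Omega>))\<close>): they depend only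
  on the Bochner class, whereas an arbitrary representative need not be jointly measurable.\<close>

definition norm_Q ::
    "'a::euclidean_space set \<Rightarrow> real \<Rightarrow> (real \<Rightarrow> 'a \<Rightarrow> 'b::euclidean_space) \<Rightarrow> real" where
  "norm_Q \<Omega> T w =
     sqrt (\<integral>t. (\<integral>x. (norm (w t x))\<^sup>2 \<partial>lebesgue_on \<Omega>) \<partial>lebesgue_on {0<..<T})"

definition norm1_Q ::
    "'a::euclidean_space set \<Rightarrow> real \<Rightarrow> (real \<Rightarrow> 'a \<Rightarrow> 'b::euclidean_space) \<Rightarrow> real" where
  "norm1_Q \<Omega> T w = (\<integral>t. (\<integral>x. norm (w t x) \<partial>lebesgue_on \<Omega>) \<partial>lebesgue_on {0<..<T})"

definition inner_Q ::
    "'a::euclidean_space set \<Rightarrow> real \<Rightarrow> (real \<Rightarrow> 'a \<Rightarrow> 'b::euclidean_space) \<Rightarrow> (real \<Rightarrow> 'a \<Rightarrow> 'b) \<Rightarrow> real" where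
  "inner_Q \<Omega> T y w = (\<integral>t. (\<integral>x. y t x \<bullet> w t x \<partial>lebesgue_on \<Omega>) \<partial>lebesgue_on {0<..<T})"

definition grad_Q :: "'a::euclidean_space set \<Rightarrow> (real \<Rightarrow> 'a \<Rightarrow> real) \<Rightarrow> real \<Rightarrow> 'a \<Rightarrow> 'a" where
  "grad_Q \<Omega> v = (\<lambda>t. weak_grad \<Omega> (v t))"

definition L_adj ::
    "'a::euclidean_space set \<Rightarrow> ('a \<Rightarrow> 'a) \<Rightarrow> ('a \<Rightarrow> real) \<Rightarrow> real" where
  "L_adj \<Omega> y = (\<lambda>w. \<integral>x. y x \<bullet> weak_grad \<Omega> w x \<partial>lebesgue_on \<Omega>)"

section \<open>Bingham pipe flow\<close>

definition phi :: "real \<Rightarrow> real \<Rightarrow> 'a::euclidean_space \<Rightarrow> real" where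
  "phi \<nu> g a = \<nu> / 2 * (norm a)\<^sup>2 + g * norm a"

definition subdiff :: "('a::euclidean_space \<Rightarrow> real) \<Rightarrow> 'a \<Rightarrow> 'a set" where
  "subdiff F a = {s. \<forall>b. F a + s \<bullet> (b - a) \<le> F b}"

definition subdiff_V ::
    "'a::euclidean_space set \<Rightarrow> 'a set \<Rightarrow> (('a \<Rightarrow> real) \<Rightarrow> real) \<Rightarrow> ('a \<Rightarrow> real) \<Rightarrow>
     (('a \<Rightarrow> real) \<Rightarrow> real) set" where
  "subdiff_V \<Omega> \<Gamma>D F v =
     {l \<in> V_dual \<Omega> \<Gamma>D. \<forall>w\<in>W12_D \<Omega> \<Gamma>D. F v + l (w - v) \<le> F w}"

definition energy ::
    "'a::euclidean_space set \<Rightarrow> real \<Rightarrow> real \<Rightarrow> (real \<Rightarrow> ('a \<Rightarrow> real) \<Rightarrow> real) \<Rightarrow>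
     real \<Rightarrow> ('a \<Rightarrow> real) \<Rightarrow> real" where
  "energy \<Omega> \<nu> g f t v = (\<integral>x. phi \<nu> g (weak_grad \<Omega> v x) \<partial>lebesgue_on \<Omega>) - f t v"

definition bingham_solution ::
    "'a::euclidean_space set \<Rightarrow> 'a set \<Rightarrow> real \<Rightarrow> real \<Rightarrow> real \<Rightarrow>
     (real \<Rightarrow> ('a \<Rightarrow> real) \<Rightarrow> real) \<Rightarrow> ('a \<Rightarrow> real) \<Rightarrow> (real \<Rightarrow> 'a \<Rightarrow> real) \<Rightarrow> bool" where
  "bingham_solution \<Omega> \<Gamma>D T \<nu> g f u0 u \<longleftrightarrow>
     u \<in> W_space \<Omega> \<Gamma>D T \<and>
     (AE t in lebesgue_on {0<..<T}. \<exists>\<xi>\<in>subdiff_V \<Omega> \<Gamma>D (energy \<Omega> \<nu> g f t) (u t).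
        V_dual_eq \<Omega> \<Gamma>D (\<lambda>w. time_deriv \<Omega> \<Gamma>D T u t w + \<xi> w) (\<lambda>w. 0)) \<and>
     has_value \<Omega> T u 0 u0"

definition dual_admissible ::
    "'a::euclidean_space set \<Rightarrow> 'a set \<Rightarrow> real \<Rightarrow> (real \<Rightarrow> ('a \<Rightarrow> real) \<Rightarrow> real) \<Rightarrow>
     (real \<Rightarrow> 'a \<Rightarrow> real) \<Rightarrow> (real \<Rightarrow> 'a \<Rightarrow> 'a) set" where
  "dual_admissible \<Omega> \<Gamma>D T f v =
     {y \<in> L2_Y \<Omega> T. AE t in lebesgue_on {0<..<T}.
        V_dual_eq \<Omega> \<Gamma>D (L_adj \<Omega> (y t)) (\<lambda>w. f t w - time_deriv \<Omega> \<Gamma>D T v t w)}"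

definition dual_flux ::
    "'a::euclidean_space set \<Rightarrow> 'a set \<Rightarrow> real \<Rightarrow> real \<Rightarrow> real \<Rightarrow>
     (real \<Rightarrow> ('a \<Rightarrow> real) \<Rightarrow> real) \<Rightarrow> (real \<Rightarrow> 'a \<Rightarrow> real) \<Rightarrow> (real \<Rightarrow> 'a \<Rightarrow> 'a) \<Rightarrow> bool" where
  "dual_flux \<Omega> \<Gamma>D T \<nu> g f u z \<longleftrightarrow>
     z \<in> L2_Y \<Omega> T \<and>
     (AE t in lebesgue_on {0<..<T}. AE x in lebesgue_on \<Omega>.
        z t x \<in> subdiff (phi \<nu> g) (grad_Q \<Omega> u t x)) \<and>
     (AE t in lebesgue_on {0<..<T}.
        V_dual_eq \<Omega> \<Gamma>D (\<lambda>w. time_deriv \<Omega> \<Gamma>D T u t w + L_adj \<Omega> (z t) w) (f t))"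

definition proj_Q ::
    "real \<Rightarrow> (real \<Rightarrow> 'a::euclidean_space \<Rightarrow> 'a) \<Rightarrow> real \<Rightarrow> 'a \<Rightarrow> 'a" where
  "proj_Q g y = (\<lambda>t x. closest_point (cball 0 g) (y t x))"

end

theory Submission
  imports Defs
begin

text \<open>
  Expanding the squares, the two functionals under the infima differ, for every admissible \<open>y\<close>,
  by the first two summands of the left-hand side plus \<open>(z - y, \<nabla>(v - u))\<^sub>Q\<close>; here
  \<open>z - \<Pi>\<^sub>g(z) = \<nu>\<nabla>u\<close> and \<open>\<Pi>\<^sub>g(z) \<bullet> \<nabla>u = g|\<nabla>u|\<close> enter. As \<open>L\<^sup>*(z - y)\<close> is the time derivative of \<open>v - u\<close>
  and \<open>(v - u)(0) = 0\<close>, integration by parts in time turns this term into half the squared norm of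
  \<open>(v - u)(T)\<close>.

  Integration by parts for \<open>w = v - u\<close> is obtained without vector-valued mollification. The weak
  derivative gives \<open>(w(b) - w(a), w(t)) = \<integral> (p(s), \<nabla>w(t)) ds\<close> over \<open>(a, b)\<close>, where \<open>p = z - y\<close>. With \<open>t = a\<close> or
  \<open>t = b\<close>, the left-hand side bounds half the increment of \<open>\<parallel>w\<parallel>\<^sup>2\<close> from below or above; averaging over
  short intervals, both right-hand sides tend to \<open>\<integral> (p, \<nabla>w) dt\<close> since Steklov averages converge in \<open>L\<^sup>1\<close>.
\<close>

section \<open>Smooth functions\<close>

text \<open>Why the difference of the two functionals is free of nonlinear terms in
  \<open>y\<close>: for a gradient W, the cross term of the square contributes the product of
  \<open>proj_Q g y\<close> with W, and the last summand removes it again. What remains is the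
  square of \<open>y - proj_Q g y\<close>, common to both functionals, and the product of
  \<open>y\<close> with W, which is linear. The obstacle lies in time. Elements of V, of H and of
  the dual are functions, not points of a Banach space type, so derivatives and averages in time are
  used only through scalar pairings with a fixed element of V. In the energy argument this element
  is w(t) itself; therefore whatever is said about increments must hold for all a and b outside a
  single null set of t. The continuous representatives come from the initial conditions, because
  \<open>has_value\<close> at time 0 supplies one on the whole closed interval.\<close>

lemma frechet_derivative_eqI:
  assumes "(h has_derivative h') (at x)"
  shows "frechet_derivative h (at x) = h'"
  using frechet_derivative_at[OF assms] by simp

lemma C_k_const: "C_k k (\<lambda>x::'a::euclidean_space. c)"
proof (induction k arbitrary: c)
  case (Suc k)
  show ?case by (auto simp: frechet_derivative_const Suc)
qed auto

lemma C_k_Suc_imp: "C_k (Suc k) h \<Longrightarrow> C_k k h"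
proof (induction k arbitrary: h)
  case 0
  then show ?case
    by (auto intro!: differentiable_imp_continuous_on simp: differentiable_on_def
        intro: differentiable_at_withinI)
next
  case (Suc k)
  then show ?case by simp
qed

lemma C_k_add: "C_k k f \<Longrightarrow> C_k k h \<Longrightarrow> C_k k (\<lambda>x. f x + h x)"
proof (induction k arbitrary: f h)
  case 0
  then show ?case by (auto intro: continuous_intros)
next
  case (Suc k)
  have d: "((\<lambda>x. f x + h x) has_derivative (\<lambda>y. frechet_derivative f (at x) y + frechet_derivative h (at x) y)) (at x)" for x
    using Suc.prems by (auto intro!: derivative_eq_intros simp: frechet_derivative_works[symmetric])
  show ?case
    using Suc by (auto simp: frechet_derivative_eqI[OF d] differentiable_def intro: d)
qed

lemma C_k_mult: "C_k k f \<Longrightarrow> C_k k h \<Longrightarrow> C_k k (\<lambda>x. f x * h x)"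
proof (induction k arbitrary: f h)
  case 0
  then show ?case by (auto intro: continuous_intros)
next
  case (Suc k)
  have d: "((\<lambda>x. f x * h x) has_derivative
     (\<lambda>y. f x * frechet_derivative h (at x) y + frechet_derivative f (at x) y * h x)) (at x)" for x
    using Suc.prems by (intro has_derivative_mult) (auto simp: frechet_derivative_works[symmetric])
  have "C_k k f" "C_k k h" using Suc.prems by (blast intro: C_k_Suc_imp)+
  then show ?case
    using Suc by (auto simp: frechet_derivative_eqI[OF d] differentiable_def intro: d intro!: C_k_add)
qed

text \<open>Functions of one coordinate are the building blocks: products of them give cutoffs on
  boxes, and on the real line \<open>i = 1\<close> gives affine changes of variable.\<close>

lemma C_k_compose_affine:
  fixes \<theta> :: "real \<Rightarrow> real" and i :: "'a::euclidean_space"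
  shows "C_k k \<theta> \<Longrightarrow> C_k k (\<lambda>x. \<theta> (c * (x \<bullet> i) + d))"
proof (induction k arbitrary: \<theta>)
  case 0
  then show ?case
    by (auto intro!: continuous_intros continuous_on_compose2[of UNIV \<theta>])
next
  case (Suc k)
  let ?d = "\<lambda>x. frechet_derivative \<theta> (at x) 1"
  \<comment> \<open>A derivative on the real line is multiplication by its value at 1. This gives
    the chain rule the form of a product with \<open>?d\<close>, to which the induction hypothesis
    applies.\<close>
  have lin: "frechet_derivative \<theta> (at x) y = y * ?d x" for x y
    using linear_frechet_derivative[of \<theta> "at x"] Suc.prems
      linear_scale[of "frechet_derivative \<theta> (at x)" y 1] by auto
  have d: "((\<lambda>x. \<theta> (c * (x \<bullet> i) + d)) has_derivative (\<lambda>y. (c * (y \<bullet> i)) * ?d (c * (x \<bullet> i) + d))) (at x)" for x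
  proof -
    have "(\<theta> has_derivative frechet_derivative \<theta> (at (c * (x \<bullet> i) + d))) (at (c * (x \<bullet> i) + d))"
      using Suc.prems by (simp add: frechet_derivative_works[symmetric])
    moreover have "((\<lambda>x. c * (x \<bullet> i) + d) has_derivative (\<lambda>y. c * (y \<bullet> i))) (at x)"
      by (auto intro!: derivative_eq_intros)
    ultimately have "((\<lambda>x. \<theta> (c * (x \<bullet> i) + d)) has_derivative
       (\<lambda>y. frechet_derivative \<theta> (at (c * (x \<bullet> i) + d)) (c * (y \<bullet> i)))) (at x)"
      using has_derivative_compose by fast
    then show ?thesis by (subst (asm) lin)
  qed
  have "C_k k ?d" using Suc.prems by simp
  from Suc.IH[OF this] have "C_k k (\<lambda>x. (c * (y \<bullet> i)) * ?d (c * (x \<bullet> i) + d))" for y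
    by (intro C_k_mult C_k_const)
  then show ?case
    by (auto simp: frechet_derivative_eqI[OF d] differentiable_def intro: d)
qed

lemma C_inf_const: "C_inf (\<lambda>x::'a::euclidean_space. c)"
  by (simp add: C_inf_def C_k_const)

lemma C_inf_add: "C_inf f \<Longrightarrow> C_inf h \<Longrightarrow> C_inf (\<lambda>x. f x + h x)"
  by (simp add: C_inf_def C_k_add)

lemma C_inf_mult: "C_inf f \<Longrightarrow> C_inf h \<Longrightarrow> C_inf (\<lambda>x. f x * h x)"
  by (simp add: C_inf_def C_k_mult)

lemma C_inf_diff: "C_inf f \<Longrightarrow> C_inf h \<Longrightarrow> C_inf (\<lambda>x. f x - h x)"
  using C_inf_add[of f "\<lambda>x. (-1) * h x"] C_inf_mult[OF C_inf_const, of h "-1"] by simp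

lemma C_inf_compose_affine:
  fixes \<theta> :: "real \<Rightarrow> real" and i :: "'a::euclidean_space"
  shows "C_inf \<theta> \<Longrightarrow> C_inf (\<lambda>x. \<theta> (c * (x \<bullet> i) + d))"
  by (simp add: C_inf_def C_k_compose_affine)

lemma C_inf_prod:
  "finite S \<Longrightarrow> (\<And>i. i \<in> S \<Longrightarrow> C_inf (f i)) \<Longrightarrow> C_inf (\<lambda>x. \<Prod>i\<in>S. f i x)"
  by (induction S rule: finite_induct) (auto intro: C_inf_const C_inf_mult)

lemma C_inf_differentiable: "C_inf h \<Longrightarrow> h differentiable (at x)"
  unfolding C_inf_def by (metis C_k.simps(2))

lemma C_inf_continuous_on: "C_inf h \<Longrightarrow> continuous_on S h"
  unfolding C_inf_def by (metis C_k.simps(1) continuous_on_subset subset_UNIV)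

lemma C_inf_frechet: 
  assumes "C_inf h" "i \<in> Basis"
  shows "C_inf (\<lambda>x. frechet_derivative h (at x) i)"
  using assms unfolding C_inf_def by (metis C_k.simps(2))

lemma C_inf_realI:
  fixes h :: "real \<Rightarrow> real"
  assumes "\<And>x. (h has_real_derivative h' x) (at x)" "C_inf h'"
  shows "C_inf h"
  unfolding C_inf_def
proof
  fix k
  have d: "(h has_derivative (*) (h' x)) (at x)" for x
    using assms(1)[of x] by (simp add: has_field_derivative_def)
  have "C_k (Suc k) h"
    using assms(2) by (auto simp: frechet_derivative_eqI[OF d] C_inf_def differentiable_def intro: d)
  then show "C_k k h" by (rule C_k_Suc_imp)
qed

text \<open>Up to linear combinations, this family is closed under differentiation.\<close>

definition exp_flat :: "nat \<Rightarrow> real \<Rightarrow> real" where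
  "exp_flat n x = (if x > 0 then exp (- 1 / x) / x ^ n else 0)"

text \<open>The single term of order n + 2 in the series of exp(1/x) already bounds the exponential
  from below. The two spare powers of x make the difference quotient of \<open>exp_flat\<close> at 0
  vanish, the one delicate point of its derivative.\<close>

lemma exp_flat_bound: "\<bar>exp_flat n x\<bar> \<le> fact (n + 2) * x\<^sup>2"
proof (cases "x > 0")
  case True
  have "(1 / x) ^ (n + 2) / fact (n + 2) \<le> exp (1 / x)"
  proof -
    have "(1 / x) ^ (n + 2) / fact (n + 2) \<le> (\<Sum>k. (1/x) ^ k / fact k)"
    proof -
      have s: "(\<lambda>k. (1/x) ^ k / fact k) sums exp (1/x)"
        using exp_converges[of "1/x"] by (simp add: divide_inverse mult.commute)
      have "(\<Sum>k\<in>{n+2}. (1/x) ^ k / fact k) \<le> (\<Sum>k. (1/x) ^ k / fact k)"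
        using True s by (intro sum_le_suminf) (auto simp: sums_iff)
      then show ?thesis by simp
    qed
    also have "\<dots> = exp (1/x)"
      using exp_converges[of "1/x"] by (simp add: divide_inverse mult.commute sums_iff)
    finally show ?thesis .
  qed
  moreover define c where "c = (fact (n + 2) :: real)"
  ultimately have "1 / (x ^ (n + 2) * c) \<le> exp (1 / x)" "c > 0"
    by (simp_all add: power_one_over field_simps del: fact_Suc add_2_eq_Suc')
  then have "1 \<le> c * x ^ (n + 2) * exp (1 / x)"
    using True by (simp add: field_simps)
  then have "exp (- 1 / x) \<le> c * x ^ (n + 2)"
    using True by (simp add: exp_minus field_simps)
  then show ?thesis using True unfolding c_def[symmetric]
    by (simp add: exp_flat_def field_simps power_add power2_eq_square)
qed (simp add: exp_flat_def)

lemma exp_flat_deriv: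
  "(exp_flat n has_real_derivative (exp_flat (n + 2) x - real n * exp_flat (n + 1) x)) (at x)"
proof -
  consider "x > 0" | "x < 0" | "x = 0" by linarith
  then show ?thesis
  proof cases
    case 1
    have "((\<lambda>x. exp (- 1 / x) / x ^ n) has_real_derivative
        (exp_flat (n + 2) x - real n * exp_flat (n + 1) x)) (at x)"
      using 1
      apply (auto intro!: derivative_eq_intros simp: exp_flat_def)
      \<comment> \<open>The derivative of x ^ n carries the exponent n - 1, which is truncated for n
        = 0.\<close>
      apply (cases n)
       apply (auto simp: field_simps power2_eq_square power_add)
      done
    then show ?thesis
      by (rule has_field_derivative_transform_within_open[where S="{0<..}"])
        (use 1 in \<open>auto simp: exp_flat_def\<close>)
  next
    case 2
    have "((\<lambda>x. 0) has_real_derivative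
        (exp_flat (n + 2) x - real n * exp_flat (n + 1) x)) (at x)"
      using 2 by (auto simp: exp_flat_def)
    then show ?thesis
      by (rule has_field_derivative_transform_within_open[where S="{..<0}"])
        (use 2 in \<open>auto simp: exp_flat_def\<close>)
  next
    case 3
    have "((\<lambda>y. exp_flat n y / y) \<longlongrightarrow> 0) (at 0)"
    proof (rule Lim_null_comparison)
      show "\<forall>\<^sub>F y in at 0. norm (exp_flat n y / y) \<le> fact (n + 2) * \<bar>y\<bar>"
      proof (rule always_eventually, safe)
        fix y :: real
        have "norm (exp_flat n y / y) \<le> fact (n + 2) * y\<^sup>2 / \<bar>y\<bar>"
          unfolding real_norm_def abs_divide by (rule divide_right_mono[OF exp_flat_bound]) simp
        also have "\<dots> = fact (n + 2) * \<bar>y\<bar>"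
          by (cases "y = 0") (simp_all add: power2_eq_square abs_if)
        finally show "norm (exp_flat n y / y) \<le> fact (n + 2) * \<bar>y\<bar>" .
      qed
      have "((\<lambda>y::real. fact (n + 2) * \<bar>y\<bar>) \<longlongrightarrow> fact (n + 2) * \<bar>0\<bar>) (at 0)"
        by (intro tendsto_intros)
      then show "((\<lambda>y::real. fact (n + 2) * \<bar>y\<bar>) \<longlongrightarrow> 0) (at 0)" by simp
    qed
    then show ?thesis
      unfolding 3 by (simp add: has_field_derivative_iff exp_flat_def)
  qed
qed

lemma exp_flat_C_inf: "C_inf (exp_flat n)"
proof -
  have "C_k k (exp_flat n)" for k n
  proof (induction k arbitrary: n)
    case 0
    have "isCont (exp_flat n) x" for x using exp_flat_deriv DERIV_isCont by blast
    then show ?case by (simp add: continuous_on_eq_continuous_at)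
  next
    case (Suc k)
    have d: "(exp_flat n has_derivative (*) (exp_flat (n + 2) x - real n * exp_flat (n + 1) x)) (at x)" for x
      using exp_flat_deriv[of n x] by (simp add: has_field_derivative_def)
    have "C_k k (\<lambda>x. exp_flat (n + 2) x + (- real n) * exp_flat (n + 1) x)"
      by (intro C_k_add C_k_mult C_k_const Suc)
    then have "C_k k (\<lambda>x. exp_flat (Suc (Suc n)) x - real n * exp_flat (Suc n) x)" by simp
    then show ?case
      by (auto simp: frechet_derivative_eqI[OF d] differentiable_def intro: d)
  qed
  then show ?thesis by (simp add: C_inf_def)
qed

text \<open>Normalised primitive of a bump supported in [0, 1]. The step itself yields cutoffs; its
  derivative, rescaled, yields unit masses that concentrate at a point.\<close>

lemma smooth_step_ex:
  obtains \<theta> \<theta>' :: "real \<Rightarrow> real" where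
    "C_inf \<theta>" "\<And>x. (\<theta> has_real_derivative \<theta>' x) (at x)" "continuous_on UNIV \<theta>'"
    "\<And>x. \<theta>' x \<ge> 0" "\<And>x. x \<le> 0 \<Longrightarrow> \<theta>' x = 0" "\<And>x. x \<ge> 1 \<Longrightarrow> \<theta>' x = 0"
    "\<And>x. x \<le> 0 \<Longrightarrow> \<theta> x = 0" "\<And>x. x \<ge> 1 \<Longrightarrow> \<theta> x = 1"
    "\<And>x. 0 \<le> \<theta> x" "\<And>x. \<theta> x \<le> 1"
proof -
  define \<rho> where "\<rho> x = exp_flat 0 x * exp_flat 0 (1 - x)" for x :: real
  have "C_inf (\<lambda>x::real. exp_flat 0 ((-1) * (x \<bullet> 1) + 1))"
    by (intro C_inf_compose_affine exp_flat_C_inf)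
  then have "C_inf \<rho>" unfolding \<rho>_def
    by (intro C_inf_mult exp_flat_C_inf) (simp add: add.commute)
  then have cont: "continuous_on S \<rho>" for S by (rule C_inf_continuous_on)
  have \<rho>_nonneg: "\<rho> x \<ge> 0" for x by (simp add: \<rho>_def exp_flat_def)
  have \<rho>_pos: "0 < x \<Longrightarrow> x < 1 \<Longrightarrow> \<rho> x > 0" for x by (simp add: \<rho>_def exp_flat_def)
  have \<rho>_zero: "x \<le> 0 \<or> x \<ge> 1 \<Longrightarrow> \<rho> x = 0" for x by (auto simp: \<rho>_def exp_flat_def)
  have "isCont \<rho> x" for x using cont[of UNIV] by (simp add: continuous_on_eq_continuous_at)
  then obtain F where F': "\<And>x. (F has_vector_derivative \<rho> x) (at x)"
    using einterval_antiderivative[of "-\<infinity>" \<infinity> \<rho>] by auto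
  then have F: "(F has_real_derivative \<rho> x) (at x)" for x
    by (simp add: has_real_derivative_iff_has_vector_derivative)
  have mono: "a \<le> b \<Longrightarrow> F a \<le> F b" for a b
    using F \<rho>_nonneg by (meson DERIV_nonneg_imp_nondecreasing)
  have stat: "(F has_real_derivative 0) (at x)" if "x \<le> 0 \<or> x \<ge> 1" for x
    using F[of x] \<rho>_zero[OF that] by simp
  have contF: "continuous_on S F" for S
    using F DERIV_isCont continuous_at_imp_continuous_on by metis
  have F0: "F x = F 0" if "x \<le> 0" for x
  proof (cases "x = 0")
    case False
    have "F 0 = F x"
      by (rule DERIV_isconst2[of x 0 F]) (use that False stat contF in simp_all)
    then show ?thesis by simp
  qed simp
  have F1: "F x = F 1" if "x \<ge> 1" for x
  proof (cases "x = 1")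
    case False
    show "F x = F 1"
      by (rule DERIV_isconst2[of 1 x F]) (use that False stat contF in simp_all)
  qed simp
  have "F 0 < F 1"
  proof -
    \<comment> \<open>The bump vanishes at 0 and 1, so strict growth is obtained on an inner
      interval and extended by monotonicity.\<close>
    have "F (1/4) < F (3/4)"
      by (rule DERIV_pos_imp_increasing[of "1/4" "3/4"]) (use F \<rho>_pos in force)+
    with mono[of 0 "1/4"] mono[of "3/4" 1] show ?thesis by simp
  qed
  define c where "c = F 1 - F 0"
  have c: "c > 0" using \<open>F 0 < F 1\<close> by (simp add: c_def)
  define \<theta> where "\<theta> x = (F x - F 0) / c" for x
  define \<theta>' where "\<theta>' x = inverse c * \<rho> x" for x
  have d: "(\<theta> has_real_derivative \<theta>' x) (at x)" for x
    unfolding \<theta>_def \<theta>'_def by (auto intro!: derivative_eq_intros F simp: c divide_inverse)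
  have "C_inf \<theta>'" unfolding \<theta>'_def by (intro C_inf_mult C_inf_const \<open>C_inf \<rho>\<close>)
  have bds: "F 0 \<le> F x \<and> F x \<le> F 1" for x
  proof (cases "x \<le> 0 \<or> x \<ge> 1")
    case True
    then show ?thesis using F0[of x] F1[of x] \<open>F 0 < F 1\<close> by auto
  next
    case False
    then show ?thesis using mono[of 0 x] mono[of x 1] by auto
  qed
  show ?thesis
  proof (rule that[of \<theta> \<theta>'])
    show "C_inf \<theta>" using C_inf_realI[OF d] \<open>C_inf \<theta>'\<close> .
    show "continuous_on UNIV \<theta>'" using \<open>C_inf \<theta>'\<close> by (rule C_inf_continuous_on)
    show "x \<le> 0 \<Longrightarrow> \<theta> x = 0" for x using F0[of x] by (simp add: \<theta>_def)
    show "x \<ge> 1 \<Longrightarrow> \<theta> x = 1" for x using F1[of x] c by (simp add: \<theta>_def c_def)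
    show "0 \<le> \<theta> x" for x using bds[of x] c by (simp add: \<theta>_def)
    show "\<theta> x \<le> 1" for x using bds[of x] c by (simp add: \<theta>_def c_def)
  qed (use c \<rho>_nonneg \<rho>_zero d in \<open>auto simp: \<theta>'_def\<close>)
qed

section \<open>Test functions\<close>

lemma test_functionE:
  assumes "test_function S \<psi>"
  obtains K where "C_inf \<psi>" "compact K" "K \<subseteq> S" "\<And>x. x \<notin> K \<Longrightarrow> \<psi> x = 0"
  using assms unfolding test_function_def by blast

lemma test_function_bounded:
  assumes "test_function S \<psi>"
  obtains B where "\<And>x. \<bar>\<psi> x\<bar> \<le> B"
proof -
  obtain K where K: "C_inf \<psi>" "compact K" "\<And>x. x \<notin> K \<Longrightarrow> \<psi> x = 0"
    using assms by (elim test_functionE) auto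
  have "bounded (\<psi> ` K)"
    using K compact_continuous_image[OF C_inf_continuous_on] compact_imp_bounded by blast
  then obtain B where "\<And>x. x \<in> K \<Longrightarrow> \<bar>\<psi> x\<bar> \<le> B" by (auto simp: bounded_iff)
  then have "\<bar>\<psi> x\<bar> \<le> \<bar>B\<bar>" for x using K(3)[of x] by (cases "x \<in> K") force+
  then show ?thesis using that by blast
qed

lemma test_function_borel_measurable:
  assumes "test_function S \<psi>"
  shows "\<psi> \<in> borel_measurable (lebesgue_on A)"
proof -
  have "\<psi> \<in> borel_measurable borel"
    using assms by (elim test_functionE) (intro borel_measurable_continuous_onI C_inf_continuous_on)
  then show ?thesis
    by (intro measurable_restrict_space1 measurable_completion) simp
qed

text \<open>Off the compact set the function vanishes on an open set, so its derivative vanishes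
  there too and the same compact set can be used.\<close>

lemma test_function_partial:
  assumes "test_function S \<psi>" "i \<in> Basis"
  shows "test_function S (\<lambda>x. frechet_derivative \<psi> (at x) i)"
proof -
  obtain K where K: "C_inf \<psi>" "compact K" "K \<subseteq> S" "\<And>x. x \<notin> K \<Longrightarrow> \<psi> x = 0"
    using assms by (elim test_functionE) auto
  have "frechet_derivative \<psi> (at x) i = 0" if "x \<notin> K" for x
  proof -
    have "((\<lambda>x. 0) has_derivative (\<lambda>y. 0)) (at x)" by simp
    then have "(\<psi> has_derivative (\<lambda>y. 0)) (at x)"
      by (rule has_derivative_transform_within_open[where s="-K"])
        (use that K compact_imp_closed in auto)
    then show ?thesis by (simp add: frechet_derivative_eqI)
  qed
  then show ?thesis using K C_inf_frechet[OF K(1) assms(2)] by (auto simp: test_function_def)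
qed

lemma integrable_mult_test_function:
  assumes "test_function S \<psi>" "integrable (lebesgue_on A) f"
  shows "integrable (lebesgue_on A) (\<lambda>x. f x * \<psi> x)"
proof -
  obtain B where B: "\<And>x. \<bar>\<psi> x\<bar> \<le> B" using test_function_bounded[OF assms(1)] by blast
  show ?thesis
  proof (rule Bochner_Integration.integrable_bound[where f="\<lambda>x. B * \<bar>f x\<bar>"])
    show "AE x in lebesgue_on A. norm (f x * \<psi> x) \<le> norm (B * \<bar>f x\<bar>)"
    proof (rule AE_I2)
      fix x
      have "\<bar>f x\<bar> * \<bar>\<psi> x\<bar> \<le> \<bar>B\<bar> * \<bar>f x\<bar>"
        using B[of x] by (subst mult.commute) (intro mult_right_mono, auto)
      then show "norm (f x * \<psi> x) \<le> norm (B * \<bar>f x\<bar>)" by (simp add: abs_mult)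
    qed
  qed (use assms test_function_borel_measurable[OF assms(1), of A] in \<open>auto intro: borel_measurable_times\<close>)
qed

section \<open>The fundamental lemma of the calculus of variations\<close>

lemma box_indicator_approx:
  fixes a b :: "'a::euclidean_space"
  obtains \<eta> :: "nat \<Rightarrow> 'a \<Rightarrow> real" where
    "\<And>n. test_function (box a b) (\<eta> n)" "\<And>n x. 0 \<le> \<eta> n x" "\<And>n x. \<eta> n x \<le> 1"
    "\<And>x. (\<lambda>n. \<eta> n x) \<longlonglongrightarrow> indicator (box a b) x"
proof -
  obtain \<theta> :: "real \<Rightarrow> real" where \<theta>: "C_inf \<theta>" "\<And>x. x \<le> 0 \<Longrightarrow> \<theta> x = 0" "\<And>x. x \<ge> 1 \<Longrightarrow> \<theta> x = 1"
    "\<And>x. 0 \<le> \<theta> x" "\<And>x. \<theta> x \<le> 1"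
    using smooth_step_ex by metis
  \<comment> \<open>Two steps per coordinate, scaled by n + 1 and shifted by 1: inside the box the
    factor is 0 up to distance 1/(n + 1) from a face, which keeps the support compact in the open
    box, and 1 beyond distance 2/(n + 1).\<close>
  define \<eta> where "\<eta> n x = (\<Prod>i\<in>Basis.
      \<theta> (real (Suc n) * (x \<bullet> i) + (- real (Suc n) * (a \<bullet> i) - 1)) *
      \<theta> (- real (Suc n) * (x \<bullet> i) + (real (Suc n) * (b \<bullet> i) - 1)))" for n and x :: 'a
  have zero: "\<eta> n x = 0" if "i \<in> Basis" "real (Suc n) * (x \<bullet> i - a \<bullet> i) \<le> 1 \<or> real (Suc n) * (b \<bullet> i - x \<bullet> i) \<le> 1" for n x i
  proof -
    have "\<theta> (real (Suc n) * (x \<bullet> i) + (- real (Suc n) * (a \<bullet> i) - 1)) *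
      \<theta> (- real (Suc n) * (x \<bullet> i) + (real (Suc n) * (b \<bullet> i) - 1)) = 0"
      using that(2) by (auto simp: algebra_simps intro!: \<theta>(2) simp del: of_nat_Suc)
    then show ?thesis unfolding \<eta>_def using that(1) by (intro prod_zero) auto
  qed
  show ?thesis
  proof (rule that[of \<eta>])
    fix n
    define K where "K = cbox (a + (1 / real (Suc n)) *\<^sub>R One) (b - (1 / real (Suc n)) *\<^sub>R One)"
    have "C_inf (\<eta> n)" unfolding \<eta>_def
      by (intro C_inf_prod C_inf_mult C_inf_compose_affine \<theta>) auto
    moreover have "K \<subseteq> box a b"
    proof
      fix x assume "x \<in> K"
      then have *: "a \<bullet> i + 1 / real (Suc n) \<le> x \<bullet> i \<and> x \<bullet> i \<le> b \<bullet> i - 1 / real (Suc n)" if "i \<in> Basis" for i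
        using that by (auto simp: K_def mem_box inner_add_left inner_diff_left inner_sum_left inner_Basis if_distrib sum.delta cong: if_cong)
      have "1 / real (Suc n) > 0" by simp
      with * show "x \<in> box a b" by (smt (verit) mem_box(1))
    qed
    moreover have "\<eta> n x = 0" if "x \<notin> K" for x
    proof -
      have "\<not> (\<forall>i\<in>Basis. a \<bullet> i + 1 / real (Suc n) \<le> x \<bullet> i \<and> x \<bullet> i \<le> b \<bullet> i - 1 / real (Suc n))"
        using that by (simp add: K_def mem_box inner_add_left inner_diff_left)
      then obtain i where i: "i \<in> Basis" "\<not> (a \<bullet> i + 1 / real (Suc n) \<le> x \<bullet> i \<and> x \<bullet> i \<le> b \<bullet> i - 1 / real (Suc n))"
        by blast
      then have "x \<bullet> i - a \<bullet> i \<le> 1 / real (Suc n) \<or> b \<bullet> i - x \<bullet> i \<le> 1 / real (Suc n)" by linarith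
      then have "real (Suc n) * (x \<bullet> i - a \<bullet> i) \<le> 1 \<or> real (Suc n) * (b \<bullet> i - x \<bullet> i) \<le> 1"
        by (simp add: field_simps)
      with i zero show ?thesis by blast
    qed
    ultimately show "test_function (box a b) (\<eta> n)"
      unfolding test_function_def K_def using compact_cbox by blast
  next
    show "0 \<le> \<eta> n x" for n x unfolding \<eta>_def by (intro prod_nonneg mult_nonneg_nonneg \<theta>)
    show "\<eta> n x \<le> 1" for n x unfolding \<eta>_def
      by (intro prod_le_1) (auto intro!: \<theta> mult_le_one mult_nonneg_nonneg)
  next
    fix x :: 'a
    show "(\<lambda>n. \<eta> n x) \<longlonglongrightarrow> indicator (box a b) x"
    proof (cases "x \<in> box a b")
      case True
      have "\<forall>\<^sub>F n in sequentially. real (Suc n) * (x \<bullet> i - a \<bullet> i) \<ge> 2 \<and> real (Suc n) * (b \<bullet> i - x \<bullet> i) \<ge> 2"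
        if "i \<in> Basis" for i
      proof -
        have *: "\<forall>\<^sub>F n in sequentially. real (Suc n) * c \<ge> 2" if "c > 0" for c
        proof -
          obtain N where N: "2 / c < real N" using reals_Archimedean2 by blast
          have "real (Suc n) * c \<ge> 2" if "n \<ge> N" for n
          proof -
            have "2 / c \<le> real (Suc n)" using N that by linarith
            then show ?thesis using \<open>c > 0\<close> by (simp add: field_simps)
          qed
          then show ?thesis by (auto simp: eventually_sequentially)
        qed
        have "0 < x \<bullet> i - a \<bullet> i" "0 < b \<bullet> i - x \<bullet> i" using True that by (auto simp: mem_box)
        then show ?thesis using * by (auto intro: eventually_conj)
      qed
      then have "\<forall>\<^sub>F n in sequentially. \<forall>i\<in>Basis. real (Suc n) * (x \<bullet> i - a \<bullet> i) \<ge> 2 \<and> real (Suc n) * (b \<bullet> i - x \<bullet> i) \<ge> 2"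
        by (simp add: eventually_ball_finite_distrib)
      then have "\<forall>\<^sub>F n in sequentially. \<eta> n x = 1"
      proof eventually_elim
        case (elim n)
        show ?case unfolding \<eta>_def
        proof (intro prod.neutral ballI)
          fix i :: 'a assume "i \<in> Basis"
          with elim have "real (Suc n) * (x \<bullet> i - a \<bullet> i) \<ge> 2" "real (Suc n) * (b \<bullet> i - x \<bullet> i) \<ge> 2" by auto
          then have "\<theta> (real (Suc n) * (x \<bullet> i) + (- real (Suc n) * (a \<bullet> i) - 1)) = 1"
            "\<theta> (- real (Suc n) * (x \<bullet> i) + (real (Suc n) * (b \<bullet> i) - 1)) = 1"
            by (auto intro!: \<theta>(3) simp: algebra_simps simp del: of_nat_Suc)
          then show "\<theta> (real (Suc n) * (x \<bullet> i) + (- real (Suc n) * (a \<bullet> i) - 1)) *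
            \<theta> (- real (Suc n) * (x \<bullet> i) + (real (Suc n) * (b \<bullet> i) - 1)) = 1" by simp
        qed
      qed
      with True show ?thesis by (simp add: tendsto_eventually)
    next
      case False
      then obtain i where i: "i \<in> Basis" "x \<bullet> i \<le> a \<bullet> i \<or> b \<bullet> i \<le> x \<bullet> i" by (auto simp: mem_box)
      have "real (Suc n) * (x \<bullet> i - a \<bullet> i) \<le> 1 \<or> real (Suc n) * (b \<bullet> i - x \<bullet> i) \<le> 1" for n
      proof -
        have "c \<le> 0 \<Longrightarrow> real (Suc n) * c \<le> 1" for c
          by (rule order_trans[of _ 0]) (auto intro: mult_nonneg_nonpos)
        then show ?thesis using i by (metis diff_le_0_iff_le)
      qed
      then have "\<eta> n x = 0" for n using zero[OF i(1)] by blast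
      with False show ?thesis by simp
    qed
  qed
qed

text \<open>Dynkin argument: open boxes are stable under intersection and generate the Borel sets,
  so the signed measure with density \<open>F\<close> vanishes on every Borel set, in particular
  where \<open>F\<close> is positive and where it is negative.\<close>

lemma AE_eq_0_if_box_integrals:
  fixes F :: "'a::euclidean_space \<Rightarrow> real"
  assumes F: "integrable lborel F"
    and box: "\<And>a b. (\<integral>x. indicator (box a b) x * F x \<partial>lborel) = 0"
  shows "AE x in lborel. F x = 0"
proof -
  have int: "integrable lborel (\<lambda>x. indicator A x * F x)" if "A \<in> sets borel" for A
    using integrable_mult_indicator[OF _ F, of A] that by simp
  \<comment> \<open>The complement case of the induction uses the integral over the whole space,
    obtained by exhausting it with growing boxes.\<close>
  have total: "(\<integral>x. F x \<partial>lborel) = 0"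
  proof -
    let ?B = "\<lambda>n::nat. box (- real n *\<^sub>R One) (real n *\<^sub>R One) :: 'a set"
    have "(\<lambda>n. \<integral>x. indicator (?B n) x * F x \<partial>lborel) \<longlonglongrightarrow> (\<integral>x. F x \<partial>lborel)"
    proof (rule integral_dominated_convergence[where w="\<lambda>x. \<bar>F x\<bar>"])
      show "AE x in lborel. (\<lambda>n. indicator (?B n) x * F x) \<longlonglongrightarrow> F x"
      proof (rule AE_I2)
        fix x :: 'a
        obtain N where N: "norm x < real N" using reals_Archimedean2 by blast
        have "x \<in> ?B n" if "n \<ge> N" for n
        proof -
          have "\<bar>x \<bullet> i\<bar> < real n" if "i \<in> Basis" for i
            using Basis_le_norm[OF that, of x] N \<open>n \<ge> N\<close> by linarith
          then show ?thesis by (force simp: mem_box)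
        qed
        then have "\<forall>\<^sub>F n in sequentially. indicator (?B n) x * F x = F x"
          by (auto simp: eventually_sequentially intro!: exI[of _ N])
        then show "(\<lambda>n. indicator (?B n) x * F x) \<longlonglongrightarrow> F x" by (rule tendsto_eventually)
      qed
    qed (use F in \<open>auto simp: indicator_def\<close>)
    then show ?thesis using box by (simp add: LIMSEQ_const_iff)
  qed
  have all: "(\<integral>x. indicator A x * F x \<partial>lborel) = 0" if "A \<in> sets borel" for A
  proof -
    have "Int_stable (range (\<lambda>(a, b). box a b :: 'a set))" by (auto simp: Int_stable_def box_Int_box)
    moreover have "range (\<lambda>(a, b). box a b :: 'a set) \<subseteq> Pow UNIV" by auto
    moreover have "A \<in> sigma_sets UNIV (range (\<lambda>(a, b). box a b))"
      using that unfolding borel_eq_box by simp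
    ultimately show ?thesis
    proof (induction rule: sigma_sets_induct_disjoint)
      case (basic A)
      then show ?case using box by auto
    next
      case empty
      show ?case by simp
    next
      case (compl A)
      then have A: "A \<in> sets borel" by (simp add: borel_eq_box)
      have "(\<integral>x. indicator (UNIV - A) x * F x \<partial>lborel) = (\<integral>x. F x - indicator A x * F x \<partial>lborel)"
        by (rule Bochner_Integration.integral_cong) (auto simp: indicator_def)
      also have "\<dots> = 0" using compl int[OF A] F total by simp
      finally show ?case .
    next
      case (union A)
      then have A: "\<And>i. A i \<in> sets borel" by (simp add: borel_eq_box subset_eq)
      have "(\<integral>x. indicator (\<Union>i. A i) x *\<^sub>R F x \<partial>lborel) = (\<Sum>i. \<integral>x. indicator (A i) x *\<^sub>R F x \<partial>lborel)"
        using lebesgue_integral_countable_add[of A lborel F] union A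
          integrable_mult_indicator[OF _ F, of "\<Union>i. A i"]
        by (auto simp: set_lebesgue_integral_def set_integrable_def disjoint_family_on_def)
      then show ?case using union by simp
    qed
  qed
  have [measurable]: "F \<in> borel_measurable borel" using F by auto
  \<comment> \<open>\<open>s = 1\<close> and \<open>s = - 1\<close> give the positive and the
    negative part.\<close>
  have pos: "AE x in lborel. indicator {x. s * F x > 0} x * (s * F x) = 0" for s
  proof (subst integral_nonneg_eq_0_iff_AE[symmetric])
    have "{x. s * F x > 0} \<in> sets borel" by measurable
    then show "integrable lborel (\<lambda>x. indicator {x. s * F x > 0} x * (s * F x))"
      "(\<integral>x. indicator {x. s * F x > 0} x * (s * F x) \<partial>lborel) = 0"
      using int[of "{x. s * F x > 0}"] all[of "{x. s * F x > 0}"]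
      by (auto simp: mult.left_commute[of _ s])
  qed (auto simp: indicator_def)
  show ?thesis
    using pos[of 1] pos[of "-1"] by eventually_elim (auto simp: indicator_def split: if_splits)
qed

text \<open>Cutoffs converge boundedly to the indicator of a box inside \<open>\<Omega>\<close>, so
  integrals over such boxes vanish. Cutting \<open>f\<close> off to one box makes the statement for
  the whole space applicable, and countably many boxes exhaust the open set.\<close>

lemma AE_eq_0_if_test_integrals:
  fixes f :: "'a::euclidean_space \<Rightarrow> real"
  assumes "open \<Omega>" and f: "integrable (lebesgue_on \<Omega>) f"
    and test: "\<And>\<psi>. test_function \<Omega> \<psi> \<Longrightarrow> (\<integral>x. f x * \<psi> x \<partial>lebesgue_on \<Omega>) = 0"
  shows "AE x in lebesgue_on \<Omega>. f x = 0"
proof -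
  have \<Omega>: "\<Omega> \<in> sets borel" using \<open>open \<Omega>\<close> by simp
  have box: "(\<integral>x. indicator (box a b) x * f x \<partial>lebesgue_on \<Omega>) = 0" if "box a b \<subseteq> \<Omega>" for a b
  proof -
    obtain \<eta> :: "nat \<Rightarrow> 'a \<Rightarrow> real" where \<eta>:
      "\<And>n. test_function (box a b) (\<eta> n)" "\<And>n x. 0 \<le> \<eta> n x" "\<And>n x. \<eta> n x \<le> 1"
      "\<And>x. (\<lambda>n. \<eta> n x) \<longlonglongrightarrow> indicator (box a b) x"
      using box_indicator_approx by blast
    have "(\<lambda>n. \<integral>x. f x * \<eta> n x \<partial>lebesgue_on \<Omega>) \<longlonglongrightarrow> (\<integral>x. f x * indicator (box a b) x \<partial>lebesgue_on \<Omega>)"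
    proof (rule integral_dominated_convergence[where w="\<lambda>x. \<bar>f x\<bar>"])
      show "(\<lambda>x. f x * \<eta> n x) \<in> borel_measurable (lebesgue_on \<Omega>)" for n
        using integrable_mult_test_function[OF \<eta>(1) f] by auto
      show "AE x in lebesgue_on \<Omega>. norm (f x * \<eta> n x) \<le> \<bar>f x\<bar>" for n
        using \<eta>(2)[of n] \<eta>(3)[of n] by (auto simp: abs_mult intro!: mult_left_le)
      show "AE x in lebesgue_on \<Omega>. (\<lambda>n. f x * \<eta> n x) \<longlonglongrightarrow> f x * indicator (box a b) x"
        using \<eta>(4) by (auto intro!: tendsto_intros)
      have "(indicator (box a b) :: 'a \<Rightarrow> real) \<in> borel_measurable (lebesgue_on \<Omega>)"
        by (intro measurable_restrict_space1 measurable_completion) simp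
      then show "(\<lambda>x. f x * indicator (box a b) x) \<in> borel_measurable (lebesgue_on \<Omega>)"
        using f by (auto intro: borel_measurable_times)
    qed (use f in auto)
    moreover have "(\<integral>x. f x * \<eta> n x \<partial>lebesgue_on \<Omega>) = 0" for n
      using test \<eta>(1) that unfolding test_function_def by (meson order_trans)
    ultimately have "(\<integral>x. f x * indicator (box a b) x \<partial>lebesgue_on \<Omega>) = 0"
      by (simp add: LIMSEQ_const_iff)
    then show ?thesis by (simp add: mult.commute)
  qed
  define F where "F x = indicator \<Omega> x * f x" for x
  have F: "integrable lebesgue F"
    using f \<Omega> by (simp add: integrable_restrict_space F_def[abs_def])
  have boxF: "(\<integral>x. indicator (box a b) x * F x \<partial>lebesgue) = 0" if "box a b \<subseteq> \<Omega>" for a b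
    using box[OF that] \<Omega> by (subst (asm) integral_restrict_space) (auto simp: F_def mult.left_commute)
  \<comment> \<open>The Dynkin argument works with Borel functions; \<open>G\<close> is a Borel
    version of the Lebesgue measurable \<open>F\<close>.\<close>
  obtain G where G: "G \<in> borel_measurable lborel" "AE x in lborel. F x = G x"
    using completion_ex_borel_measurable_real[of F lborel] F by auto
  have [measurable]: "G \<in> borel_measurable borel" using G by simp
  have G': "AE x in lebesgue. F x = G x" using G(2) by (rule AE_completion)
  have zero: "AE x in lebesgue. x \<in> box c d \<longrightarrow> F x = 0" if "box c d \<subseteq> \<Omega>" for c d
  proof -
    have m: "(\<lambda>x. indicator (box c d) x * G x) \<in> borel_measurable lborel" by measurable
    have "integrable lebesgue (\<lambda>x. indicator (box c d) x * F x)"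
      using integrable_mult_indicator[OF _ F, of "box c d"] by simp
    then have "integrable lebesgue (\<lambda>x. indicator (box c d) x * G x)"
      by (rule integrable_cong_AE_imp) (use G' m in \<open>auto intro: measurable_completion\<close>)
    then have "integrable lborel (\<lambda>x. indicator (box c d) x * G x)"
      using m integrable_completion by blast
    moreover have "(\<integral>x. indicator (box a b) x * (indicator (box c d) x * G x) \<partial>lborel) = 0" for a b
    proof -
      \<comment> \<open>A box intersected with \<open>box c d\<close> is again a box contained in
        \<open>\<Omega>\<close>.\<close>
      obtain p q where pq: "box a b \<inter> box c d = box p q" unfolding box_Int_box by blast
      have "(\<integral>x. indicator (box a b) x * (indicator (box c d) x * G x) \<partial>lborel)
          = (\<integral>x. indicator (box p q) x * G x \<partial>lborel)"
        by (rule Bochner_Integration.integral_cong) (auto simp: pq[symmetric] indicator_def)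
      also have "\<dots> = (\<integral>x. indicator (box p q) x * G x \<partial>lebesgue)"
        by (intro integral_completion[symmetric]) measurable
      also have "\<dots> = (\<integral>x. indicator (box p q) x * F x \<partial>lebesgue)"
      proof (rule integral_cong_AE)
        show "(\<lambda>x. indicator (box p q) x * G x) \<in> borel_measurable lebesgue"
          by (intro measurable_completion) measurable
        show "(\<lambda>x. indicator (box p q) x * F x) \<in> borel_measurable lebesgue"
          using integrable_mult_indicator[OF _ F, of "box p q"] by simp
      qed (use G' in auto)
      also have "\<dots> = 0" using boxF[of p q] pq that by auto
      finally show ?thesis .
    qed
    ultimately have "AE x in lborel. indicator (box c d) x * G x = 0"
      by (rule AE_eq_0_if_box_integrals)
    from AE_completion[OF this] G' show ?thesis
      by eventually_elim (auto simp: indicator_def split: if_splits)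
  qed
  obtain \<D> where \<D>: "countable \<D>" "\<D> \<subseteq> Pow \<Omega>" "\<And>X. X \<in> \<D> \<Longrightarrow> \<exists>a b. X = box a b" "\<Union>\<D> = \<Omega>"
    using open_countable_Union_open_box[OF \<open>open \<Omega>\<close>] by blast
  have "AE x in lebesgue. \<forall>X\<in>\<D>. x \<in> X \<longrightarrow> F x = 0"
    by (subst AE_ball_countable[OF \<D>(1)]) (use zero \<D> in blast)
  then have "AE x in lebesgue. x \<in> \<Omega> \<longrightarrow> f x = 0"
  proof eventually_elim
    case (elim x)
    then show ?case using \<D>(4) by (force simp: F_def)
  qed
  then show ?thesis using \<Omega> by (simp add: AE_restrict_space_iff)
qed

section \<open>Square-integrable functions\<close>

text \<open>Representatives are not identified, so this is only a semi-inner product: a vanishing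
  norm means equality to zero almost everywhere.\<close>

definition inner_L2 :: "'a measure \<Rightarrow> ('a \<Rightarrow> 'b::euclidean_space) \<Rightarrow> ('a \<Rightarrow> 'b) \<Rightarrow> real" where
  "inner_L2 N a b = (\<integral>x. a x \<bullet> b x \<partial>N)"

lemma L2_measurable: "a \<in> L2 N \<Longrightarrow> a \<in> borel_measurable N"
  and L2_integrable_sq: "a \<in> L2 N \<Longrightarrow> integrable N (\<lambda>x. (norm (a x))\<^sup>2)"
  by (auto simp: L2_def)

lemma L2_integrable_inner:
  assumes "a \<in> L2 N" "b \<in> L2 N"
  shows "integrable N (\<lambda>x. a x \<bullet> b x)"
proof (rule Bochner_Integration.integrable_bound)
  show "integrable N (\<lambda>x. (norm (a x))\<^sup>2 + (norm (b x))\<^sup>2)"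
    using assms by (intro Bochner_Integration.integrable_add L2_integrable_sq)
  show "(\<lambda>x. a x \<bullet> b x) \<in> borel_measurable N"
    using assms by (intro borel_measurable_inner L2_measurable)
  show "AE x in N. norm (a x \<bullet> b x) \<le> norm ((norm (a x))\<^sup>2 + (norm (b x))\<^sup>2)"
  proof (rule AE_I2)
    fix x
    have "\<bar>a x \<bullet> b x\<bar> \<le> norm (a x) * norm (b x)" by (rule Cauchy_Schwarz_ineq2)
    also have "\<dots> \<le> (norm (a x))\<^sup>2 + (norm (b x))\<^sup>2"
      using sum_squares_bound[of "norm (a x)" "norm (b x)"] zero_le_power2[of "norm (a x)"] zero_le_power2[of "norm (b x)"]
        mult_nonneg_nonneg[OF norm_ge_zero[of "a x"] norm_ge_zero[of "b x"]] by linarith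
    finally show "norm (a x \<bullet> b x) \<le> norm ((norm (a x))\<^sup>2 + (norm (b x))\<^sup>2)" by simp
  qed
qed

lemma L2_add: assumes "a \<in> L2 N" "b \<in> L2 N" shows "(\<lambda>x. a x + b x) \<in> L2 N"
proof -
  have "integrable N (\<lambda>x. (norm (a x))\<^sup>2 + 2 * (a x \<bullet> b x) + (norm (b x))\<^sup>2)"
    using assms by (intro Bochner_Integration.integrable_add integrable_mult_right L2_integrable_sq L2_integrable_inner)
  moreover have "(norm (a x + b x))\<^sup>2 = (norm (a x))\<^sup>2 + 2 * (a x \<bullet> b x) + (norm (b x))\<^sup>2" for x
    by (simp add: power2_norm_eq_inner inner_add_left inner_add_right inner_commute)
  ultimately show ?thesis
    using assms by (auto simp: L2_def)
qed

lemma L2_scaleR: "a \<in> L2 N \<Longrightarrow> (\<lambda>x. c *\<^sub>R a x) \<in> L2 N"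
  by (auto simp: L2_def power_mult_distrib)

lemma L2_diff: assumes "a \<in> L2 N" "b \<in> L2 N" shows "(\<lambda>x. a x - b x) \<in> L2 N"
  using L2_add[OF assms(1) L2_scaleR[OF assms(2), of "-1"]] by simp

lemma L2_zero: "(\<lambda>x. 0) \<in> L2 N"
  by (simp add: L2_def)

lemma L2_bound:
  assumes "a \<in> L2 N" "b \<in> borel_measurable N" "\<And>x. norm (b x) \<le> norm (a x)"
  shows "b \<in> L2 N"
proof -
  have "integrable N (\<lambda>x. (norm (b x))\<^sup>2)"
    by (rule Bochner_Integration.integrable_bound[OF L2_integrable_sq[OF assms(1)]])
      (use assms in \<open>auto intro!: AE_I2 power_mono\<close>)
  then show ?thesis using assms by (simp add: L2_def)
qed

lemma inner_L2_commute: "inner_L2 N a b = inner_L2 N b a"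
  by (simp add: inner_L2_def inner_commute)

lemma inner_L2_add_left:
  "a \<in> L2 N \<Longrightarrow> b \<in> L2 N \<Longrightarrow> c \<in> L2 N \<Longrightarrow> inner_L2 N (\<lambda>x. a x + b x) c = inner_L2 N a c + inner_L2 N b c"
  by (simp add: inner_L2_def inner_add_left L2_integrable_inner)

lemma inner_L2_add_right:
  "a \<in> L2 N \<Longrightarrow> b \<in> L2 N \<Longrightarrow> c \<in> L2 N \<Longrightarrow> inner_L2 N c (\<lambda>x. a x + b x) = inner_L2 N c a + inner_L2 N c b"
  by (simp add: inner_L2_def inner_add_right L2_integrable_inner)

lemma inner_L2_diff_left:
  "a \<in> L2 N \<Longrightarrow> b \<in> L2 N \<Longrightarrow> c \<in> L2 N \<Longrightarrow> inner_L2 N (\<lambda>x. a x - b x) c = inner_L2 N a c - inner_L2 N b c"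
  by (simp add: inner_L2_def inner_diff_left L2_integrable_inner)

lemma inner_L2_diff_right:
  "a \<in> L2 N \<Longrightarrow> b \<in> L2 N \<Longrightarrow> c \<in> L2 N \<Longrightarrow> inner_L2 N c (\<lambda>x. a x - b x) = inner_L2 N c a - inner_L2 N c b"
  by (simp add: inner_L2_def inner_diff_right L2_integrable_inner)

lemma inner_L2_scaleR_left: "inner_L2 N (\<lambda>x. r *\<^sub>R a x) c = r * inner_L2 N a c"
  by (simp add: inner_L2_def)

lemma inner_L2_scaleR_right: "inner_L2 N c (\<lambda>x. r *\<^sub>R a x) = r * inner_L2 N c a"
  by (simp add: inner_L2_def)

lemma inner_L2_self_nonneg: "0 \<le> inner_L2 N a a"
  by (simp add: inner_L2_def)

lemma norm_L2_eq: "norm_L2 N a = sqrt (inner_L2 N a a)"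
  by (simp add: norm_L2_def inner_L2_def power2_norm_eq_inner)

lemma norm_L2_nonneg: "0 \<le> norm_L2 N a"
  by (simp add: norm_L2_eq inner_L2_self_nonneg)

lemma norm_L2_sq: "(norm_L2 N a)\<^sup>2 = inner_L2 N a a"
  by (simp add: norm_L2_eq inner_L2_self_nonneg)

lemma norm_L2_scaleR: "norm_L2 N (\<lambda>x. c *\<^sub>R a x) = \<bar>c\<bar> * norm_L2 N a"
  by (simp add: norm_L2_eq inner_L2_scaleR_left inner_L2_scaleR_right real_sqrt_mult flip: mult.assoc)

lemma norm_L2_commute: "norm_L2 N (\<lambda>x. a x - b x) = norm_L2 N (\<lambda>x. b x - a x)"
  by (simp add: norm_L2_def norm_minus_commute)

text \<open>The squared norm of \<open>a - t b\<close> is a nonnegative quadratic polynomial in t.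
  In a semi-inner product its leading coefficient may vanish although b is not the zero function,
  hence the case split.\<close>

lemma inner_L2_le:
  assumes "a \<in> L2 N" "b \<in> L2 N"
  shows "\<bar>inner_L2 N a b\<bar> \<le> norm_L2 N a * norm_L2 N b"
proof -
  let ?A = "inner_L2 N a a" and ?B = "inner_L2 N a b" and ?C = "inner_L2 N b b"
  have q: "0 \<le> ?A - 2 * t * ?B + t\<^sup>2 * ?C" for t
  proof -
    have "0 \<le> inner_L2 N (\<lambda>x. a x - t *\<^sub>R b x) (\<lambda>x. a x - t *\<^sub>R b x)" by (rule inner_L2_self_nonneg)
    also have "\<dots> = ?A - 2 * t * ?B + t\<^sup>2 * ?C"
      using assms by (simp add: inner_L2_diff_left inner_L2_diff_right L2_diff L2_scaleR inner_L2_scaleR_left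
          inner_L2_scaleR_right inner_L2_commute[of N b a] power2_eq_square algebra_simps)
    finally show ?thesis .
  qed
  have "?B\<^sup>2 \<le> ?A * ?C"
  proof (cases "?C = 0")
    case True
    have "?B = 0"
    proof (rule ccontr)
      assume "?B \<noteq> 0"
      \<comment> \<open>This value of t would make the polynomial equal to - 1.\<close>
      then show False using q[of "(?A + 1) / (2 * ?B)"] True by (simp add: field_simps)
    qed
    then show ?thesis using True by simp
  next
    case False
    then have "?C > 0" using inner_L2_self_nonneg[of N b] by linarith
    \<comment> \<open>The minimiser of the polynomial.\<close>
    then show ?thesis using q[of "?B / ?C"] by (simp add: field_simps power2_eq_square)
  qed
  then have "sqrt (?B\<^sup>2) \<le> sqrt (?A * ?C)" by (rule real_sqrt_le_mono)
  then show ?thesis by (simp add: norm_L2_eq real_sqrt_mult)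
qed

lemma norm_L2_triangle:
  assumes "a \<in> L2 N" "b \<in> L2 N"
  shows "norm_L2 N (\<lambda>x. a x + b x) \<le> norm_L2 N a + norm_L2 N b"
proof (rule power2_le_imp_le)
  have "(norm_L2 N (\<lambda>x. a x + b x))\<^sup>2 = inner_L2 N a a + 2 * inner_L2 N a b + inner_L2 N b b"
    using assms by (simp add: norm_L2_sq inner_L2_add_left inner_L2_add_right L2_add
        inner_L2_commute[of N b a])
  also have "\<dots> \<le> (norm_L2 N a + norm_L2 N b)\<^sup>2"
    using inner_L2_le[OF assms] by (simp add: norm_L2_sq[symmetric] power2_sum)
  finally show "(norm_L2 N (\<lambda>x. a x + b x))\<^sup>2 \<le> (norm_L2 N a + norm_L2 N b)\<^sup>2" .
qed (simp add: norm_L2_nonneg)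

lemma norm_L2_diff_le:
  assumes "a \<in> L2 N" "b \<in> L2 N"
  shows "norm_L2 N (\<lambda>x. a x - b x) \<le> norm_L2 N a + norm_L2 N b"
  using norm_L2_triangle[OF assms(1) L2_scaleR[OF assms(2), of "-1"]] norm_L2_scaleR[of N "-1" b] by simp

lemma norm_L2_diff_abs:
  assumes "a \<in> L2 N" "b \<in> L2 N"
  shows "\<bar>norm_L2 N a - norm_L2 N b\<bar> \<le> norm_L2 N (\<lambda>x. a x - b x)"
  using norm_L2_triangle[OF L2_diff[OF assms] assms(2)] norm_L2_triangle[OF L2_diff[OF assms(2,1)] assms(1)]
    norm_L2_commute[of N a b] by simp

text \<open>The filter is arbitrary because the same estimate is used along sequences of simple
  functions and for continuity in time.\<close>

lemma inner_L2_tendsto: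
  assumes "\<And>n. a n \<in> L2 N" "a' \<in> L2 N" "\<And>n. b n \<in> L2 N" "b' \<in> L2 N"
    and a: "((\<lambda>n. norm_L2 N (\<lambda>x. a n x - a' x)) \<longlongrightarrow> 0) F"
    and b: "((\<lambda>n. norm_L2 N (\<lambda>x. b n x - b' x)) \<longlongrightarrow> 0) F"
  shows "((\<lambda>n. inner_L2 N (a n) (b n)) \<longlongrightarrow> inner_L2 N a' b') F"
proof -
  let ?e = "\<lambda>n. norm_L2 N (\<lambda>x. a n x - a' x)" and ?d = "\<lambda>n. norm_L2 N (\<lambda>x. b n x - b' x)"
  have "((\<lambda>n. inner_L2 N (a n) (b n) - inner_L2 N a' b') \<longlongrightarrow> 0) F"
  proof (rule Lim_null_comparison)
    show "((\<lambda>n. ?e n * (?d n + norm_L2 N b') + norm_L2 N a' * ?d n) \<longlongrightarrow> 0) F"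
      using tendsto_add[OF tendsto_mult[OF a tendsto_add[OF b tendsto_const[of "norm_L2 N b'"]]]
          tendsto_mult[OF tendsto_const[of "norm_L2 N a'"] b]] by simp
    show "\<forall>\<^sub>F n in F. norm (inner_L2 N (a n) (b n) - inner_L2 N a' b') \<le> ?e n * (?d n + norm_L2 N b') + norm_L2 N a' * ?d n"
    proof (rule always_eventually, rule allI)
      fix n
      note L = assms(1)[of n] assms(2) assms(3)[of n] assms(4)
      have "inner_L2 N (a n) (b n) - inner_L2 N a' b' =
          inner_L2 N (\<lambda>x. a n x - a' x) (b n) + inner_L2 N a' (\<lambda>x. b n x - b' x)"
        using L by (simp add: inner_L2_diff_left inner_L2_diff_right)
      moreover have "\<bar>inner_L2 N (\<lambda>x. a n x - a' x) (b n)\<bar> \<le> ?e n * norm_L2 N (b n)"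
        using L by (intro inner_L2_le L2_diff)
      moreover have "\<bar>inner_L2 N a' (\<lambda>x. b n x - b' x)\<bar> \<le> norm_L2 N a' * ?d n"
        using L by (intro inner_L2_le L2_diff)
      moreover have "norm_L2 N (b n) \<le> ?d n + norm_L2 N b'"
        using norm_L2_diff_abs[OF L(3,4)] by simp
      then have "?e n * norm_L2 N (b n) \<le> ?e n * (?d n + norm_L2 N b')"
        by (intro mult_left_mono norm_L2_nonneg)
      ultimately show "norm (inner_L2 N (a n) (b n) - inner_L2 N a' b') \<le> ?e n * (?d n + norm_L2 N b') + norm_L2 N a' * ?d n"
        unfolding real_norm_def by linarith
    qed
  qed
  then show ?thesis by (simp flip: Lim_null)
qed

lemma norm_L2_cong_AE:
  assumes "AE x in N. a x = b x" "a \<in> borel_measurable N" "b \<in> borel_measurable N"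
  shows "norm_L2 N a = norm_L2 N b"
  unfolding norm_L2_def using assms
  by (intro arg_cong[where f=sqrt] integral_cong_AE) auto

lemma inner_L2_cong_AE:
  assumes "AE x in N. a x = b x" "a \<in> L2 N" "b \<in> L2 N" "c \<in> L2 N"
  shows "inner_L2 N a c = inner_L2 N b c"
  unfolding inner_L2_def using assms L2_measurable[of _ N]
  by (intro integral_cong_AE) (auto intro!: borel_measurable_inner)

lemma norm_L2_eq_0_imp_AE:
  assumes "a \<in> L2 N" "norm_L2 N a = 0"
  shows "AE x in N. a x = 0"
proof -
  have "(\<integral>x. (norm (a x))\<^sup>2 \<partial>N) = 0" using assms(2) by (simp add: norm_L2_def)
  then have "AE x in N. (norm (a x))\<^sup>2 = 0"
    using assms(1) by (subst (asm) integral_nonneg_eq_0_iff_AE) (auto simp: L2_integrable_sq)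
  then show ?thesis by simp
qed

lemma L2_integrable:
  fixes a :: "'a \<Rightarrow> 'b::euclidean_space"
  assumes "finite_measure N" "a \<in> L2 N"
  shows "integrable N a"
proof (rule Bochner_Integration.integrable_bound)
  interpret finite_measure N by fact
  show "integrable N (\<lambda>x. 1 + (norm (a x))\<^sup>2)" using L2_integrable_sq[OF assms(2)] by simp
  show "AE x in N. norm (a x) \<le> norm (1 + (norm (a x))\<^sup>2)"
  proof (rule AE_I2)
    fix x
    have "2 * norm (a x) \<le> 1 + (norm (a x))\<^sup>2" using sum_squares_bound[of 1 "norm (a x)"] by simp
    then have "norm (a x) \<le> 1 + (norm (a x))\<^sup>2" using norm_ge_zero[of "a x"] by linarith
    then show "norm (a x) \<le> norm (1 + (norm (a x))\<^sup>2)" by simp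
  qed
qed (rule L2_measurable[OF assms(2)])

section \<open>Weak gradients\<close>

lemma finite_measure_bounded_open:
  assumes "open (\<Omega> :: 'a::euclidean_space set)" "bounded \<Omega>"
  shows "finite_measure (lebesgue_on \<Omega>)"
  using assms by (intro finite_measure_lebesgue_on) (simp add: lmeasurable_open)

text \<open>The fundamental lemma is applied to each component of the difference. Since
  \<open>weak_grad\<close> is a choice among representatives, identities for it rest on this
  uniqueness and hold almost everywhere.\<close>

lemma weak_grad_unique:
  assumes \<Omega>: "open \<Omega>" "bounded \<Omega>" and G: "G \<in> L2 (lebesgue_on \<Omega>)" "is_weak_grad \<Omega> w G"
    and G': "G' \<in> L2 (lebesgue_on \<Omega>)" "is_weak_grad \<Omega> w G'"
  shows "AE x in lebesgue_on \<Omega>. G x = G' x"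
proof -
  have int: "integrable (lebesgue_on \<Omega>) (\<lambda>x. H x \<bullet> i)" if "H \<in> L2 (lebesgue_on \<Omega>)" for H i
    using L2_integrable[OF finite_measure_bounded_open[OF \<Omega>] that] by simp
  have "AE x in lebesgue_on \<Omega>. (G x - G' x) \<bullet> i = 0" if "i \<in> Basis" for i
  proof (rule AE_eq_0_if_test_integrals[OF \<Omega>(1)])
    show "integrable (lebesgue_on \<Omega>) (\<lambda>x. (G x - G' x) \<bullet> i)"
      using int[OF L2_diff[OF G(1) G'(1)]] .
    fix \<psi> assume \<psi>: "test_function \<Omega> \<psi>"
    have "(\<integral>x. (G x - G' x) \<bullet> i * \<psi> x \<partial>lebesgue_on \<Omega>) =
        (\<integral>x. (G x \<bullet> i) * \<psi> x \<partial>lebesgue_on \<Omega>) - (\<integral>x. (G' x \<bullet> i) * \<psi> x \<partial>lebesgue_on \<Omega>)"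
      using integrable_mult_test_function[OF \<psi> int[OF G(1)]] integrable_mult_test_function[OF \<psi> int[OF G'(1)]]
      by (simp add: inner_diff_left left_diff_distrib)
    also have "\<dots> = 0" using G(2) G'(2) \<psi> that by (simp add: is_weak_grad_def)
    finally show "(\<integral>x. (G x - G' x) \<bullet> i * \<psi> x \<partial>lebesgue_on \<Omega>) = 0" .
  qed
  then have "AE x in lebesgue_on \<Omega>. \<forall>i\<in>Basis. (G x - G' x) \<bullet> i = 0"
    by (intro AE_finite_allI) auto
  then show ?thesis by eventually_elim (auto simp: inner_diff_left intro: euclidean_eqI)
qed

lemma weak_grad_works:
  assumes "w \<in> W12 \<Omega>"
  shows "weak_grad \<Omega> w \<in> L2 (lebesgue_on \<Omega>)" "is_weak_grad \<Omega> w (weak_grad \<Omega> w)"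
proof -
  have "\<exists>G. G \<in> L2 (lebesgue_on \<Omega>) \<and> is_weak_grad \<Omega> w G" using assms by (auto simp: W12_def)
  from someI_ex[OF this] show "weak_grad \<Omega> w \<in> L2 (lebesgue_on \<Omega>)" "is_weak_grad \<Omega> w (weak_grad \<Omega> w)"
    by (auto simp: weak_grad_def)
qed

lemma W12_L2: "w \<in> W12 \<Omega> \<Longrightarrow> w \<in> L2 (lebesgue_on \<Omega>)"
  by (simp add: W12_def)

lemma is_weak_grad_lincomb:
  assumes \<Omega>: "open \<Omega>" "bounded \<Omega>" and w: "w \<in> W12 \<Omega>" "w' \<in> W12 \<Omega>"
  shows "is_weak_grad \<Omega> (\<lambda>x. c * w x + d * w' x) (\<lambda>x. c *\<^sub>R weak_grad \<Omega> w x + d *\<^sub>R weak_grad \<Omega> w' x)"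
  unfolding is_weak_grad_def
proof (intro allI impI ballI)
  fix \<psi> :: "'a \<Rightarrow> real" and i :: 'a assume \<psi>: "test_function \<Omega> \<psi>" and i: "i \<in> Basis"
  note fin = finite_measure_bounded_open[OF \<Omega>]
  note d = test_function_partial[OF \<psi> i]
  note [simp] = integrable_mult_test_function[OF d L2_integrable[OF fin W12_L2[OF w(1)]]]
    integrable_mult_test_function[OF d L2_integrable[OF fin W12_L2[OF w(2)]]]
    integrable_mult_test_function[OF \<psi> integrable_inner_left[OF L2_integrable[OF fin weak_grad_works(1)[OF w(1)]]]]
    integrable_mult_test_function[OF \<psi> integrable_inner_left[OF L2_integrable[OF fin weak_grad_works(1)[OF w(2)]]]]
  have "(\<integral>x. (c * w x + d * w' x) * frechet_derivative \<psi> (at x) i \<partial>lebesgue_on \<Omega>) =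
      (\<integral>x. c * (w x * frechet_derivative \<psi> (at x) i) + d * (w' x * frechet_derivative \<psi> (at x) i) \<partial>lebesgue_on \<Omega>)"
    by (simp add: algebra_simps)
  also have "\<dots> = c * (\<integral>x. w x * frechet_derivative \<psi> (at x) i \<partial>lebesgue_on \<Omega>)
      + d * (\<integral>x. w' x * frechet_derivative \<psi> (at x) i \<partial>lebesgue_on \<Omega>)"
    by simp
  also have "\<dots> = - (c * (\<integral>x. (weak_grad \<Omega> w x \<bullet> i) * \<psi> x \<partial>lebesgue_on \<Omega>)
      + d * (\<integral>x. (weak_grad \<Omega> w' x \<bullet> i) * \<psi> x \<partial>lebesgue_on \<Omega>))"
    using weak_grad_works(2)[OF w(1)] weak_grad_works(2)[OF w(2)] \<psi> i by (simp add: is_weak_grad_def)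
  also have "c * (\<integral>x. (weak_grad \<Omega> w x \<bullet> i) * \<psi> x \<partial>lebesgue_on \<Omega>)
      + d * (\<integral>x. (weak_grad \<Omega> w' x \<bullet> i) * \<psi> x \<partial>lebesgue_on \<Omega>)
      = (\<integral>x. c * ((weak_grad \<Omega> w x \<bullet> i) * \<psi> x) + d * ((weak_grad \<Omega> w' x \<bullet> i) * \<psi> x) \<partial>lebesgue_on \<Omega>)"
    by simp
  also have "\<dots> = (\<integral>x. ((c *\<^sub>R weak_grad \<Omega> w x + d *\<^sub>R weak_grad \<Omega> w' x) \<bullet> i) * \<psi> x \<partial>lebesgue_on \<Omega>)"
    by (simp add: inner_add_left algebra_simps)
  finally show "(\<integral>x. (c * w x + d * w' x) * frechet_derivative \<psi> (at x) i \<partial>lebesgue_on \<Omega>) =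
      - (\<integral>x. ((c *\<^sub>R weak_grad \<Omega> w x + d *\<^sub>R weak_grad \<Omega> w' x) \<bullet> i) * \<psi> x \<partial>lebesgue_on \<Omega>)" .
qed

lemma W12_lincomb:
  assumes \<Omega>: "open \<Omega>" "bounded \<Omega>" and w: "w \<in> W12 \<Omega>" "w' \<in> W12 \<Omega>"
  shows "(\<lambda>x. c * w x + d * w' x) \<in> W12 \<Omega>"
    and "AE x in lebesgue_on \<Omega>. weak_grad \<Omega> (\<lambda>x. c * w x + d * w' x) x =
      c *\<^sub>R weak_grad \<Omega> w x + d *\<^sub>R weak_grad \<Omega> w' x"
proof -
  have G: "(\<lambda>x. c *\<^sub>R weak_grad \<Omega> w x + d *\<^sub>R weak_grad \<Omega> w' x) \<in> L2 (lebesgue_on \<Omega>)"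
    using w by (intro L2_add L2_scaleR weak_grad_works)
  have "(\<lambda>x. c *\<^sub>R w x + d *\<^sub>R w' x) \<in> L2 (lebesgue_on \<Omega>)"
    using w by (intro L2_add L2_scaleR W12_L2)
  then show W: "(\<lambda>x. c * w x + d * w' x) \<in> W12 \<Omega>"
    using G is_weak_grad_lincomb[OF assms] by (auto simp: W12_def)
  show "AE x in lebesgue_on \<Omega>. weak_grad \<Omega> (\<lambda>x. c * w x + d * w' x) x =
      c *\<^sub>R weak_grad \<Omega> w x + d *\<^sub>R weak_grad \<Omega> w' x"
    by (rule weak_grad_unique[OF \<Omega> weak_grad_works[OF W] G is_weak_grad_lincomb[OF assms]])
qed

lemma weak_grad_diff:
  assumes \<Omega>: "open \<Omega>" "bounded \<Omega>" and w: "w \<in> W12 \<Omega>" "w' \<in> W12 \<Omega>"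
  shows "(\<lambda>x. w x - w' x) \<in> W12 \<Omega>"
    and "AE x in lebesgue_on \<Omega>. weak_grad \<Omega> (\<lambda>x. w x - w' x) x = weak_grad \<Omega> w x - weak_grad \<Omega> w' x"
  using W12_lincomb[OF assms, of 1 "-1"] by simp_all

lemma weak_grad_scale:
  assumes \<Omega>: "open \<Omega>" "bounded \<Omega>" and w: "w \<in> W12 \<Omega>"
  shows "(\<lambda>x. c * w x) \<in> W12 \<Omega>"
    and "AE x in lebesgue_on \<Omega>. weak_grad \<Omega> (\<lambda>x. c * w x) x = c *\<^sub>R weak_grad \<Omega> w x"
  using W12_lincomb[OF \<Omega> w w, of c 0] by simp_all

lemma norm_V_diff:
  assumes \<Omega>: "open \<Omega>" "bounded \<Omega>" and w: "w \<in> W12 \<Omega>" "w' \<in> W12 \<Omega>"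
  shows "norm_V \<Omega> (\<lambda>x. w x - w' x) = norm_L2 (lebesgue_on \<Omega>) (\<lambda>x. weak_grad \<Omega> w x - weak_grad \<Omega> w' x)"
  unfolding norm_V_def
  by (rule norm_L2_cong_AE[OF weak_grad_diff(2)[OF assms]])
    (use w weak_grad_diff(1)[OF assms] in \<open>auto intro!: L2_measurable L2_diff weak_grad_works\<close>)

lemma norm_V_scale:
  assumes \<Omega>: "open \<Omega>" "bounded \<Omega>" and w: "w \<in> W12 \<Omega>"
  shows "norm_V \<Omega> (\<lambda>x. c * w x) = \<bar>c\<bar> * norm_V \<Omega> w"
proof -
  have "norm_V \<Omega> (\<lambda>x. c * w x) = norm_L2 (lebesgue_on \<Omega>) (\<lambda>x. c *\<^sub>R weak_grad \<Omega> w x)"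
    unfolding norm_V_def
    by (rule norm_L2_cong_AE[OF weak_grad_scale(2)[OF assms]])
      (use w weak_grad_scale(1)[OF assms] in \<open>auto intro!: L2_measurable L2_scaleR weak_grad_works\<close>)
  then show ?thesis by (simp add: norm_V_def norm_L2_scaleR)
qed

section \<open>Traces, the space \<open>W12_D\<close> and its dual\<close>

lemma surface_measure_borel_measurable:
  assumes "h \<in> borel_measurable borel"
  shows "h \<in> borel_measurable (surface_measure \<Omega>)"
  unfolding surface_measure_def
  \<comment> \<open>\<open>measure_of\<close> takes its measurable sets from the Borel sets,
    whatever the set function is.\<close>
  by (intro measurable_restrict_space1) (use assms in \<open>simp add: measurable_def\<close>)

text \<open>Scaling the approximating sequence multiplies its two null sequences by
  \<open>\<bar>c\<bar>\<close> and \<open>c\<^sup>2\<close>. This is what lets elements of V be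
  normalised in \<open>V_dual_bound\<close>.\<close>

lemma has_trace_scale:
  assumes \<Omega>: "open \<Omega>" "bounded \<Omega>" and w: "w \<in> W12 \<Omega>" and h: "has_trace \<Omega> w h"
  shows "has_trace \<Omega> (\<lambda>x. c * w x) (\<lambda>x. c * h x)"
proof -
  obtain \<phi> where \<phi>: "\<And>k. C_inf (\<phi> k)" "\<And>k. \<phi> k \<in> W12 \<Omega>"
    "(\<lambda>k. norm_W12 \<Omega> (\<phi> k - w)) \<longlonglongrightarrow> 0"
    "(\<lambda>k. \<integral>\<^sup>+ x. ennreal ((\<phi> k x - h x)\<^sup>2) \<partial>surface_measure \<Omega>) \<longlonglongrightarrow> 0"
    using h unfolding has_trace_def by blast
  have hL: "h \<in> L2 (surface_measure \<Omega>)" using h by (simp add: has_trace_def)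
  let ?\<phi> = "\<lambda>k x. c * \<phi> k x"
  have "norm_W12 \<Omega> (?\<phi> k - (\<lambda>x. c * w x)) = \<bar>c\<bar> * norm_W12 \<Omega> (\<phi> k - w)" for k
  proof -
    let ?w = "\<lambda>x. \<phi> k x - w x"
    have W: "?w \<in> W12 \<Omega>" using weak_grad_diff(1)[OF \<Omega> \<phi>(2) w] .
    have e: "?\<phi> k - (\<lambda>x. c * w x) = (\<lambda>x. c *\<^sub>R ?w x)" by (auto simp: algebra_simps)
    have "norm_L2 (lebesgue_on \<Omega>) (weak_grad \<Omega> (\<lambda>x. c *\<^sub>R ?w x)) = \<bar>c\<bar> * norm_L2 (lebesgue_on \<Omega>) (weak_grad \<Omega> ?w)"
      using norm_V_scale[OF \<Omega> W, of c] by (simp add: norm_V_def)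
    moreover have "sqrt ((\<bar>c\<bar> * p)\<^sup>2 + (\<bar>c\<bar> * q)\<^sup>2) = \<bar>c\<bar> * sqrt (p\<^sup>2 + q\<^sup>2)" for p q
    proof -
      have "(\<bar>c\<bar> * p)\<^sup>2 + (\<bar>c\<bar> * q)\<^sup>2 = \<bar>c\<bar>\<^sup>2 * (p\<^sup>2 + q\<^sup>2)" by (simp add: power_mult_distrib algebra_simps)
      then show ?thesis by (simp add: real_sqrt_mult)
    qed
    ultimately show ?thesis unfolding e norm_W12_def norm_L2_scaleR fun_diff_def by simp
  qed
  then have 1: "(\<lambda>k. norm_W12 \<Omega> (?\<phi> k - (\<lambda>x. c * w x))) \<longlonglongrightarrow> 0"
    using tendsto_mult_right_zero[OF \<phi>(3), of "\<bar>c\<bar>"] by simp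
  have "(\<integral>\<^sup>+ x. ennreal ((?\<phi> k x - c * h x)\<^sup>2) \<partial>surface_measure \<Omega>) =
      ennreal (c\<^sup>2) * (\<integral>\<^sup>+ x. ennreal ((\<phi> k x - h x)\<^sup>2) \<partial>surface_measure \<Omega>)" for k
  proof (subst nn_integral_cmult[symmetric])
    show "(\<lambda>x. ennreal ((\<phi> k x - h x)\<^sup>2)) \<in> borel_measurable (surface_measure \<Omega>)"
      using L2_measurable[OF hL] surface_measure_borel_measurable[OF borel_measurable_continuous_onI[OF C_inf_continuous_on[OF \<phi>(1)]]]
      by measurable
  qed (auto simp: ennreal_mult[symmetric] power_mult_distrib[symmetric] right_diff_distrib)
  then have 2: "(\<lambda>k. \<integral>\<^sup>+ x. ennreal ((?\<phi> k x - c * h x)\<^sup>2) \<partial>surface_measure \<Omega>) \<longlonglongrightarrow> 0"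
    using ennreal_tendsto_cmult[OF _ \<phi>(4), of "ennreal (c\<^sup>2)"] by simp
  have "(\<lambda>x. c * h x) \<in> L2 (surface_measure \<Omega>)" using L2_scaleR[OF hL, of c] by simp
  then show ?thesis unfolding has_trace_def
    by (intro conjI exI[of _ ?\<phi>] allI 1 2 C_inf_mult[OF C_inf_const \<phi>(1)] weak_grad_scale(1)[OF \<Omega> \<phi>(2)])
qed

lemma W12_D_scale:
  assumes \<Omega>: "open \<Omega>" "bounded \<Omega>" and w: "w \<in> W12_D \<Omega> \<Gamma>D"
  shows "(\<lambda>x. c * w x) \<in> W12_D \<Omega> \<Gamma>D"
proof -
  obtain h where h: "has_trace \<Omega> w h" "AE x in surface_measure \<Omega>. x \<in> \<Gamma>D \<longrightarrow> h x = 0"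
    and W: "w \<in> W12 \<Omega>" using w by (auto simp: W12_D_def)
  have "AE x in surface_measure \<Omega>. x \<in> \<Gamma>D \<longrightarrow> c * h x = 0"
    using h(2) by eventually_elim auto
  then show ?thesis
    using has_trace_scale[OF \<Omega> W h(1), of c] weak_grad_scale(1)[OF \<Omega> W, of c] unfolding W12_D_def by blast
qed

lemma W12_D_W12: "w \<in> W12_D \<Omega> \<Gamma>D \<Longrightarrow> w \<in> W12 \<Omega>"
  by (simp add: W12_D_def)

text \<open>The supremum is applied to \<open>w\<close> divided by its norm; if the norm is 0, the
  bound in \<open>V_dual\<close> already forces \<open>l w = 0\<close>.\<close>

lemma V_dual_bound:
  assumes \<Omega>: "open \<Omega>" "bounded \<Omega>" and l: "l \<in> V_dual \<Omega> \<Gamma>D" and w: "w \<in> W12_D \<Omega> \<Gamma>D"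
  shows "\<bar>l w\<bar> \<le> norm_V_dual \<Omega> \<Gamma>D l * norm_V \<Omega> w"
proof (cases "norm_V \<Omega> w = 0")
  case True
  then show ?thesis using l w by (force simp: V_dual_def)
next
  case False
  define n where "n = norm_V \<Omega> w"
  have n: "n > 0" using False norm_L2_nonneg[of _ "weak_grad \<Omega> w"] unfolding n_def norm_V_def
    by (metis less_eq_real_def)
  let ?w = "\<lambda>x. inverse n * w x"
  have "norm_V \<Omega> ?w = 1" using norm_V_scale[OF \<Omega> W12_D_W12[OF w], of "inverse n"] n by (simp add: n_def)
  moreover have "?w \<in> W12_D \<Omega> \<Gamma>D" by (rule W12_D_scale[OF \<Omega> w])
  moreover obtain C where C: "\<And>v. v \<in> W12_D \<Omega> \<Gamma>D \<Longrightarrow> \<bar>l v\<bar> \<le> C * norm_V \<Omega> v"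
    using l unfolding V_dual_def by blast
  \<comment> \<open>\<open>norm_V_dual\<close> is a supremum in the reals, and an upper bound only
    once the set is known to be bounded.\<close>
  have "bdd_above ((\<lambda>v. \<bar>l v\<bar>) ` {v \<in> W12_D \<Omega> \<Gamma>D. norm_V \<Omega> v \<le> 1})"
  proof (rule bdd_aboveI2[where M="\<bar>C\<bar>"])
    fix v assume v: "v \<in> {v \<in> W12_D \<Omega> \<Gamma>D. norm_V \<Omega> v \<le> 1}"
    have "\<bar>l v\<bar> \<le> C * norm_V \<Omega> v" using C v by simp
    also have "\<dots> \<le> \<bar>C\<bar> * 1" using v norm_L2_nonneg by (intro mult_mono) (auto simp: norm_V_def)
    finally show "\<bar>l v\<bar> \<le> \<bar>C\<bar>" by simp
  qed
  ultimately have "\<bar>l ?w\<bar> \<le> norm_V_dual \<Omega> \<Gamma>D l"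
    unfolding norm_V_dual_def by (intro cSUP_upper) auto
  moreover have "l ?w = inverse n * l w"
  proof -
    have "l (\<lambda>x. inverse n * w x + 0 * w x) = inverse n * l w + 0 * l w"
      using l w unfolding V_dual_def by blast
    then show ?thesis by simp
  qed
  ultimately have "inverse n * \<bar>l w\<bar> \<le> norm_V_dual \<Omega> \<Gamma>D l" using n by (simp only: abs_mult) simp
  from mult_left_mono[OF this, of n] n show ?thesis
    unfolding n_def[symmetric] by (simp add: mult.assoc[symmetric] mult.commute)
qed

section \<open>Bochner measurable functions with values in a space of square-integrable functions\<close>

text \<open>Completeness of Lebesgue measure, carried to a subset by extending functions by 0.
  Bochner functions are known as limits almost everywhere, so measurability of their pairings is
  reached in this way.\<close>

lemma borel_measurable_lebesgue_on_AE:
  fixes f g :: "'a::euclidean_space \<Rightarrow> 'b::euclidean_space"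
  assumes S: "S \<in> sets lebesgue" and f: "f \<in> borel_measurable (lebesgue_on S)"
    and eq: "AE x in lebesgue_on S. f x = g x"
  shows "g \<in> borel_measurable (lebesgue_on S)"
proof -
  have "(\<lambda>x. if x \<in> S then f x else 0) \<in> borel_measurable lebesgue"
    using f S by (rule borel_measurable_if_I)
  moreover have "AE x in lebesgue. (if x \<in> S then f x else 0) = (if x \<in> S then g x else 0)"
  proof -
    have "AE x in lebesgue. x \<in> S \<longrightarrow> f x = g x" using eq S by (simp add: AE_restrict_space_iff)
    then show ?thesis by eventually_elim auto
  qed
  ultimately have "(\<lambda>x. if x \<in> S then g x else 0) \<in> borel_measurable lebesgue"
    by (rule borel_measurable_AE)
  then show ?thesis using S by (simp add: borel_measurable_if)
qed

lemma borel_measurable_lebesgue_on_AE_lim: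
  fixes f :: "nat \<Rightarrow> 'a::euclidean_space \<Rightarrow> 'b::euclidean_space"
  assumes S: "S \<in> sets lebesgue" and f: "\<And>n. f n \<in> borel_measurable (lebesgue_on S)"
    and lim: "AE x in lebesgue_on S. (\<lambda>n. f n x) \<longlonglongrightarrow> g x"
  shows "g \<in> borel_measurable (lebesgue_on S)"
proof (rule borel_measurable_lebesgue_on_AE[OF S borel_measurable_lim_metric[OF f]])
  show "AE x in lebesgue_on S. lim (\<lambda>n. f n x) = g x"
    using lim by eventually_elim (rule limI)
qed

lemma integral_cong_AE_lebesgue_on:
  fixes f g :: "'a::euclidean_space \<Rightarrow> 'b::euclidean_space"
  assumes "S \<in> sets lebesgue" "AE x in lebesgue_on S. f x = g x" "f \<in> borel_measurable (lebesgue_on S)"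
  shows "integral\<^sup>L (lebesgue_on S) f = integral\<^sup>L (lebesgue_on S) g"
  by (rule integral_cong_AE[OF assms(3) borel_measurable_lebesgue_on_AE[OF assms(1,3,2)] assms(2)])

lemma Ioo_lebesgue: "{a<..<b::real} \<in> sets lebesgue"
  by simp

lemma finite_measure_Ioo: "finite_measure (lebesgue_on {a<..<b::real})"
  by (rule finite_measure_bounded_open) auto

text \<open>\<open>bochner_L2\<close> without square integrability, so that norms and pairings can
  be shown measurable before they are shown integrable.\<close>

definition bochner_meas :: "real \<Rightarrow> 'a measure \<Rightarrow> (real \<Rightarrow> 'a \<Rightarrow> 'b::euclidean_space) \<Rightarrow> bool" where
  "bochner_meas T N U \<longleftrightarrow>
     (AE t in lebesgue_on {0<..<T}. U t \<in> L2 N) \<and>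
     (\<exists>s. (\<forall>k::nat. simple_function (lebesgue_on {0<..<T}) (s k) \<and> s k ` {0<..<T} \<subseteq> L2 N) \<and>
          (AE t in lebesgue_on {0<..<T}. (\<lambda>k. norm_L2 N (\<lambda>x. U t x - s k t x)) \<longlonglongrightarrow> 0))"

definition L2_bochner :: "real \<Rightarrow> 'a measure \<Rightarrow> (real \<Rightarrow> 'a \<Rightarrow> 'b::euclidean_space) set" where
  "L2_bochner T N = bochner_L2 T (L2 N) (norm_L2 N)"

lemma L2_bochner_iff:
  "U \<in> L2_bochner T N \<longleftrightarrow> bochner_meas T N U \<and> integrable (lebesgue_on {0<..<T}) (\<lambda>t. (norm_L2 N (U t))\<^sup>2)"
  unfolding L2_bochner_def bochner_L2_def bochner_meas_def fun_diff_def by blast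

lemma L2_Y_eq: "L2_Y \<Omega> T = L2_bochner T (lebesgue_on \<Omega>)"
  by (simp add: L2_Y_def L2_bochner_def)

lemma bochner_measE:
  assumes "bochner_meas T N U"
  obtains s where "\<And>k::nat. simple_function (lebesgue_on {0<..<T}) (s k)"
    "\<And>k t. t \<in> {0<..<T} \<Longrightarrow> s k t \<in> L2 N"
    "AE t in lebesgue_on {0<..<T}. (\<lambda>k. norm_L2 N (\<lambda>x. U t x - s k t x)) \<longlonglongrightarrow> 0"
  using assms unfolding bochner_meas_def by blast

lemma bochner_meas_L2: "bochner_meas T N U \<Longrightarrow> AE t in lebesgue_on {0<..<T}. U t \<in> L2 N"
  by (simp add: bochner_meas_def)

lemma AE_Ioo: "AE t in lebesgue_on {a<..<b::real}. t \<in> {a<..<b}"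
  using AE_space[of "lebesgue_on {a<..<b}"] by simp

text \<open>The pairing of two simple functions is a real simple function, and the pairing is
  continuous in both arguments.\<close>

lemma bochner_meas_inner:
  assumes U: "bochner_meas T N U" and V: "bochner_meas T N V"
  shows "(\<lambda>t. inner_L2 N (U t) (V t)) \<in> borel_measurable (lebesgue_on {0<..<T})"
proof -
  obtain s where s: "\<And>k::nat. simple_function (lebesgue_on {0<..<T}) (s k)"
    "\<And>k t. t \<in> {0<..<T} \<Longrightarrow> s k t \<in> L2 N"
    "AE t in lebesgue_on {0<..<T}. (\<lambda>k. norm_L2 N (\<lambda>x. U t x - s k t x)) \<longlonglongrightarrow> 0"
    using bochner_measE[OF U] by blast
  obtain r where r: "\<And>k::nat. simple_function (lebesgue_on {0<..<T}) (r k)"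
    "\<And>k t. t \<in> {0<..<T} \<Longrightarrow> r k t \<in> L2 N"
    "AE t in lebesgue_on {0<..<T}. (\<lambda>k. norm_L2 N (\<lambda>x. V t x - r k t x)) \<longlonglongrightarrow> 0"
    using bochner_measE[OF V] by blast
  show ?thesis
  proof (rule borel_measurable_lebesgue_on_AE_lim[OF Ioo_lebesgue])
    show "(\<lambda>t. inner_L2 N (s k t) (r k t)) \<in> borel_measurable (lebesgue_on {0<..<T})" for k
      by (rule borel_measurable_simple_function[OF simple_function_compose2[OF s(1) r(1)]])
    show "AE t in lebesgue_on {0<..<T}. (\<lambda>k. inner_L2 N (s k t) (r k t)) \<longlonglongrightarrow> inner_L2 N (U t) (V t)"
      using s(3) r(3) bochner_meas_L2[OF U] bochner_meas_L2[OF V] AE_Ioo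
      by eventually_elim
        (intro inner_L2_tendsto s r; simp add: norm_L2_commute[of N "s _ _"] norm_L2_commute[of N "r _ _"])
  qed
qed

lemma bochner_meas_norm:
  "bochner_meas T N U \<Longrightarrow> (\<lambda>t. norm_L2 N (U t)) \<in> borel_measurable (lebesgue_on {0<..<T})"
  unfolding norm_L2_eq using bochner_meas_inner[of T N U U] by measurable

text \<open>A Lipschitz map sends simple functions to simple functions and approximations to
  approximations. Differences, multiples and pointwise contractions are obtained as
  instances.\<close>

lemma bochner_meas_comp2:
  assumes U: "bochner_meas T N U" and V: "bochner_meas T N V"
    and \<Phi>: "\<And>a b. a \<in> L2 N \<Longrightarrow> b \<in> L2 N \<Longrightarrow> \<Phi> a b \<in> L2 N'"
    and lip: "\<And>a b a' b'. a \<in> L2 N \<Longrightarrow> b \<in> L2 N \<Longrightarrow> a' \<in> L2 N \<Longrightarrow> b' \<in> L2 N \<Longrightarrow>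
      norm_L2 N' (\<lambda>x. \<Phi> a b x - \<Phi> a' b' x) \<le> C * (norm_L2 N (\<lambda>x. a x - a' x) + norm_L2 N (\<lambda>x. b x - b' x))"
  shows "bochner_meas T N' (\<lambda>t. \<Phi> (U t) (V t))"
proof -
  obtain s where s: "\<And>k::nat. simple_function (lebesgue_on {0<..<T}) (s k)"
    "\<And>k t. t \<in> {0<..<T} \<Longrightarrow> s k t \<in> L2 N"
    "AE t in lebesgue_on {0<..<T}. (\<lambda>k. norm_L2 N (\<lambda>x. U t x - s k t x)) \<longlonglongrightarrow> 0"
    using bochner_measE[OF U] by blast
  obtain r where r: "\<And>k::nat. simple_function (lebesgue_on {0<..<T}) (r k)"
    "\<And>k t. t \<in> {0<..<T} \<Longrightarrow> r k t \<in> L2 N"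
    "AE t in lebesgue_on {0<..<T}. (\<lambda>k. norm_L2 N (\<lambda>x. V t x - r k t x)) \<longlonglongrightarrow> 0"
    using bochner_measE[OF V] by blast
  have "AE t in lebesgue_on {0<..<T}. \<Phi> (U t) (V t) \<in> L2 N'"
    using bochner_meas_L2[OF U] bochner_meas_L2[OF V] by eventually_elim (rule \<Phi>)
  moreover have "simple_function (lebesgue_on {0<..<T}) (\<lambda>t. \<Phi> (s k t) (r k t))" for k
    by (rule simple_function_compose2[OF s(1) r(1)])
  moreover have "\<Phi> (s k t) (r k t) \<in> L2 N'" if "t \<in> {0<..<T}" for k t
    using that by (intro \<Phi> s r)
  moreover have "AE t in lebesgue_on {0<..<T}.
      (\<lambda>k. norm_L2 N' (\<lambda>x. \<Phi> (U t) (V t) x - \<Phi> (s k t) (r k t) x)) \<longlonglongrightarrow> 0"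
    using s(3) r(3) bochner_meas_L2[OF U] bochner_meas_L2[OF V] AE_Ioo
  proof eventually_elim
    case (elim t)
    show ?case
    proof (rule Lim_null_comparison)
      show "(\<lambda>k. C * (norm_L2 N (\<lambda>x. U t x - s k t x) + norm_L2 N (\<lambda>x. V t x - r k t x))) \<longlonglongrightarrow> 0"
        using tendsto_mult_right_zero[OF tendsto_add_zero[OF elim(1,2)]] .
      show "\<forall>\<^sub>F k in sequentially. norm (norm_L2 N' (\<lambda>x. \<Phi> (U t) (V t) x - \<Phi> (s k t) (r k t) x))
          \<le> C * (norm_L2 N (\<lambda>x. U t x - s k t x) + norm_L2 N (\<lambda>x. V t x - r k t x))"
        using lip[OF elim(3,4) s(2)[OF elim(5)] r(2)[OF elim(5)]] by (simp add: norm_L2_nonneg)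
    qed
  qed
  ultimately show ?thesis unfolding bochner_meas_def
    by (intro conjI exI[of _ "\<lambda>k t. \<Phi> (s k t) (r k t)"] allI image_subsetI; blast)
qed

lemma L2_bochner_comp2:
  assumes U: "U \<in> L2_bochner T N" and V: "V \<in> L2_bochner T N"
    and \<Phi>: "\<And>a b. a \<in> L2 N \<Longrightarrow> b \<in> L2 N \<Longrightarrow> \<Phi> a b \<in> L2 N'"
    and lip: "\<And>a b a' b'. a \<in> L2 N \<Longrightarrow> b \<in> L2 N \<Longrightarrow> a' \<in> L2 N \<Longrightarrow> b' \<in> L2 N \<Longrightarrow>
      norm_L2 N' (\<lambda>x. \<Phi> a b x - \<Phi> a' b' x) \<le> C * (norm_L2 N (\<lambda>x. a x - a' x) + norm_L2 N (\<lambda>x. b x - b' x))"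
    and zero: "\<And>x. \<Phi> (\<lambda>x. 0) (\<lambda>x. 0) x = 0"
  shows "(\<lambda>t. \<Phi> (U t) (V t)) \<in> L2_bochner T N'"
  unfolding L2_bochner_iff
proof
  have U': "bochner_meas T N U" and V': "bochner_meas T N V" using U V by (auto simp: L2_bochner_iff)
  show m: "bochner_meas T N' (\<lambda>t. \<Phi> (U t) (V t))"
    by (rule bochner_meas_comp2[OF U' V' \<Phi> lip])
  show "integrable (lebesgue_on {0<..<T}) (\<lambda>t. (norm_L2 N' (\<Phi> (U t) (V t)))\<^sup>2)"
  proof (rule Bochner_Integration.integrable_bound)
    show "integrable (lebesgue_on {0<..<T}) (\<lambda>t. 2 * C\<^sup>2 * ((norm_L2 N (U t))\<^sup>2 + (norm_L2 N (V t))\<^sup>2))"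
      using U V by (simp add: L2_bochner_iff)
    show "(\<lambda>t. (norm_L2 N' (\<Phi> (U t) (V t)))\<^sup>2) \<in> borel_measurable (lebesgue_on {0<..<T})"
      by (intro borel_measurable_power bochner_meas_norm m)
    show "AE t in lebesgue_on {0<..<T}. norm ((norm_L2 N' (\<Phi> (U t) (V t)))\<^sup>2) \<le>
        norm (2 * C\<^sup>2 * ((norm_L2 N (U t))\<^sup>2 + (norm_L2 N (V t))\<^sup>2))"
      using bochner_meas_L2[OF U'] bochner_meas_L2[OF V']
    proof eventually_elim
      case (elim t)
      let ?u = "norm_L2 N (U t)" and ?v = "norm_L2 N (V t)"
      \<comment> \<open>Comparison with the zero functions turns the Lipschitz bound into linear
        growth.\<close>
      have "norm_L2 N' (\<Phi> (U t) (V t)) \<le> C * (?u + ?v)"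
        using lip[OF elim L2_zero L2_zero] zero by simp
      then have "(norm_L2 N' (\<Phi> (U t) (V t)))\<^sup>2 \<le> (C * (?u + ?v))\<^sup>2"
        by (intro power_mono norm_L2_nonneg)
      also have "\<dots> = C\<^sup>2 * (?u + ?v)\<^sup>2" by (simp add: power_mult_distrib)
      also have "\<dots> \<le> C\<^sup>2 * (2 * (?u\<^sup>2 + ?v\<^sup>2))"
        using sum_squares_bound[of ?u ?v] by (intro mult_left_mono) (auto simp: power2_sum)
      finally show ?case by (simp add: algebra_simps)
    qed
  qed
qed

lemma L2_bochner_diff:
  fixes U V :: "real \<Rightarrow> 'a \<Rightarrow> 'b::euclidean_space"
  assumes "U \<in> L2_bochner T N" "V \<in> L2_bochner T N"
  shows "(\<lambda>t x. U t x - V t x) \<in> L2_bochner T N"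
proof (rule L2_bochner_comp2[OF assms, where \<Phi>="\<lambda>a b x. a x - b x" and C=1])
  fix a b a' b' :: "'a \<Rightarrow> 'b" assume L: "a \<in> L2 N" "b \<in> L2 N" "a' \<in> L2 N" "b' \<in> L2 N"
  have "(\<lambda>x. a x - b x - (a' x - b' x)) = (\<lambda>x. (a x - a' x) - (b x - b' x))"
    by (simp add: algebra_simps)
  then show "norm_L2 N (\<lambda>x. a x - b x - (a' x - b' x)) \<le>
      1 * (norm_L2 N (\<lambda>x. a x - a' x) + norm_L2 N (\<lambda>x. b x - b' x))"
    using norm_L2_diff_le[OF L2_diff[OF L(1,3)] L2_diff[OF L(2,4)]] by simp
qed (simp_all add: L2_diff)

lemma L2_bochner_scaleR:
  fixes U :: "real \<Rightarrow> 'a \<Rightarrow> 'b::euclidean_space"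
  assumes "U \<in> L2_bochner T N"
  shows "(\<lambda>t x. c *\<^sub>R U t x) \<in> L2_bochner T N"
proof (rule L2_bochner_comp2[OF assms assms, where \<Phi>="\<lambda>a b x. c *\<^sub>R a x" and C="\<bar>c\<bar>"])
  fix a b a' b' :: "'a \<Rightarrow> 'b" assume L: "a \<in> L2 N" "b \<in> L2 N" "a' \<in> L2 N" "b' \<in> L2 N"
  have "(\<lambda>x. c *\<^sub>R a x - c *\<^sub>R a' x) = (\<lambda>x. c *\<^sub>R (a x - a' x))" by (simp add: algebra_simps)
  then show "norm_L2 N (\<lambda>x. c *\<^sub>R a x - c *\<^sub>R a' x) \<le>
      \<bar>c\<bar> * (norm_L2 N (\<lambda>x. a x - a' x) + norm_L2 N (\<lambda>x. b x - b' x))"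
    by (simp add: norm_L2_scaleR norm_L2_nonneg mult_left_mono)
qed (simp_all add: L2_scaleR)

lemma norm_L2_mono:
  assumes "a \<in> L2 N" "b \<in> borel_measurable N" "\<And>x. norm (b x) \<le> norm (a x)"
  shows "norm_L2 N b \<le> norm_L2 N a"
  unfolding norm_L2_def
  using L2_integrable_sq[OF L2_bound[OF assms]] L2_integrable_sq[OF assms(1)] assms(3)
  by (intro real_sqrt_le_mono integral_mono power_mono) auto

lemma L2_bochner_contraction:
  fixes P :: "'b::euclidean_space \<Rightarrow> 'b" and U :: "real \<Rightarrow> 'a \<Rightarrow> 'b"
  assumes U: "U \<in> L2_bochner T N" and P: "\<And>a b. norm (P a - P b) \<le> norm (a - b)" "P 0 = 0"
  shows "(\<lambda>t x. P (U t x)) \<in> L2_bochner T N"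
proof (rule L2_bochner_comp2[OF U U, where \<Phi>="\<lambda>a b x. P (a x)" and C=1])
  have "1-lipschitz_on UNIV P" using P by (auto simp: lipschitz_on_def dist_norm)
  then have Pm: "P \<in> borel_measurable borel"
    by (intro borel_measurable_continuous_onI lipschitz_on_continuous_on)
  have PL: "(\<lambda>x. P (a x)) \<in> L2 N" if "a \<in> L2 N" for a
    using that P(1)[of _ 0] P(2) by (intro L2_bound[OF that] measurable_compose[OF L2_measurable[OF that] Pm]) auto
  then show "\<And>a b. a \<in> L2 N \<Longrightarrow> b \<in> L2 N \<Longrightarrow> (\<lambda>x. P (a x)) \<in> L2 N" by simp
  fix a b a' b' :: "'a \<Rightarrow> 'b" assume L: "a \<in> L2 N" "b \<in> L2 N" "a' \<in> L2 N" "b' \<in> L2 N"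
  have "norm_L2 N (\<lambda>x. P (a x) - P (a' x)) \<le> norm_L2 N (\<lambda>x. a x - a' x)"
    using L P by (intro norm_L2_mono L2_diff L2_measurable PL)
  then show "norm_L2 N (\<lambda>x. P (a x) - P (a' x)) \<le>
      1 * (norm_L2 N (\<lambda>x. a x - a' x) + norm_L2 N (\<lambda>x. b x - b' x))"
    by (simp add: add_increasing2 norm_L2_nonneg)
qed (simp add: P)

lemma L2_bochner_L2: "U \<in> L2_bochner T N \<Longrightarrow> AE t in lebesgue_on {0<..<T}. U t \<in> L2 N"
  by (simp add: L2_bochner_iff bochner_meas_L2)

text \<open>Young's inequality, with the weight \<open>sqrt \<delta>\<close> shifted from one factor
  to the other. The free \<open>\<delta>\<close> lets the share of a fixed factor be made small at
  the expense of a factor that is small already.\<close>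

lemma abs_inner_L2_le:
  assumes "a \<in> L2 N" "b \<in> L2 N" "\<delta> > 0"
  shows "\<bar>inner_L2 N a b\<bar> \<le> (\<delta> * (norm_L2 N a)\<^sup>2 + (norm_L2 N b)\<^sup>2 / \<delta>) / 2"
proof -
  define r where "r = sqrt \<delta>"
  have r: "r > 0" "\<delta> = r\<^sup>2" using assms(3) by (auto simp: r_def)
  have am: "p * q \<le> (p\<^sup>2 + q\<^sup>2) / 2" for p q :: real
    using sum_squares_bound[of p q] by simp
  have "\<bar>inner_L2 N a b\<bar> \<le> norm_L2 N a * norm_L2 N b" by (rule inner_L2_le[OF assms(1,2)])
  also have "\<dots> = (r * norm_L2 N a) * (norm_L2 N b / r)" using r by simp
  also have "\<dots> \<le> ((r * norm_L2 N a)\<^sup>2 + (norm_L2 N b / r)\<^sup>2) / 2"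
    by (rule am)
  finally show ?thesis by (simp add: r(2) power_mult_distrib power_divide)
qed

lemma L2_bochner_integrable_inner:
  assumes U: "U \<in> L2_bochner T N" and V: "V \<in> L2_bochner T N"
  shows "integrable (lebesgue_on {0<..<T}) (\<lambda>t. inner_L2 N (U t) (V t))"
proof (rule Bochner_Integration.integrable_bound)
  show "integrable (lebesgue_on {0<..<T}) (\<lambda>t. (1 * (norm_L2 N (U t))\<^sup>2 + (norm_L2 N (V t))\<^sup>2 / 1) / 2)"
    using U V by (simp add: L2_bochner_iff)
  show "(\<lambda>t. inner_L2 N (U t) (V t)) \<in> borel_measurable (lebesgue_on {0<..<T})"
    using U V by (intro bochner_meas_inner) (auto simp: L2_bochner_iff)
  show "AE t in lebesgue_on {0<..<T}. norm (inner_L2 N (U t) (V t)) \<le>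
      norm ((1 * (norm_L2 N (U t))\<^sup>2 + (norm_L2 N (V t))\<^sup>2 / 1) / 2)"
    using L2_bochner_L2[OF U] L2_bochner_L2[OF V]
  proof eventually_elim
    case (elim t)
    then show ?case using abs_inner_L2_le[OF elim, of 1] by simp
  qed
qed

lemma L2_bochner_const_inner:
  assumes U: "U \<in> L2_bochner T N" and b: "b \<in> L2 N"
  shows "integrable (lebesgue_on {0<..<T}) (\<lambda>t. inner_L2 N (U t) b)"
proof (rule L2_bochner_integrable_inner[OF U])
  have "bochner_meas T N (\<lambda>t. b)" unfolding bochner_meas_def
    using b by (intro conjI exI[of _ "\<lambda>k t. b"]) (auto simp: norm_L2_def)
  then show "(\<lambda>t. b) \<in> L2_bochner T N"
    using finite_measure.integrable_const[OF finite_measure_Ioo] by (auto simp: L2_bochner_iff)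
qed

lemma simple_L2_bochner:
  assumes "simple_function (lebesgue_on {0<..<T}) s" "\<And>t. t \<in> {0<..<T} \<Longrightarrow> s t \<in> L2 N"
  shows "s \<in> L2_bochner T N"
proof -
  have "bochner_meas T N s" unfolding bochner_meas_def
    using assms AE_Ioo[of 0 T] by (intro conjI exI[of _ "\<lambda>k. s"]) (auto simp: norm_L2_def elim: eventually_mono)
  moreover have "integrable (lebesgue_on {0<..<T}) (\<lambda>t. (norm_L2 N (s t))\<^sup>2)"
  proof -
    have sf: "simple_function (lebesgue_on {0<..<T}) (\<lambda>t. (norm_L2 N (s t))\<^sup>2)"
      using simple_function_compose1[OF assms(1)] .
    have "finite ((\<lambda>t. (norm_L2 N (s t))\<^sup>2) ` {0<..<T})"
      using simple_functionD(1)[OF sf] by simp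
    then obtain B where "\<And>t. t \<in> {0<..<T} \<Longrightarrow> (norm_L2 N (s t))\<^sup>2 \<le> B"
      by (meson finite_imageI bdd_above_finite bdd_above.unfold imageI)
    then show ?thesis
      by (intro finite_measure.integrable_const_bound[OF finite_measure_Ioo, where B=B]
          borel_measurable_simple_function[OF sf] eventually_mono[OF AE_Ioo]) auto
  qed
  ultimately show ?thesis by (simp add: L2_bochner_iff)
qed

text \<open>Bochner measurability gives convergence for almost every t only; dominated convergence
  makes it convergence in the mean square.\<close>

lemma L2_bochner_simple_approx:
  assumes U: "U \<in> L2_bochner T N"
  obtains s where "\<And>k::nat. simple_function (lebesgue_on {0<..<T}) (s k)"
    "\<And>k t. t \<in> {0<..<T} \<Longrightarrow> s k t \<in> L2 N"
    "(\<lambda>k. \<integral>t. (norm_L2 N (\<lambda>x. U t x - s k t x))\<^sup>2 \<partial>lebesgue_on {0<..<T}) \<longlonglongrightarrow> 0"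
proof -
  have U': "bochner_meas T N U" using U by (simp add: L2_bochner_iff)
  obtain r where r: "\<And>k::nat. simple_function (lebesgue_on {0<..<T}) (r k)"
    "\<And>k t. t \<in> {0<..<T} \<Longrightarrow> r k t \<in> L2 N"
    "AE t in lebesgue_on {0<..<T}. (\<lambda>k. norm_L2 N (\<lambda>x. U t x - r k t x)) \<longlonglongrightarrow> 0"
    using bochner_measE[OF U'] by blast
  \<comment> \<open>truncation provides the majorant for dominated convergence\<close>
  define A where "A k = {t \<in> {0<..<T}. norm_L2 N (r k t) \<le> norm_L2 N (U t) + 1}" for k
  define s where "s k t = (if t \<in> A k then r k t else (\<lambda>x. 0))" for k t
  have "simple_function (lebesgue_on {0<..<T}) (\<lambda>t. norm_L2 N (r k t))" for k
    using simple_function_compose1[OF r(1)] .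
  from borel_measurable_simple_function[OF this] bochner_meas_norm[OF U']
  have "{t \<in> space (lebesgue_on {0<..<T}). norm_L2 N (r k t) \<le> norm_L2 N (U t) + 1} \<in> sets (lebesgue_on {0<..<T})" for k
    by measurable
  then have A: "A k \<in> sets (lebesgue_on {0<..<T})" for k by (simp add: A_def)
  have s1: "simple_function (lebesgue_on {0<..<T}) (s k)" for k
    unfolding s_def using A by (intro simple_function_If_set r simple_function_const) auto
  have s2: "s k t \<in> L2 N" if "t \<in> {0<..<T}" for k t
    using r(2)[OF that] by (simp add: s_def L2_zero)
  have D: "(\<lambda>t x. U t x - s k t x) \<in> L2_bochner T N" for k
    by (rule L2_bochner_diff[OF U simple_L2_bochner[OF s1 s2]])
  have "(\<lambda>k. \<integral>t. (norm_L2 N (\<lambda>x. U t x - s k t x))\<^sup>2 \<partial>lebesgue_on {0<..<T}) \<longlonglongrightarrow>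
      (\<integral>t. 0 \<partial>lebesgue_on {0<..<T})"
  proof (rule integral_dominated_convergence)
    \<comment> \<open>From the bound \<open>2 * norm_L2 N (U t) + 1\<close> on the norm of the
      difference, since the square of a sum is at most twice the sum of the squares.\<close>
    show "integrable (lebesgue_on {0<..<T}) (\<lambda>t. 8 * (norm_L2 N (U t))\<^sup>2 + 2)"
      using U by (intro Bochner_Integration.integrable_add finite_measure.integrable_const[OF finite_measure_Ioo])
        (auto simp: L2_bochner_iff)
    show "(\<lambda>t. (norm_L2 N (\<lambda>x. U t x - s k t x))\<^sup>2) \<in> borel_measurable (lebesgue_on {0<..<T})" for k
      using D[of k] by (auto simp: L2_bochner_iff)
    show "AE t in lebesgue_on {0<..<T}. (\<lambda>k. (norm_L2 N (\<lambda>x. U t x - s k t x))\<^sup>2) \<longlonglongrightarrow> 0"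
      using r(3) L2_bochner_L2[OF U] AE_Ioo
    proof eventually_elim
      \<comment> \<open>For large k the truncation is inactive at this t, so it does not disturb the
        limit.\<close>
      case (elim t)
      have "\<forall>\<^sub>F k in sequentially. norm_L2 N (\<lambda>x. U t x - r k t x) < 1"
        using order_tendstoD(2)[OF elim(1)] by simp
      then have "\<forall>\<^sub>F k in sequentially. norm_L2 N (\<lambda>x. U t x - r k t x) = norm_L2 N (\<lambda>x. U t x - s k t x)"
      proof eventually_elim
        case (elim k)
        have "norm_L2 N (r k t) \<le> norm_L2 N (U t) + 1"
          using norm_L2_diff_abs[OF \<open>U t \<in> L2 N\<close> r(2)[OF \<open>t \<in> {0<..<T}\<close>, of k]] elim by linarith
        then show ?case using \<open>t \<in> {0<..<T}\<close> by (simp add: s_def A_def)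
      qed
      then have "(\<lambda>k. norm_L2 N (\<lambda>x. U t x - s k t x)) \<longlonglongrightarrow> 0"
        using elim(1) by (rule Lim_transform_eventually[rotated])
      then show ?case using tendsto_power[of _ 0 _ 2] by fastforce
    qed
    show "AE t in lebesgue_on {0<..<T}. norm ((norm_L2 N (\<lambda>x. U t x - s k t x))\<^sup>2) \<le> 8 * (norm_L2 N (U t))\<^sup>2 + 2" for k
      using L2_bochner_L2[OF U] AE_Ioo
    proof eventually_elim
      case (elim t)
      have "norm_L2 N (s k t) \<le> norm_L2 N (U t) + 1"
        using norm_L2_nonneg[of N "U t"] by (auto simp: s_def A_def norm_L2_def[of N "\<lambda>x. 0"])
      then have "norm_L2 N (\<lambda>x. U t x - s k t x) \<le> 2 * norm_L2 N (U t) + 1"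
        using norm_L2_diff_le[OF elim(1) s2[OF elim(2), of k]] by linarith
      then have "(norm_L2 N (\<lambda>x. U t x - s k t x))\<^sup>2 \<le> (2 * norm_L2 N (U t) + 1)\<^sup>2"
        by (intro power_mono norm_L2_nonneg)
      also have "\<dots> \<le> 8 * (norm_L2 N (U t))\<^sup>2 + 2"
        using sum_squares_bound[of "2 * norm_L2 N (U t)" 1] by (simp add: power2_sum power_mult_distrib)
      finally show ?case by simp
    qed
  qed simp
  then show ?thesis using that[OF s1 s2] by simp
qed

section \<open>Steklov averages\<close>

lemma id_measurable_lebesgue_on: "(\<lambda>x::real. x) \<in> borel_measurable (lebesgue_on S)"
  by (intro measurable_restrict_space1 measurable_completion) simp

lemma indicator_Ioo_measurable:
  "(indicator {a<..<b::real} :: real \<Rightarrow> real) \<in> borel_measurable (lebesgue_on S)"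
  by (intro measurable_restrict_space1 measurable_completion) simp

lemma integral_indicator_Ioo:
  "(\<integral>t. indicator {a<..<b} t \<partial>lebesgue_on {0<..<T}) = measure lebesgue ({a<..<b::real} \<inter> {0<..<T})"
proof -
  have "(\<integral>t. indicator {a<..<b} t \<partial>lebesgue_on {0<..<T}) = measure (lebesgue_on {0<..<T}) ({a<..<b} \<inter> {0<..<T})"
    by simp
  also have "\<dots> = measure lebesgue ({a<..<b} \<inter> {0<..<T})"
    by (subst measure_restrict_space) auto
  finally show ?thesis .
qed

lemma integral_indicator_Ioo_le:
  assumes "a \<le> b"
  shows "(\<integral>t. indicator {a<..<b} t \<partial>lebesgue_on {0<..<T}) \<le> b - (a::real)"
proof -
  have "measure lebesgue ({a<..<b} \<inter> {0<..<T}) \<le> measure lebesgue {a<..<b}"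
    by (intro measure_mono_fmeasurable lmeasurable_open) auto
  then show ?thesis unfolding integral_indicator_Ioo using assms by simp
qed

lemma integral_indicator_Ioo_eq:
  assumes "a \<le> b" "0 \<le> a" "b \<le> T"
  shows "(\<integral>t. indicator {a<..<b} t \<partial>lebesgue_on {0<..<T}) = b - (a::real)"
proof -
  have "{a<..<b} \<inter> {0<..<T} = {a<..<b}" using assms by auto
  then show ?thesis unfolding integral_indicator_Ioo using assms by simp
qed

lemma integrable_indicator_Ioo_mult:
  fixes f :: "real \<Rightarrow> real"
  assumes "integrable (lebesgue_on S) f"
  shows "integrable (lebesgue_on S) (\<lambda>s. indicator {a<..<b} s * f s)"
proof (rule Bochner_Integration.integrable_bound[OF assms])
  show "(\<lambda>s. indicator {a<..<b} s * f s) \<in> borel_measurable (lebesgue_on S)"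
    using assms by (intro borel_measurable_times indicator_Ioo_measurable) auto
qed (auto simp: indicator_def)

text \<open>The window reaches back by \<open>\<alpha> n\<close> and ahead by
  \<open>\<beta> n\<close>. Either may be 0: \<open>energy_identity\<close> uses forward windows for
  one inequality and backward windows for the other.\<close>

locale steklov =
  fixes T :: real and \<alpha> \<beta> :: "nat \<Rightarrow> real"
  assumes \<alpha>_nonneg: "\<And>n. 0 \<le> \<alpha> n" and \<beta>_nonneg: "\<And>n. 0 \<le> \<beta> n" and h_pos: "\<And>n. 0 < \<alpha> n + \<beta> n"
    and \<alpha>_lim: "\<alpha> \<longlonglongrightarrow> 0" and \<beta>_lim: "\<beta> \<longlonglongrightarrow> 0"
begin

abbreviation M :: "real measure" where "M \<equiv> lebesgue_on {0<..<T}"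

sublocale M: finite_measure M by (rule finite_measure_Ioo)

sublocale MM: pair_sigma_finite M M ..

text \<open>Integration over \<open>M\<close> treats \<open>f\<close> as 0 outside (0, T), while the
  divisor remains the full length of the window. Averages of positive constants are therefore too
  small near the ends of the interval, and \<open>avg_const_le\<close> is only an
  inequality.\<close>

definition avg :: "nat \<Rightarrow> (real \<Rightarrow> real) \<Rightarrow> real \<Rightarrow> real" where
  "avg n f t = (\<integral>s. indicator {t - \<alpha> n<..<t + \<beta> n} s * f s \<partial>M) / (\<alpha> n + \<beta> n)"

lemma window_measurable:
  "(\<lambda>(t, s). indicator {t - \<alpha> n<..<t + \<beta> n} s :: real) \<in> borel_measurable (M \<Otimes>\<^sub>M M)"
proof -
  have [measurable]: "fst \<in> borel_measurable (M \<Otimes>\<^sub>M M)" "snd \<in> borel_measurable (M \<Otimes>\<^sub>M M)"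
    by (rule measurable_compose[OF measurable_fst id_measurable_lebesgue_on],
        rule measurable_compose[OF measurable_snd id_measurable_lebesgue_on])
  have "(\<lambda>p. if fst p - \<alpha> n < snd p \<and> snd p < fst p + \<beta> n then 1 else 0 :: real) \<in> borel_measurable (M \<Otimes>\<^sub>M M)"
    by measurable
  then show ?thesis by (rule measurable_cong[THEN iffD1, rotated]) (auto simp: indicator_def)
qed

lemma window_prod_integrable:
  fixes f :: "real \<Rightarrow> real"
  assumes f: "integrable M f"
  shows "integrable (M \<Otimes>\<^sub>M M) (\<lambda>(t, s). indicator {t - \<alpha> n<..<t + \<beta> n} s * f s)"
proof -
  have m: "(\<lambda>p. f (snd p)) \<in> borel_measurable (M \<Otimes>\<^sub>M M)"
    using f by (intro measurable_compose[OF measurable_snd]) auto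
  have "integrable (M \<Otimes>\<^sub>M M) (\<lambda>p. f (snd p))"
    by (rule MM.Fubini_integrable[OF m]) (use f in auto)
  then show ?thesis
  proof (rule Bochner_Integration.integrable_bound)
    show "(\<lambda>(t, s). indicator {t - \<alpha> n<..<t + \<beta> n} s * f s) \<in> borel_measurable (M \<Otimes>\<^sub>M M)"
      using borel_measurable_times[OF window_measurable[of n] m] by (simp add: case_prod_beta)
  qed (auto simp: indicator_def)
qed

lemma avg_integrable:
  assumes "integrable M f"
  shows "integrable M (avg n f)"
  using MM.integrable_fst'[OF window_prod_integrable[OF assms, of n]] unfolding avg_def by simp

lemma avg_mono:
  assumes "integrable M f" "integrable M g" "AE s in M. f s \<le> g s"
  shows "avg n f t \<le> avg n g t"
  unfolding avg_def
proof (intro divide_right_mono integral_mono_AE integrable_indicator_Ioo_mult assms)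
  show "AE s in M. indicator {t - \<alpha> n<..<t + \<beta> n} s * f s \<le> indicator {t - \<alpha> n<..<t + \<beta> n} s * g s"
    using assms(3) by eventually_elim (auto simp: indicator_def)
qed (use h_pos[of n] in simp)

lemma avg_diff:
  assumes "integrable M f" "integrable M g"
  shows "avg n (\<lambda>s. f s - g s) t = avg n f t - avg n g t"
  using integrable_indicator_Ioo_mult[OF assms(1)] integrable_indicator_Ioo_mult[OF assms(2)]
  by (simp add: avg_def right_diff_distrib diff_divide_distrib)

lemma avg_add:
  assumes "integrable M f" "integrable M g"
  shows "avg n (\<lambda>s. f s + g s) t = avg n f t + avg n g t"
  using integrable_indicator_Ioo_mult[OF assms(1)] integrable_indicator_Ioo_mult[OF assms(2)]
  by (simp add: avg_def distrib_left add_divide_distrib)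

lemma avg_cmult: "avg n (\<lambda>s. c * f s) t = c * avg n f t"
  by (simp add: avg_def mult.left_commute[of _ c])

lemma avg_const_le:
  assumes "0 \<le> c"
  shows "avg n (\<lambda>s. c) t \<le> c"
proof -
  have "(\<integral>s. indicator {t - \<alpha> n<..<t + \<beta> n} s \<partial>M) \<le> \<alpha> n + \<beta> n"
    using integral_indicator_Ioo_le[of "t - \<alpha> n" "t + \<beta> n" T] h_pos[of n] by simp
  then have "c * (\<integral>s. indicator {t - \<alpha> n<..<t + \<beta> n} s \<partial>M) \<le> c * (\<alpha> n + \<beta> n)"
    using assms by (intro mult_left_mono)
  then show ?thesis using h_pos[of n] by (simp add: avg_def mult.commute divide_le_eq)
qed

lemma avg_abs_le:
  shows "\<bar>avg n f t\<bar> \<le> avg n (\<lambda>s. \<bar>f s\<bar>) t"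
proof -
  have "norm (\<integral>s. indicator {t - \<alpha> n<..<t + \<beta> n} s * f s \<partial>M) \<le>
      (\<integral>s. norm (indicator {t - \<alpha> n<..<t + \<beta> n} s * f s) \<partial>M)"
    by (rule integral_norm_bound)
  then show ?thesis using h_pos[of n]
    by (simp add: avg_def abs_mult divide_right_mono)
qed

text \<open>By Fubini: s lies in the window of t exactly if t lies in the reflected window of s, so
  each \<open>f s\<close> is counted with total weight at most the window length.\<close>

lemma integral_avg_nonneg_le:
  assumes f: "integrable M f" "\<And>s. 0 \<le> f s"
  shows "(\<integral>t. avg n f t \<partial>M) \<le> (\<integral>s. f s \<partial>M)"
proof -
  let ?k = "\<lambda>t s. indicator {t - \<alpha> n<..<t + \<beta> n} s :: real"
  let ?h = "\<alpha> n + \<beta> n"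
  have "(\<integral>t. \<integral>s. ?k t s * f s \<partial>M \<partial>M) = (\<integral>s. \<integral>t. ?k t s * f s \<partial>M \<partial>M)"
    using MM.Fubini_integral[OF window_prod_integrable[OF f(1), of n]] by simp
  also have "\<dots> = (\<integral>s. f s * (\<integral>t. indicator {s - \<beta> n<..<s + \<alpha> n} t \<partial>M) \<partial>M)"
  proof (rule Bochner_Integration.integral_cong[OF refl])
    fix s
    have "?k t s = indicator {s - \<beta> n<..<s + \<alpha> n} t" for t by (auto simp: indicator_def)
    then show "(\<integral>t. ?k t s * f s \<partial>M) = f s * (\<integral>t. indicator {s - \<beta> n<..<s + \<alpha> n} t \<partial>M)"
      by (simp add: mult.commute)
  qed
  also have "\<dots> \<le> (\<integral>s. f s * ?h \<partial>M)"
  proof (rule integral_mono')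
    show "integrable M (\<lambda>s. f s * ?h)" using f by simp
    show "f s * (\<integral>t. indicator {s - \<beta> n<..<s + \<alpha> n} t \<partial>M) \<le> f s * ?h" for s
      using integral_indicator_Ioo_le[of "s - \<beta> n" "s + \<alpha> n" T] h_pos[of n] f(2)
      by (intro mult_left_mono) auto
    show "0 \<le> f s * ?h" for s using f(2)[of s] h_pos[of n] by simp
  qed
  finally show ?thesis using h_pos[of n] by (simp add: avg_def divide_le_eq)
qed

lemma integral_abs_avg_le:
  assumes f: "integrable M f"
  shows "(\<integral>t. \<bar>avg n f t\<bar> \<partial>M) \<le> (\<integral>s. \<bar>f s\<bar> \<partial>M)"
proof -
  have "(\<integral>t. \<bar>avg n f t\<bar> \<partial>M) \<le> (\<integral>t. avg n (\<lambda>s. \<bar>f s\<bar>) t \<partial>M)"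
    using f by (intro integral_mono integrable_abs avg_integrable avg_abs_le)
  also have "\<dots> \<le> (\<integral>s. \<bar>f s\<bar> \<partial>M)" using f by (intro integral_avg_nonneg_le) auto
  finally show ?thesis .
qed

text \<open>Convergence in the mean, packaged as a predicate so that it can be carried from
  continuous functions to indicators of open sets, then of measurable sets, and to all integrable
  functions.\<close>

definition avg_conv :: "(real \<Rightarrow> real) \<Rightarrow> bool" where
  "avg_conv f \<longleftrightarrow> integrable M f \<and> (\<lambda>n. \<integral>t. \<bar>avg n f t - f t\<bar> \<partial>M) \<longlonglongrightarrow> 0"

text \<open>Averaging does not increase the integral of the absolute value, so replacing
  \<open>f\<close> by \<open>g\<close> costs at most the same error after averaging as
  before.\<close>

lemma avg_convI_limit:
  assumes f: "integrable M f" and app: "\<And>e. e > 0 \<Longrightarrow> \<exists>g. avg_conv g \<and> (\<integral>t. \<bar>f t - g t\<bar> \<partial>M) < e"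
  shows "avg_conv f"
  unfolding avg_conv_def
proof (intro conjI f LIMSEQ_I)
  fix r :: real assume r: "r > 0"
  obtain g where g: "avg_conv g" and e: "(\<integral>t. \<bar>f t - g t\<bar> \<partial>M) < r / 4" using app[of "r / 4"] r by auto
  then have gi: "integrable M g" and gl: "(\<lambda>n. \<integral>t. \<bar>avg n g t - g t\<bar> \<partial>M) \<longlonglongrightarrow> 0" by (auto simp: avg_conv_def)
  obtain m where m: "\<And>n. n \<ge> m \<Longrightarrow> norm ((\<integral>t. \<bar>avg n g t - g t\<bar> \<partial>M) - 0) < r / 4"
    using LIMSEQ_D[OF gl, of "r / 4"] r by auto
  have "norm ((\<integral>t. \<bar>avg n f t - f t\<bar> \<partial>M) - 0) < r" if "n \<ge> m" for n
  proof -
    note I = integrable_abs Bochner_Integration.integrable_add Bochner_Integration.integrable_diff f gi avg_integrable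
    have "(\<integral>t. \<bar>avg n f t - f t\<bar> \<partial>M) \<le>
        (\<integral>t. \<bar>avg n (\<lambda>s. f s - g s) t\<bar> + \<bar>avg n g t - g t\<bar> + \<bar>f t - g t\<bar> \<partial>M)"
    proof (rule integral_mono)
      fix t
      show "\<bar>avg n f t - f t\<bar> \<le> \<bar>avg n (\<lambda>s. f s - g s) t\<bar> + \<bar>avg n g t - g t\<bar> + \<bar>f t - g t\<bar>"
        unfolding avg_diff[OF f gi] by linarith
    qed (intro I)+
    also have "\<dots> = (\<integral>t. \<bar>avg n (\<lambda>s. f s - g s) t\<bar> \<partial>M) + (\<integral>t. \<bar>avg n g t - g t\<bar> \<partial>M) + (\<integral>t. \<bar>f t - g t\<bar> \<partial>M)"
      by (subst Bochner_Integration.integral_add, (intro I)+)+ simp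
    also have "\<dots> < r"
      using integral_abs_avg_le[OF Bochner_Integration.integrable_diff[OF f gi], of n] m[OF that] e r unfolding real_norm_def diff_0_right by linarith
    finally show ?thesis by simp
  qed
  then show "\<exists>no. \<forall>n\<ge>no. norm ((\<integral>t. \<bar>avg n f t - f t\<bar> \<partial>M) - 0) < r" by blast
qed

lemma avg_tendsto_continuous:
  assumes c: "continuous_on UNIV c" and t: "t \<in> {0<..<T}" and ci: "integrable M c"
  shows "(\<lambda>n. avg n c t) \<longlonglongrightarrow> c t"
proof (rule LIMSEQ_I)
  fix r :: real assume r: "r > 0"
  have "isCont c t" using c by (simp add: continuous_on_eq_continuous_at)
  then obtain d where d: "d > 0" "\<And>s. \<bar>s - t\<bar> < d \<Longrightarrow> \<bar>c s - c t\<bar> < r / 2"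
    using r unfolding continuous_at_eps_delta by (metis half_gt_zero real_norm_def dist_real_def)
  \<comment> \<open>Small enough for the window to stay inside (0, T), where the average of a
    constant is exact.\<close>
  define d' where "d' = min d (min t (T - t))"
  have d': "d' > 0" using d t by (auto simp: d'_def)
  have "\<forall>\<^sub>F n in sequentially. \<alpha> n < d'" "\<forall>\<^sub>F n in sequentially. \<beta> n < d'"
    using order_tendstoD(2)[OF \<alpha>_lim d'] order_tendstoD(2)[OF \<beta>_lim d'] by auto
  then have "\<forall>\<^sub>F n in sequentially. norm (avg n c t - c t) < r"
  proof eventually_elim
    case (elim n)
    let ?W = "{t - \<alpha> n<..<t + \<beta> n}"
    have one: "(\<integral>s. indicator ?W s \<partial>M) = \<alpha> n + \<beta> n"
      using elim \<alpha>_nonneg[of n] \<beta>_nonneg[of n] t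
      by (subst integral_indicator_Ioo_eq) (auto simp: d'_def)
    have "avg n (\<lambda>s. c t) t = c t" using one h_pos[of n] by (simp add: avg_def)
    then have "avg n c t - c t = avg n (\<lambda>s. c s - c t) t"
      using avg_diff[OF ci M.integrable_const, of n "c t" t] by simp
    also have "\<bar>\<dots>\<bar> \<le> avg n (\<lambda>s. \<bar>c s - c t\<bar>) t" by (rule avg_abs_le)
    also have "\<dots> \<le> avg n (\<lambda>s. r / 2) t"
      unfolding avg_def
    proof (intro divide_right_mono integral_mono)
      show "integrable M (\<lambda>s. indicator ?W s * \<bar>c s - c t\<bar>)"
        by (intro integrable_indicator_Ioo_mult integrable_abs Bochner_Integration.integrable_diff ci M.integrable_const)
      show "integrable M (\<lambda>s. indicator ?W s * (r / 2))"
        by (intro integrable_indicator_Ioo_mult M.integrable_const)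
      show "indicator ?W s * \<bar>c s - c t\<bar> \<le> indicator ?W s * (r / 2)" for s
        using d(2)[of s] elim by (auto simp: indicator_def d'_def intro!: less_imp_le)
    qed (use h_pos[of n] in simp)
    also have "\<dots> \<le> r / 2" using r by (intro avg_const_le) simp
    finally show ?case using r by simp
  qed
  then show "\<exists>no. \<forall>n\<ge>no. norm (avg n c t - c t) < r" by (simp add: eventually_sequentially)
qed

lemma avg_conv_continuous:
  assumes c: "continuous_on UNIV c" and B: "\<And>x. \<bar>c x\<bar> \<le> B"
  shows "avg_conv c"
proof -
  have cm: "c \<in> borel_measurable M"
    by (intro measurable_restrict_space1 measurable_completion)
      (simp add: borel_measurable_continuous_onI[OF c])
  have ci: "integrable M c"
    using B cm by (intro M.integrable_const_bound[where B=B]) auto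
  have B0: "0 \<le> B" using B[of 0] by linarith
  have "(\<lambda>n. \<integral>t. \<bar>avg n c t - c t\<bar> \<partial>M) \<longlonglongrightarrow> (\<integral>t. 0 \<partial>M)"
  proof (rule integral_dominated_convergence)
    show "(\<lambda>t. \<bar>avg n c t - c t\<bar>) \<in> borel_measurable M" for n
      using avg_integrable[OF ci, of n] ci by auto
    show "integrable M (\<lambda>t. 2 * B)" by simp
    show "AE t in M. (\<lambda>n. \<bar>avg n c t - c t\<bar>) \<longlonglongrightarrow> 0"
      using AE_Ioo
    proof eventually_elim
      case (elim t)
      show ?case using tendsto_rabs_zero[OF LIM_zero[OF avg_tendsto_continuous[OF c elim ci]]] .
    qed
    show "AE t in M. norm \<bar>avg n c t - c t\<bar> \<le> 2 * B" for n
    proof (rule AE_I2)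
      fix t
      have "\<bar>avg n c t\<bar> \<le> avg n (\<lambda>s. \<bar>c s\<bar>) t" by (rule avg_abs_le)
      also have "\<dots> \<le> avg n (\<lambda>s. B) t" using B ci by (intro avg_mono) auto
      also have "\<dots> \<le> B" by (rule avg_const_le[OF B0])
      finally show "norm \<bar>avg n c t - c t\<bar> \<le> 2 * B" using B[of t] by simp
    qed
  qed simp
  then show ?thesis using ci by (simp add: avg_conv_def)
qed

lemma avg_conv_open_indicator:
  assumes U: "open U" "U \<subseteq> {0<..<T}"
  shows "avg_conv (indicator U)"
proof (rule avg_convI_limit)
  have Um: "(indicator U :: real \<Rightarrow> real) \<in> borel_measurable M"
    using U by (intro measurable_restrict_space1 measurable_completion) simp
  show i: "integrable M (indicator U :: real \<Rightarrow> real)"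
    using Um by (intro M.integrable_const_bound[where B=1]) (auto simp: indicator_def)
  \<comment> \<open>The distance to the empty set is 0 by convention, so the construction of
    \<open>g\<close> relies on a point outside \<open>U\<close>.\<close>
  have ne: "- U \<noteq> {}" using U(2) by (metis Compl_empty_eq UNIV_I double_complement greaterThanLessThan_iff less_irrefl subsetD)
  define g where "g m x = min 1 (real m * infdist x (- U))" for m :: nat and x
  have g: "continuous_on UNIV (g m)" for m unfolding g_def by (intro continuous_intros)
  have g01: "0 \<le> g m x" "g m x \<le> 1" for m x by (auto simp: g_def infdist_nonneg)
  have lim: "(\<lambda>m. g m x) \<longlonglongrightarrow> indicator U x" for x
  proof (cases "x \<in> U")
    case True
    then have pos: "infdist x (- U) > 0"
      using in_closed_iff_infdist_zero[of "- U" x] U ne infdist_nonneg[of x "- U"] by (simp add: closed_def less_le)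
    then obtain m0 where m0: "1 / infdist x (- U) < real m0" using reals_Archimedean2 by blast
    have "g m x = 1" if "m \<ge> m0" for m
    proof -
      have "1 / infdist x (- U) \<le> real m" using m0 that by linarith
      then show ?thesis using pos by (simp add: g_def field_simps min_def)
    qed
    then have "\<forall>\<^sub>F m in sequentially. g m x = 1" by (auto simp: eventually_sequentially)
    then show ?thesis using True by (simp add: tendsto_eventually)
  next
    case False
    then have "g m x = 0" for m by (simp add: g_def)
    then show ?thesis using False by simp
  qed
  have avg_conv: "avg_conv (g m)" for m
    using g01 by (intro avg_conv_continuous[OF g, where B=1]) auto
  have "(\<lambda>m. \<integral>t. \<bar>indicator U t - g m t\<bar> \<partial>M) \<longlonglongrightarrow> (\<integral>t. 0 \<partial>M)"
  proof (rule integral_dominated_convergence)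
    show "(\<lambda>t. \<bar>indicator U t - g m t\<bar>) \<in> borel_measurable M" for m
      using Um avg_conv[of m] by (auto simp: avg_conv_def)
    show "integrable M (\<lambda>t. 2 :: real)" by simp
    show "AE t in M. (\<lambda>m. \<bar>indicator U t - g m t\<bar>) \<longlonglongrightarrow> 0"
    proof (rule AE_I2)
      fix t
      have "(\<lambda>m. \<bar>indicator U t - g m t\<bar>) \<longlonglongrightarrow> \<bar>indicator U t - indicator U t\<bar>"
        by (intro tendsto_intros lim)
      then show "(\<lambda>m. \<bar>indicator U t - g m t\<bar>) \<longlonglongrightarrow> 0" by simp
    qed
    show "AE t in M. norm \<bar>indicator U t - g m t\<bar> \<le> 2" for m
    proof (rule AE_I2)
      fix t show "norm \<bar>indicator U t - g m t\<bar> \<le> 2"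
        using g01[of m t] unfolding indicator_def by (cases "t \<in> U") auto
    qed
  qed simp
  then have L: "(\<lambda>m. \<integral>t. \<bar>indicator U t - g m t\<bar> \<partial>M) \<longlonglongrightarrow> 0" by simp
  fix e :: real assume "e > 0"
  then obtain m where "(\<integral>t. \<bar>indicator U t - g m t\<bar> \<partial>M) < e"
    using eventually_happens[OF order_tendstoD(2)[OF L]] by auto
  then show "\<exists>g. avg_conv g \<and> (\<integral>t. \<bar>indicator U t - g t\<bar> \<partial>M) < e" using avg_conv by blast
qed

text \<open>Outer regularity: an open superset exceeds \<open>A\<close> by little measure, and
  \<open>avg_conv_open_indicator\<close> applies to its part inside (0, T).\<close>

lemma avg_conv_indicator:
  assumes A: "A \<in> sets M"
  shows "avg_conv (indicator A)"
proof (rule avg_convI_limit)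
  show i: "integrable M (indicator A :: real \<Rightarrow> real)"
    using A by (simp add: M.emeasure_finite less_top[symmetric])
  have AI: "A \<subseteq> {0<..<T}" and AL: "A \<in> sets lebesgue"
    using A by (auto simp: sets_restrict_space_iff)
  fix e :: real assume e: "e > 0"
  obtain U where U: "open U" "A \<subseteq> U" "U - A \<in> lmeasurable" "emeasure lebesgue (U - A) < ennreal e"
    using sets_lebesgue_outer_open[OF AL e] by blast
  let ?U = "U \<inter> {0<..<T}"
  have "(\<integral>t. \<bar>indicator A t - indicator ?U t :: real\<bar> \<partial>M) = (\<integral>t. indicator (?U - A) t \<partial>M)"
    using U AI by (intro Bochner_Integration.integral_cong) (auto simp: indicator_def)
  also have "\<dots> = measure M ((?U - A) \<inter> space M)" by (rule Bochner_Integration.integral_indicator)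
  also have "(?U - A) \<inter> space M = ?U - A" by auto
  also have "measure M (?U - A) = measure lebesgue (?U - A)"
    by (rule measure_restrict_space) auto
  also have "\<dots> \<le> measure lebesgue (U - A)"
    using U AL by (intro measure_mono_fmeasurable) auto
  also have "\<dots> < e"
    using U(3,4) e by (simp add: emeasure_eq_measure2 ennreal_less_iff)
  finally show "\<exists>g. avg_conv g \<and> (\<integral>t. \<bar>indicator A t - g t\<bar> \<partial>M) < e"
    using avg_conv_open_indicator[OF open_Int[OF U(1) open_greaterThanLessThan] Int_lower2] by blast
qed

lemma avg_conv_integrable:
  assumes "integrable M f"
  shows "avg_conv f"
  using assms
proof (induction rule: integrable_induct)
  case (base A c)
  have "avg n (\<lambda>x. indicator A x *\<^sub>R c) t - indicator A t *\<^sub>R c = c * (avg n (indicator A) t - indicator A t)" for n t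
    using avg_cmult[of n c "indicator A" t] by (simp add: algebra_simps)
  then have "(\<integral>t. \<bar>avg n (\<lambda>x. indicator A x *\<^sub>R c) t - indicator A t *\<^sub>R c\<bar> \<partial>M) =
      \<bar>c\<bar> * (\<integral>t. \<bar>avg n (indicator A) t - indicator A t\<bar> \<partial>M)" for n
    by (simp add: abs_mult)
  moreover have "(\<lambda>n. \<bar>c\<bar> * (\<integral>t. \<bar>avg n (indicator A) t - indicator A t\<bar> \<partial>M)) \<longlonglongrightarrow> 0"
    using avg_conv_indicator[OF base(1)] by (intro tendsto_mult_right_zero) (simp add: avg_conv_def)
  moreover have "integrable M (\<lambda>x. indicator A x *\<^sub>R c)"
    using base by simp
  ultimately show ?case by (simp add: avg_conv_def)
next
  case (add f g)
  note I = integrable_abs Bochner_Integration.integrable_add Bochner_Integration.integrable_diff add(1) add(2) avg_integrable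
  have fg: "integrable M (\<lambda>x. f x + g x)" using add by simp
  have L: "(\<lambda>n. (\<integral>t. \<bar>avg n f t - f t\<bar> \<partial>M) + (\<integral>t. \<bar>avg n g t - g t\<bar> \<partial>M)) \<longlonglongrightarrow> 0"
    using add by (intro tendsto_add_zero) (auto simp: avg_conv_def)
  have "(\<lambda>n. \<integral>t. \<bar>avg n (\<lambda>x. f x + g x) t - (f t + g t)\<bar> \<partial>M) \<longlonglongrightarrow> 0"
  proof (rule Lim_null_comparison[OF _ L], rule always_eventually, rule allI)
    fix n
    have "(\<integral>t. \<bar>avg n (\<lambda>x. f x + g x) t - (f t + g t)\<bar> \<partial>M) \<le>
        (\<integral>t. \<bar>avg n f t - f t\<bar> + \<bar>avg n g t - g t\<bar> \<partial>M)"
    proof (rule integral_mono)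
      show "integrable M (\<lambda>t. \<bar>avg n (\<lambda>x. f x + g x) t - (f t + g t)\<bar>)"
        by (intro integrable_abs Bochner_Integration.integrable_diff avg_integrable[OF fg] fg)
      fix t
      show "\<bar>avg n (\<lambda>x. f x + g x) t - (f t + g t)\<bar> \<le> \<bar>avg n f t - f t\<bar> + \<bar>avg n g t - g t\<bar>"
        unfolding avg_add[OF add(1,2)] by linarith
    qed (intro I)
    also have "\<dots> = (\<integral>t. \<bar>avg n f t - f t\<bar> \<partial>M) + (\<integral>t. \<bar>avg n g t - g t\<bar> \<partial>M)"
      by (intro Bochner_Integration.integral_add I)
    finally show "norm (\<integral>t. \<bar>avg n (\<lambda>x. f x + g x) t - (f t + g t)\<bar> \<partial>M) \<le>
        (\<integral>t. \<bar>avg n f t - f t\<bar> \<partial>M) + (\<integral>t. \<bar>avg n g t - g t\<bar> \<partial>M)" by simp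
  qed
  then show ?case using fg by (simp add: avg_conv_def)
next
  case (lim f s)
  show ?case
  proof (rule avg_convI_limit)
    show "integrable M f" by fact
    have "(\<lambda>i. \<integral>t. \<bar>f t - s i t\<bar> \<partial>M) \<longlonglongrightarrow> (\<integral>t. 0 \<partial>M)"
    proof (rule integral_dominated_convergence)
      show "(\<lambda>t. \<bar>f t - s i t\<bar>) \<in> borel_measurable M" for i using lim.hyps(1)[of i] lim.hyps(4) by auto
      \<comment> \<open>The induction rule provides simple functions with
        \<open>\<bar>s i t\<bar> \<le> 2 * \<bar>f t\<bar>\<close>, hence the factor 3.\<close>
      show "integrable M (\<lambda>t. 3 * \<bar>f t\<bar>)" using lim.hyps(4) by simp
      show "AE t in M. (\<lambda>i. \<bar>f t - s i t\<bar>) \<longlonglongrightarrow> 0"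
      proof (rule AE_I2)
        fix t assume "t \<in> space M"
        then have "(\<lambda>i. \<bar>f t - s i t\<bar>) \<longlonglongrightarrow> \<bar>f t - f t\<bar>" by (intro tendsto_intros lim.hyps(2))
        then show "(\<lambda>i. \<bar>f t - s i t\<bar>) \<longlonglongrightarrow> 0" by simp
      qed
      show "AE t in M. norm \<bar>f t - s i t\<bar> \<le> 3 * \<bar>f t\<bar>" for i
      proof (rule AE_I2)
        fix t assume "t \<in> space M"
        then show "norm \<bar>f t - s i t\<bar> \<le> 3 * \<bar>f t\<bar>" using lim.hyps(3)[of t i] by simp
      qed
    qed simp
    then have L: "(\<lambda>i. \<integral>t. \<bar>f t - s i t\<bar> \<partial>M) \<longlonglongrightarrow> 0" by simp
    fix e :: real assume "e > 0"
    then obtain i where "(\<integral>t. \<bar>f t - s i t\<bar> \<partial>M) < e"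
      using eventually_happens[OF order_tendstoD(2)[OF L]] by auto
    then show "\<exists>g. avg_conv g \<and> (\<integral>t. \<bar>f t - g t\<bar> \<partial>M) < e" using lim.IH by blast
  qed
qed

text \<open>Averaging the scalar pairing stands in for pairing \<open>a\<close> with an average of
  \<open>p\<close>, which would be a vector-valued integral. The vector \<open>a\<close> is frozen
  during averaging; later it is \<open>D t\<close>, for the same t as the window.\<close>

abbreviation avgi where "avgi N p n a \<equiv> avg n (\<lambda>r. inner_L2 N (p r) a)"

lemma integrable_norm_L2:
  assumes "p \<in> L2_bochner T N"
  shows "integrable M (\<lambda>t. norm_L2 N (p t))"
proof (rule Bochner_Integration.integrable_bound)
  show "integrable M (\<lambda>t. 1 + (norm_L2 N (p t))\<^sup>2)"
    using assms by (simp add: L2_bochner_iff)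
  show "(\<lambda>t. norm_L2 N (p t)) \<in> borel_measurable M"
    using assms by (simp add: L2_bochner_iff bochner_meas_norm)
  show "AE t in M. norm (norm_L2 N (p t)) \<le> norm (1 + (norm_L2 N (p t))\<^sup>2)"
  proof (rule AE_I2)
    fix t
    have "2 * norm_L2 N (p t) \<le> 1 + (norm_L2 N (p t))\<^sup>2"
      using sum_squares_bound[of 1 "norm_L2 N (p t)"] by simp
    then have "norm_L2 N (p t) \<le> 1 + (norm_L2 N (p t))\<^sup>2" using norm_L2_nonneg[of N "p t"] by linarith
    then show "norm (norm_L2 N (p t)) \<le> norm (1 + (norm_L2 N (p t))\<^sup>2)" by (simp add: norm_L2_nonneg)
  qed
qed

lemma avg_inner_diff:
  assumes p: "p \<in> L2_bochner T N" and "a \<in> L2 N" "b \<in> L2 N"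
  shows "avgi N p n (\<lambda>x. a x - b x) t =
    avgi N p n a t - avgi N p n b t"
proof -
  have "avgi N p n (\<lambda>x. a x - b x) t =
      avg n (\<lambda>s. inner_L2 N (p s) a - inner_L2 N (p s) b) t"
  \<comment> \<open>\<open>avg_mono\<close> tolerates null sets, so two inequalities replace the
    integrand by one equal to it almost everywhere.\<close>
  proof (rule antisym)
    have i: "integrable M (\<lambda>s. inner_L2 N (p s) (\<lambda>x. a x - b x))"
      by (intro L2_bochner_const_inner[OF p] L2_diff assms)
    have i': "integrable M (\<lambda>s. inner_L2 N (p s) a - inner_L2 N (p s) b)"
      by (intro Bochner_Integration.integrable_diff L2_bochner_const_inner[OF p] assms)
    have "AE s in M. inner_L2 N (p s) (\<lambda>x. a x - b x) = inner_L2 N (p s) a - inner_L2 N (p s) b"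
      using L2_bochner_L2[OF p] by eventually_elim (simp add: inner_L2_diff_right assms)
    then show "avgi N p n (\<lambda>x. a x - b x) t \<le> avg n (\<lambda>s. inner_L2 N (p s) a - inner_L2 N (p s) b) t"
      "avg n (\<lambda>s. inner_L2 N (p s) a - inner_L2 N (p s) b) t \<le> avgi N p n (\<lambda>x. a x - b x) t"
      by (auto intro!: avg_mono[OF i i'] avg_mono[OF i' i])
  qed
  then show ?thesis
    by (simp add: avg_diff[OF L2_bochner_const_inner[OF p assms(2)] L2_bochner_const_inner[OF p assms(3)]])
qed

lemma avg_inner_bound:
  assumes p: "p \<in> L2_bochner T N" and a: "a \<in> L2 N" and \<delta>: "\<delta> > 0"
  shows "\<bar>avgi N p n a t\<bar> \<le>
    (\<delta> / 2) * avg n (\<lambda>s. (norm_L2 N (p s))\<^sup>2) t + (norm_L2 N a)\<^sup>2 / (2 * \<delta>)"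
proof -
  have P: "integrable M (\<lambda>s. (norm_L2 N (p s))\<^sup>2)" using p by (simp add: L2_bochner_iff)
  have PI: "integrable M (\<lambda>s. (\<delta> / 2) * (norm_L2 N (p s))\<^sup>2)" using P by simp
  let ?d = "(norm_L2 N a)\<^sup>2 / (2 * \<delta>)"
  have "\<bar>avgi N p n a t\<bar> \<le> avg n (\<lambda>s. \<bar>inner_L2 N (p s) a\<bar>) t" by (rule avg_abs_le)
  also have "\<dots> \<le> avg n (\<lambda>s. (\<delta> / 2) * (norm_L2 N (p s))\<^sup>2 + ?d) t"
  proof (rule avg_mono)
    show "AE s in M. \<bar>inner_L2 N (p s) a\<bar> \<le> (\<delta> / 2) * (norm_L2 N (p s))\<^sup>2 + ?d"
      using L2_bochner_L2[OF p]
    proof eventually_elim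
      case (elim s)
      show ?case using abs_inner_L2_le[OF elim a \<delta>] by (simp add: field_simps)
    qed
  qed (use P L2_bochner_const_inner[OF p a] in auto)
  also have "\<dots> = (\<delta> / 2) * avg n (\<lambda>s. (norm_L2 N (p s))\<^sup>2) t + avg n (\<lambda>s. ?d) t"
    unfolding avg_add[OF PI M.integrable_const] avg_cmult ..
  also have "avg n (\<lambda>s. ?d) t \<le> ?d" using \<delta> by (intro avg_const_le) simp
  finally show ?thesis by simp
qed

text \<open>At each t exactly one summand survives. Freezing the value of the simple function leaves
  finitely many fixed vectors, to which scalar averages apply.\<close>

lemma simple_function_sum_indicator:
  fixes F :: "'y \<Rightarrow> real \<Rightarrow> real"
  assumes "simple_function M s" "t \<in> {0<..<T}"
  shows "F (s t) t = (\<Sum>y\<in>s ` {0<..<T}. indicator (s -` {y} \<inter> {0<..<T}) t * F y t)"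
proof -
  have fin: "finite (s ` {0<..<T})" using simple_functionD(1)[OF assms(1)] by simp
  have "(\<Sum>y\<in>s ` {0<..<T}. indicator (s -` {y} \<inter> {0<..<T}) t * F y t) =
      (\<Sum>y\<in>s ` {0<..<T}. if y = s t then F y t else 0)"
    using assms(2) by (intro sum.cong) (auto simp: indicator_def)
  then show ?thesis using fin assms(2) by simp
qed

text \<open>On each level set of \<open>s\<close> the pairing is with a fixed vector, so
  \<open>avg_conv_integrable\<close> applies there, and there are finitely many level sets.\<close>

lemma avg_inner_simple:
  assumes p: "p \<in> L2_bochner T N"
    and s: "simple_function M s" "\<And>t. t \<in> {0<..<T} \<Longrightarrow> s t \<in> L2 N"
  shows "integrable M (\<lambda>t. avgi N p n (s t) t)"
    and "(\<lambda>n. \<integral>t. avgi N p n (s t) t \<partial>M) \<longlonglongrightarrow> (\<integral>t. inner_L2 N (p t) (s t) \<partial>M)"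
proof -
  let ?R = "s ` {0<..<T}"
  let ?I = "\<lambda>y. indicator (s -` {y} \<inter> {0<..<T}) :: real \<Rightarrow> real"
  have R: "y \<in> ?R \<Longrightarrow> y \<in> L2 N" for y using s(2) by auto
  have A: "s -` {y} \<inter> {0<..<T} \<in> sets M" for y
    using simple_functionD(2)[OF s(1), of "{y}"] by simp
  have q: "integrable M (\<lambda>r. inner_L2 N (p r) y)" if "y \<in> ?R" for y
    by (rule L2_bochner_const_inner[OF p R[OF that]])
  have Iint: "integrable M (\<lambda>t. ?I y t * f t)" if "integrable M f" for y f
    using integrable_mult_indicator[OF A that] by simp
  have i1: "integrable M (\<lambda>t. \<Sum>y\<in>?R. ?I y t * avgi N p n y t)" for n
    by (intro Bochner_Integration.integrable_sum Iint avg_integrable q)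
  show "integrable M (\<lambda>t. avgi N p n (s t) t)"
    by (rule Bochner_Integration.integrable_cong[THEN iffD1, OF refl _ i1[of n]])
      (simp add: simple_function_sum_indicator[OF s(1), of _ "\<lambda>y. avgi N p n y"])
  have e1: "(\<integral>t. avgi N p n (s t) t \<partial>M) =
      (\<Sum>y\<in>?R. \<integral>t. ?I y t * avgi N p n y t \<partial>M)" for n
  proof -
    have "(\<integral>t. avgi N p n (s t) t \<partial>M) =
      (\<integral>t. (\<Sum>y\<in>?R. ?I y t * avgi N p n y t) \<partial>M)"
      by (rule Bochner_Integration.integral_cong[OF refl])
        (simp add: simple_function_sum_indicator[OF s(1), of _ "\<lambda>y. avgi N p n y"])
    also have "\<dots> = (\<Sum>y\<in>?R. \<integral>t. ?I y t * avgi N p n y t \<partial>M)"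
      by (intro Bochner_Integration.integral_sum Iint avg_integrable q)
    finally show ?thesis .
  qed
  have e2: "(\<integral>t. inner_L2 N (p t) (s t) \<partial>M) = (\<Sum>y\<in>?R. \<integral>t. ?I y t * inner_L2 N (p t) y \<partial>M)"
  proof -
    have "(\<integral>t. inner_L2 N (p t) (s t) \<partial>M) = (\<integral>t. (\<Sum>y\<in>?R. ?I y t * inner_L2 N (p t) y) \<partial>M)"
      by (rule Bochner_Integration.integral_cong[OF refl])
        (simp add: simple_function_sum_indicator[OF s(1), of _ "\<lambda>y t. inner_L2 N (p t) y"])
    also have "\<dots> = (\<Sum>y\<in>?R. \<integral>t. ?I y t * inner_L2 N (p t) y \<partial>M)"
      by (intro Bochner_Integration.integral_sum Iint q)
    finally show ?thesis .
  qed
  show "(\<lambda>n. \<integral>t. avgi N p n (s t) t \<partial>M) \<longlonglongrightarrow> (\<integral>t. inner_L2 N (p t) (s t) \<partial>M)"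
    unfolding e1 e2
  proof (rule tendsto_sum)
    fix y assume y: "y \<in> ?R"
    let ?q = "\<lambda>r. inner_L2 N (p r) y"
    have "(\<lambda>n. \<integral>t. \<bar>avg n ?q t - ?q t\<bar> \<partial>M) \<longlonglongrightarrow> 0"
      using avg_conv_integrable[OF q[OF y]] by (simp add: avg_conv_def)
    then have "(\<lambda>n. (\<integral>t. ?I y t * avg n ?q t \<partial>M) - (\<integral>t. ?I y t * ?q t \<partial>M)) \<longlonglongrightarrow> 0"
    proof (rule Lim_null_comparison[rotated], intro always_eventually allI)
      fix n
      have D: "integrable M (\<lambda>t. avg n ?q t - ?q t)"
        by (intro Bochner_Integration.integrable_diff avg_integrable q y)
      have eq: "(\<integral>t. ?I y t * avg n ?q t \<partial>M) - (\<integral>t. ?I y t * ?q t \<partial>M) = (\<integral>t. ?I y t * (avg n ?q t - ?q t) \<partial>M)"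
        by (simp only: Bochner_Integration.integral_diff[OF Iint[OF avg_integrable[OF q[OF y]]] Iint[OF q[OF y]]]
            right_diff_distrib)
      have "norm (\<integral>t. ?I y t * (avg n ?q t - ?q t) \<partial>M) \<le> (\<integral>t. norm (?I y t * (avg n ?q t - ?q t)) \<partial>M)"
        by (rule integral_norm_bound)
      also have "\<dots> \<le> (\<integral>t. \<bar>avg n ?q t - ?q t\<bar> \<partial>M)"
        by (intro integral_mono integrable_norm Iint D integrable_abs) (auto simp: indicator_def)
      finally show "norm ((\<integral>t. ?I y t * avg n ?q t \<partial>M) - (\<integral>t. ?I y t * ?q t \<partial>M)) \<le> (\<integral>t. \<bar>avg n ?q t - ?q t\<bar> \<partial>M)"
        unfolding eq .
    qed
    then show "(\<lambda>n. \<integral>t. ?I y t * avg n ?q t \<partial>M) \<longlonglongrightarrow> (\<integral>t. ?I y t * ?q t \<partial>M)" by (simp flip: Lim_null)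
  qed
qed

text \<open>\<open>D\<close> is approximated by simple functions; at almost every t the error is at
  most the norm of \<open>D t - s k t\<close> times the average of the norm of
  \<open>p\<close>.\<close>

lemma avg_inner_measurable:
  assumes p: "p \<in> L2_bochner T N" and D: "D \<in> L2_bochner T N"
  shows "(\<lambda>t. avgi N p n (D t) t) \<in> borel_measurable M"
proof -
  have D': "bochner_meas T N D" using D by (simp add: L2_bochner_iff)
  obtain s where s: "\<And>k::nat. simple_function M (s k)" "\<And>k t. t \<in> {0<..<T} \<Longrightarrow> s k t \<in> L2 N"
    "AE t in M. (\<lambda>k. norm_L2 N (\<lambda>x. D t x - s k t x)) \<longlonglongrightarrow> 0"
    using bochner_measE[OF D'] by blast
  show ?thesis
  proof (rule borel_measurable_lebesgue_on_AE_lim[OF Ioo_lebesgue])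
    show "(\<lambda>t. avgi N p n (s k t) t) \<in> borel_measurable M" for k
      using avg_inner_simple(1)[OF p s(1,2)] by blast
    show "AE t in M. (\<lambda>k. avgi N p n (s k t) t) \<longlonglongrightarrow> avgi N p n (D t) t"
      using s(3) L2_bochner_L2[OF D] AE_Ioo
    proof eventually_elim
      case (elim t)
      let ?P = "avg n (\<lambda>r. norm_L2 N (p r)) t"
      have "(\<lambda>k. avgi N p n (s k t) t - avgi N p n (D t) t) \<longlonglongrightarrow> 0"
      proof (rule Lim_null_comparison)
        show "(\<lambda>k. norm_L2 N (\<lambda>x. D t x - s k t x) * ?P) \<longlonglongrightarrow> 0"
          by (rule tendsto_mult_left_zero[OF elim(1)])
        show "\<forall>\<^sub>F k in sequentially. norm (avgi N p n (s k t) t - avgi N p n (D t) t)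
            \<le> norm_L2 N (\<lambda>x. D t x - s k t x) * ?P"
        proof (intro always_eventually allI)
          fix k
          note L = elim(2) s(2)[OF elim(3), of k]
          let ?e = "\<lambda>x. D t x - s k t x"
          have "norm (avgi N p n (s k t) t - avgi N p n (D t) t) =
              \<bar>avgi N p n ?e t\<bar>"
            by (simp add: avg_inner_diff[OF p L] abs_minus_commute)
          also have "\<dots> \<le> avg n (\<lambda>r. \<bar>inner_L2 N (p r) ?e\<bar>) t" by (rule avg_abs_le)
          also have "\<dots> \<le> avg n (\<lambda>r. norm_L2 N ?e * norm_L2 N (p r)) t"
          proof (rule avg_mono)
            show "AE r in M. \<bar>inner_L2 N (p r) ?e\<bar> \<le> norm_L2 N ?e * norm_L2 N (p r)"
              using L2_bochner_L2[OF p]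
            proof eventually_elim
              case (elim r)
              show ?case using inner_L2_le[OF elim L2_diff[OF L]] by (simp add: mult.commute)
            qed
          qed (use integrable_norm_L2[OF p] L2_bochner_const_inner[OF p L2_diff[OF L]] in auto)
          also have "\<dots> = norm_L2 N ?e * ?P" by (rule avg_cmult)
          finally show "norm (avgi N p n (s k t) t - avgi N p n (D t) t)
            \<le> norm_L2 N ?e * ?P" .
        qed
      qed
      then show ?case by (simp flip: Lim_null)
    qed
  qed
qed

text \<open>The second bound is uniform in n, because averaging does not increase the integral of a
  nonnegative function. This uniformity allows \<open>D\<close> to be approximated before n tends to
  infinity.\<close>

lemma avg_inner_integrable:
  assumes p: "p \<in> L2_bochner T N" and D: "D \<in> L2_bochner T N" and \<delta>: "\<delta> > 0"
  shows "integrable M (\<lambda>t. avgi N p n (D t) t)"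
    and "\<bar>\<integral>t. avgi N p n (D t) t \<partial>M\<bar> \<le>
      (\<delta> / 2) * (\<integral>t. (norm_L2 N (p t))\<^sup>2 \<partial>M) + (\<integral>t. (norm_L2 N (D t))\<^sup>2 \<partial>M) / (2 * \<delta>)"
proof -
  have P: "integrable M (\<lambda>s. (norm_L2 N (p s))\<^sup>2)" using p by (simp add: L2_bochner_iff)
  have DD: "integrable M (\<lambda>s. (norm_L2 N (D s))\<^sup>2)" using D by (simp add: L2_bochner_iff)
  let ?A = "\<lambda>t. avgi N p n (D t) t"
  let ?B = "\<lambda>\<delta> t. (\<delta> / 2) * avg n (\<lambda>s. (norm_L2 N (p s))\<^sup>2) t + (norm_L2 N (D t))\<^sup>2 / (2 * \<delta>)"
  have B: "integrable M (?B \<delta>)" using avg_integrable[OF P] DD by simp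
  have ae: "AE t in M. \<bar>?A t\<bar> \<le> ?B \<delta> t"
    using L2_bochner_L2[OF D] by eventually_elim (rule avg_inner_bound[OF p _ \<delta>])
  show A: "integrable M ?A"
    by (rule Bochner_Integration.integrable_bound[OF B avg_inner_measurable[OF p D]])
      (use ae in \<open>eventually_elim, simp\<close>)
  have "\<bar>\<integral>t. ?A t \<partial>M\<bar> \<le> (\<integral>t. \<bar>?A t\<bar> \<partial>M)" using integral_norm_bound[of M ?A] by simp
  also have "\<dots> \<le> (\<integral>t. ?B \<delta> t \<partial>M)" using A B ae by (intro integral_mono_AE) auto
  also have "\<dots> = (\<delta> / 2) * (\<integral>t. avg n (\<lambda>s. (norm_L2 N (p s))\<^sup>2) t \<partial>M) + (\<integral>t. (norm_L2 N (D t))\<^sup>2 \<partial>M) / (2 * \<delta>)"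
    using avg_integrable[OF P] DD by simp
  also have "(\<delta> / 2) * (\<integral>t. avg n (\<lambda>s. (norm_L2 N (p s))\<^sup>2) t \<partial>M) \<le> (\<delta> / 2) * (\<integral>t. (norm_L2 N (p t))\<^sup>2 \<partial>M)"
    using integral_avg_nonneg_le[OF P] \<delta> by (intro mult_left_mono) auto
  finally show "\<bar>\<integral>t. ?A t \<partial>M\<bar> \<le> (\<delta> / 2) * (\<integral>t. (norm_L2 N (p t))\<^sup>2 \<partial>M) + (\<integral>t. (norm_L2 N (D t))\<^sup>2 \<partial>M) / (2 * \<delta>)"
    by simp
qed

lemma integral_inner_bound:
  assumes p: "p \<in> L2_bochner T N" and D: "D \<in> L2_bochner T N" and \<delta>: "\<delta> > 0"
  shows "\<bar>\<integral>t. inner_L2 N (p t) (D t) \<partial>M\<bar> \<le>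
      (\<delta> / 2) * (\<integral>t. (norm_L2 N (p t))\<^sup>2 \<partial>M) + (\<integral>t. (norm_L2 N (D t))\<^sup>2 \<partial>M) / (2 * \<delta>)"
proof -
  have P: "integrable M (\<lambda>s. (norm_L2 N (p s))\<^sup>2)" using p by (simp add: L2_bochner_iff)
  have DD: "integrable M (\<lambda>s. (norm_L2 N (D s))\<^sup>2)" using D by (simp add: L2_bochner_iff)
  have "\<bar>\<integral>t. inner_L2 N (p t) (D t) \<partial>M\<bar> \<le> (\<integral>t. \<bar>inner_L2 N (p t) (D t)\<bar> \<partial>M)"
    using integral_norm_bound[of M "\<lambda>t. inner_L2 N (p t) (D t)"] by simp
  also have "\<dots> \<le> (\<integral>t. (\<delta> / 2) * (norm_L2 N (p t))\<^sup>2 + (norm_L2 N (D t))\<^sup>2 / (2 * \<delta>) \<partial>M)"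
  proof (rule integral_mono_AE)
    show "AE t in M. \<bar>inner_L2 N (p t) (D t)\<bar> \<le> (\<delta> / 2) * (norm_L2 N (p t))\<^sup>2 + (norm_L2 N (D t))\<^sup>2 / (2 * \<delta>)"
      using L2_bochner_L2[OF p] L2_bochner_L2[OF D]
    proof eventually_elim
      case (elim t)
      show ?case using abs_inner_L2_le[OF elim \<delta>] by (simp add: field_simps)
    qed
  qed (use P DD L2_bochner_integrable_inner[OF p D] in auto)
  also have "\<dots> = (\<delta> / 2) * (\<integral>t. (norm_L2 N (p t))\<^sup>2 \<partial>M) + (\<integral>t. (norm_L2 N (D t))\<^sup>2 \<partial>M) / (2 * \<delta>)"
    using P DD by simp
  finally show ?thesis .
qed

lemma avg_inner_tendsto:
  assumes p: "p \<in> L2_bochner T N" and D: "D \<in> L2_bochner T N"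
  shows "(\<lambda>n. \<integral>t. avgi N p n (D t) t \<partial>M) \<longlonglongrightarrow> (\<integral>t. inner_L2 N (p t) (D t) \<partial>M)"
proof (rule LIMSEQ_I)
  fix e :: real assume e: "e > 0"
  define P where "P = (\<integral>t. (norm_L2 N (p t))\<^sup>2 \<partial>M)"
  have P0: "P \<ge> 0" by (simp add: P_def)
  \<comment> \<open>Chosen so that the share of \<open>p\<close> in the weighted bound is at most
    e/8; the added 1 avoids division by 0.\<close>
  define \<delta> where "\<delta> = e / (4 * (P + 1))"
  have \<delta>: "\<delta> > 0" using e P0 by (simp add: \<delta>_def)
  have \<delta>P: "(\<delta> / 2) * P \<le> e / 8"
    using e P0 by (simp add: \<delta>_def field_simps)
  obtain s where s: "\<And>k::nat. simple_function M (s k)" "\<And>k t. t \<in> {0<..<T} \<Longrightarrow> s k t \<in> L2 N"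
    "(\<lambda>k. \<integral>t. (norm_L2 N (\<lambda>x. D t x - s k t x))\<^sup>2 \<partial>M) \<longlonglongrightarrow> 0"
    using L2_bochner_simple_approx[OF D] by blast
  \<comment> \<open>Makes the other share at most e/8. Both remainders are then at most e/4, and an
    error below e/4 is left for the simple part.\<close>
  have "0 < e * \<delta> / 4" using e \<delta> by simp
  from eventually_happens[OF order_tendstoD(2)[OF s(3) this]]
  obtain k where k: "(\<integral>t. (norm_L2 N (\<lambda>x. D t x - s k t x))\<^sup>2 \<partial>M) < e * \<delta> / 4" by auto
  define S where "S = s k"
  define R where "R t x = D t x - S t x" for t x
  have S: "S \<in> L2_bochner T N" unfolding S_def by (rule simple_L2_bochner[OF s(1,2)])
  have R: "R \<in> L2_bochner T N" unfolding R_def[abs_def] by (rule L2_bochner_diff[OF D S])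
  have RR: "(\<integral>t. (norm_L2 N (R t))\<^sup>2 \<partial>M) / (2 * \<delta>) \<le> e / 8"
    using k \<delta> by (simp add: R_def[abs_def] S_def field_simps)
  have small1: "\<bar>\<integral>t. avgi N p n (R t) t \<partial>M\<bar> \<le> e / 4" for n
    using avg_inner_integrable(2)[OF p R \<delta>, of n] RR \<delta>P unfolding P_def by linarith
  have small2: "\<bar>\<integral>t. inner_L2 N (p t) (R t) \<partial>M\<bar> \<le> e / 4"
    using integral_inner_bound[OF p R \<delta>] RR \<delta>P unfolding P_def by linarith
  have split1: "(\<integral>t. avgi N p n (D t) t \<partial>M) =
      (\<integral>t. avgi N p n (S t) t \<partial>M) + (\<integral>t. avgi N p n (R t) t \<partial>M)" for n
  proof -
    note I = avg_inner_integrable(1)[OF p S \<delta>, of n] avg_inner_integrable(1)[OF p R \<delta>, of n]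
    have "(\<integral>t. avgi N p n (D t) t \<partial>M) =
        (\<integral>t. avgi N p n (S t) t + avgi N p n (R t) t \<partial>M)"
    proof (rule integral_cong_AE_lebesgue_on[OF Ioo_lebesgue _ avg_inner_measurable[OF p D]])
      show "AE t in M. avgi N p n (D t) t =
          avgi N p n (S t) t + avgi N p n (R t) t"
        using L2_bochner_L2[OF D] L2_bochner_L2[OF S]
        by eventually_elim (simp add: R_def[abs_def] avg_inner_diff[OF p])
    qed
    then show ?thesis by (simp add: I)
  qed
  have split2: "(\<integral>t. inner_L2 N (p t) (D t) \<partial>M) = (\<integral>t. inner_L2 N (p t) (S t) \<partial>M) + (\<integral>t. inner_L2 N (p t) (R t) \<partial>M)"
  proof -
    note I = L2_bochner_integrable_inner[OF p S] L2_bochner_integrable_inner[OF p R]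
    have "(\<integral>t. inner_L2 N (p t) (D t) \<partial>M) = (\<integral>t. inner_L2 N (p t) (S t) + inner_L2 N (p t) (R t) \<partial>M)"
    proof (rule integral_cong_AE_lebesgue_on[OF Ioo_lebesgue])
      show "AE t in M. inner_L2 N (p t) (D t) = inner_L2 N (p t) (S t) + inner_L2 N (p t) (R t)"
        using L2_bochner_L2[OF p] L2_bochner_L2[OF D] L2_bochner_L2[OF S]
        by eventually_elim (simp add: R_def[abs_def] inner_L2_diff_right)
    qed (use L2_bochner_integrable_inner[OF p D] in auto)
    then show ?thesis by (simp add: I)
  qed
  have "(\<lambda>n. \<integral>t. avgi N p n (S t) t \<partial>M) \<longlonglongrightarrow> (\<integral>t. inner_L2 N (p t) (S t) \<partial>M)"
    unfolding S_def by (rule avg_inner_simple(2)[OF p s(1,2)])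
  from LIMSEQ_D[OF this, of "e / 4"] e obtain m where m: "\<And>n. n \<ge> m \<Longrightarrow>
      norm ((\<integral>t. avgi N p n (S t) t \<partial>M) - (\<integral>t. inner_L2 N (p t) (S t) \<partial>M)) < e / 4" by auto
  have "norm ((\<integral>t. avgi N p n (D t) t \<partial>M) - (\<integral>t. inner_L2 N (p t) (D t) \<partial>M)) < e" if "n \<ge> m" for n
    using m[OF that] small1[of n] small2 e unfolding split1 split2 real_norm_def by linarith
  then show "\<exists>no. \<forall>n\<ge>no. norm ((\<integral>t. avgi N p n (D t) t \<partial>M) - (\<integral>t. inner_L2 N (p t) (D t) \<partial>M)) < e"
    by blast
qed

end

section \<open>Weak derivatives in time\<close>

lemma continuous_Icc_integrable_Ioo:
  fixes h :: "real \<Rightarrow> real"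
  assumes "continuous_on {0..T} h"
  shows "integrable (lebesgue_on {0<..<T}) h"
proof -
  have "integrable (lebesgue_on {0..T}) h"
    using continuous_imp_integrable_real[OF assms] .
  then have "set_integrable lebesgue {0..T} h"
    by (simp add: integrable_restrict_space set_integrable_def)
  then have "set_integrable lebesgue {0<..<T} h" by (rule set_integrable_subset) auto
  then show ?thesis by (simp add: integrable_restrict_space set_integrable_def)
qed

lemma integral_Ioo_FTC:
  fixes F f :: "real \<Rightarrow> real"
  assumes F: "\<And>x. (F has_real_derivative f x) (at x)" and f: "continuous_on UNIV f" and "0 \<le> T"
  shows "(\<integral>t. f t \<partial>lebesgue_on {0<..<T}) = F T - F 0"
proof -
  have "(f has_integral F T - F 0) {0..T}"
    using assms by (intro fundamental_theorem_of_calculus)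
      (auto simp: has_real_derivative_iff_has_vector_derivative intro: has_vector_derivative_at_within)
  then have "integral {0<..<T} f = F T - F 0"
    by (simp add: integral_unique flip: integral_open_interval_real)
  moreover have "integrable (lebesgue_on {0<..<T}) f"
    using f by (intro continuous_Icc_integrable_Ioo) (blast intro: continuous_on_subset)
  ultimately show ?thesis by (simp add: lebesgue_integral_eq_integral)
qed

text \<open>The kernels have unit mass inside (0, T) and concentrate at x from whichever side is
  available, so x may be an endpoint.\<close>

lemma integral_approx_delta:
  fixes h :: "real \<Rightarrow> real" and \<rho> :: "nat \<Rightarrow> real \<Rightarrow> real"
  assumes h: "continuous_on {0..T} h" and x: "x \<in> {0..T}"
    and \<rho>: "\<And>n t. 0 \<le> \<rho> n t" "\<And>n. integrable (lebesgue_on {0<..<T}) (\<rho> n)"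
      "\<And>n. (\<integral>t. \<rho> n t \<partial>lebesgue_on {0<..<T}) = 1"
      "\<And>n. integrable (lebesgue_on {0<..<T}) (\<lambda>t. \<rho> n t * h t)"
    and supp: "\<And>n t. t \<in> {0<..<T} \<Longrightarrow> \<rho> n t \<noteq> 0 \<Longrightarrow> \<bar>t - x\<bar> \<le> \<epsilon> n" and \<epsilon>: "\<epsilon> \<longlonglongrightarrow> 0"
  shows "(\<lambda>n. \<integral>t. \<rho> n t * h t \<partial>lebesgue_on {0<..<T}) \<longlonglongrightarrow> h x"
proof (rule LIMSEQ_I)
  fix r :: real assume r: "r > 0"
  obtain d where d: "d > 0" "\<And>t. t \<in> {0..T} \<Longrightarrow> \<bar>t - x\<bar> < d \<Longrightarrow> \<bar>h t - h x\<bar> < r / 2"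
    using h x r unfolding continuous_on_iff dist_real_def by (metis half_gt_zero)
  have "\<forall>\<^sub>F n in sequentially. \<epsilon> n < d" using order_tendstoD(2)[OF \<epsilon> d(1)] .
  then have "\<forall>\<^sub>F n in sequentially. norm ((\<integral>t. \<rho> n t * h t \<partial>lebesgue_on {0<..<T}) - h x) < r"
  proof eventually_elim
    case (elim n)
    have i: "integrable (lebesgue_on {0<..<T}) (\<lambda>t. \<rho> n t * h t - \<rho> n t * h x)"
      using \<rho>(2,4)[of n] by simp
    have eq: "(\<integral>t. \<rho> n t * h t \<partial>lebesgue_on {0<..<T}) - h x = (\<integral>t. \<rho> n t * h t - \<rho> n t * h x \<partial>lebesgue_on {0<..<T})"
      using \<rho>(2,3,4)[of n] by simp
    have "norm (\<integral>t. \<rho> n t * h t - \<rho> n t * h x \<partial>lebesgue_on {0<..<T}) \<le>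
        (\<integral>t. norm (\<rho> n t * h t - \<rho> n t * h x) \<partial>lebesgue_on {0<..<T})" by (rule integral_norm_bound)
    also have "\<dots> \<le> (\<integral>t. \<rho> n t * (r / 2) \<partial>lebesgue_on {0<..<T})"
    proof (rule integral_mono_AE)
      show "AE t in lebesgue_on {0<..<T}. norm (\<rho> n t * h t - \<rho> n t * h x) \<le> \<rho> n t * (r / 2)"
        using AE_Ioo
      proof eventually_elim
        fix t assume t: "t \<in> {0<..<T}"
        show "norm (\<rho> n t * h t - \<rho> n t * h x) \<le> \<rho> n t * (r / 2)"
        proof (cases "\<rho> n t = 0")
          case False
          then have "\<bar>h t - h x\<bar> < r / 2" using supp[OF t False] d(2)[of t] t elim by auto
          moreover have "norm (\<rho> n t * h t - \<rho> n t * h x) = \<rho> n t * \<bar>h t - h x\<bar>"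
            using \<rho>(1)[of n t] by (simp add: abs_mult flip: right_diff_distrib)
          moreover have "\<rho> n t * \<bar>h t - h x\<bar> \<le> \<rho> n t * (r / 2)"
            using calculation(1) \<rho>(1)[of n t] by (intro mult_left_mono) auto
          ultimately show ?thesis by simp
        qed simp
      qed
    qed (use i \<rho>(2)[of n] in auto)
    also have "\<dots> = r / 2" using \<rho>(2,3)[of n] by simp
    finally show ?case unfolding eq using r by simp
  qed
  then show "\<exists>no. \<forall>n\<ge>no. norm ((\<integral>t. \<rho> n t * h t \<partial>lebesgue_on {0<..<T}) - h x) < r"
    by (simp add: eventually_sequentially)
qed

text \<open>Smooth plateaus that approximate the indicator of (a, b) serve as test functions: their
  derivative is a unit mass near a minus a unit mass near b, and continuity of \<open>h\<close> on
  the closed interval identifies the limits.\<close>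

lemma weak_derivative_FTC:
  fixes h q :: "real \<Rightarrow> real"
  assumes h: "continuous_on {0..T} h" and q: "integrable (lebesgue_on {0<..<T}) q"
    and weak: "\<And>\<psi>. test_function {0<..<T} \<psi> \<Longrightarrow>
      (\<integral>t. deriv \<psi> t * h t \<partial>lebesgue_on {0<..<T}) = - (\<integral>t. \<psi> t * q t \<partial>lebesgue_on {0<..<T})"
    and ab: "0 \<le> a" "a < b" "b \<le> T"
  shows "h b - h a = (\<integral>t. indicator {a<..<b} t * q t \<partial>lebesgue_on {0<..<T})"
proof -
  let ?M = "lebesgue_on {0<..<T}"
  obtain \<theta> \<theta>' :: "real \<Rightarrow> real" where \<theta>:
    "C_inf \<theta>" "\<And>x. (\<theta> has_real_derivative \<theta>' x) (at x)" "continuous_on UNIV \<theta>'"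
    "\<And>x. \<theta>' x \<ge> 0" "\<And>x. x \<le> 0 \<Longrightarrow> \<theta>' x = 0" "\<And>x. x \<ge> 1 \<Longrightarrow> \<theta>' x = 0"
    "\<And>x. x \<le> 0 \<Longrightarrow> \<theta> x = 0" "\<And>x. x \<ge> 1 \<Longrightarrow> \<theta> x = 1"
    "\<And>x. 0 \<le> \<theta> x" "\<And>x. \<theta> x \<le> 1"
    using smooth_step_ex by metis
  \<comment> \<open>The summand 3 / (b - a) ensures \<open>k n * (b - a) \<ge> 3\<close> for every
    n: then \<open>g n\<close> is still 0 where \<open>f n\<close> is, and \<open>f n\<close> has
    already reached 1 where \<open>g n\<close> has.\<close>
  define k where "k n = real n + 3 / (b - a)" for n :: nat
  have k: "k n > 0" "k n * (b - a) \<ge> 3" for n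
  proof -
    have "3 / c * c = 3" if "c \<noteq> 0" for c :: real using that by simp
    from this[of "b - a"] have "3 / (b - a) * (b - a) = 3" using ab by argo
    then have "k n * (b - a) = real n * (b - a) + 3" by (simp only: k_def distrib_right)
    then show "k n * (b - a) \<ge> 3" using ab by simp
    show "k n > 0" using ab unfolding k_def by (intro add_nonneg_pos) auto
  qed
  have klim: "(\<lambda>n. 2 / k n) \<longlonglongrightarrow> 0"
  proof -
    have "filterlim k at_top sequentially" unfolding k_def
      by (subst add.commute, rule filterlim_tendsto_add_at_top[OF tendsto_const filterlim_real_sequentially])
    then show ?thesis by (rule real_tendsto_divide_at_top[OF tendsto_const])
  qed
  define f where "f n t = \<theta> (k n * (t - a) - 1)" for n t
  define g where "g n t = \<theta> (k n * (t - b) + 2)" for n t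
  define f' where "f' n t = k n * \<theta>' (k n * (t - a) - 1)" for n t
  define g' where "g' n t = k n * \<theta>' (k n * (t - b) + 2)" for n t
  have df: "(f n has_real_derivative f' n t) (at t)" for n t
    unfolding f_def f'_def by (rule DERIV_chain'[OF _ \<theta>(2), THEN DERIV_cong]) (auto intro!: derivative_eq_intros)
  have dg: "(g n has_real_derivative g' n t) (at t)" for n t
    unfolding g_def g'_def by (rule DERIV_chain'[OF _ \<theta>(2), THEN DERIV_cong]) (auto intro!: derivative_eq_intros)
  have cf: "continuous_on UNIV (f' n)" "continuous_on UNIV (g' n)" for n
    unfolding f'_def g'_def
    by (intro continuous_intros continuous_on_compose2[OF \<theta>(3)]; simp)+
  \<comment> \<open>a plateau rising on \<open>[a + 1/k, a + 2/k]\<close> and falling on \<open>[b - 2/k, b - 1/k]\<close>, so that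
    \<open>a = 0\<close> and \<open>b = T\<close> are allowed\<close>
  have test: "test_function {0<..<T} (\<lambda>t. f n t - g n t)" for n
    unfolding test_function_def
  proof (intro conjI exI[of _ "{a + 1 / k n..b - 1 / k n}"] allI impI)
    have "C_inf (\<lambda>t::real. \<theta> (k n * (t \<bullet> 1) + (- k n * a - 1)))" "C_inf (\<lambda>t::real. \<theta> (k n * (t \<bullet> 1) + (- k n * b + 2)))"
      by (intro C_inf_compose_affine \<theta>(1))+
    then show "C_inf (\<lambda>t. f n t - g n t)"
      unfolding f_def g_def by (intro C_inf_diff) (simp_all add: algebra_simps)
    define r where "r = 1 / k n"
    have "r > 0" using k by (simp add: r_def)
    then show "{a + 1 / k n..b - 1 / k n} \<subseteq> {0<..<T}" using ab unfolding r_def[symmetric] by auto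
    fix t :: real assume "t \<notin> {a + 1 / k n..b - 1 / k n}"
    then consider "t < a + 1 / k n" | "t > b - 1 / k n" by fastforce
    then show "f n t - g n t = 0"
    proof cases
      case 1
      then have "k n * (t - a) < 1" using k(1)[of n] by (simp add: field_simps)
      moreover from this have "k n * (t - b) + 2 \<le> 0" using k(2)[of n] by (simp add: algebra_simps)
      ultimately show ?thesis by (simp add: f_def g_def \<theta>)
    next
      case 2
      then have "k n * (t - b) > - 1" using k(1)[of n] by (simp add: field_simps)
      moreover from this have "k n * (t - a) - 1 \<ge> 1" using k(2)[of n] by (simp add: algebra_simps)
      ultimately show ?thesis by (simp add: f_def g_def \<theta>)
    qed
  qed simp
  have hint: "integrable ?M (\<lambda>t. f' n t * h t)" "integrable ?M (\<lambda>t. g' n t * h t)"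
    "integrable ?M (f' n)" "integrable ?M (g' n)" for n
    by (intro continuous_Icc_integrable_Ioo continuous_on_mult h continuous_on_subset[OF cf(1)]
        continuous_on_subset[OF cf(2)] subset_UNIV)+
  have limf: "(\<lambda>n. \<integral>t. f' n t * h t \<partial>?M) \<longlonglongrightarrow> h a"
  proof (rule integral_approx_delta[OF h _ _ hint(3) _ hint(1) _ klim])
    show "a \<in> {0..T}" using ab by simp
    show "0 \<le> f' n t" for n t using k(1)[of n] \<theta>(4) by (simp add: f'_def)
    show "(\<integral>t. f' n t \<partial>?M) = 1" for n
    proof -
      have "k n * (b - a) \<le> k n * (T - a)" using ab k(1)[of n] by (intro mult_left_mono) auto
      then have "k n * (T - a) - 1 \<ge> 1" using k(2)[of n] by linarith
      moreover have "0 \<le> k n * a" using ab k(1)[of n] by (intro mult_nonneg_nonneg) auto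
      then have "k n * (0 - a) - 1 \<le> 0" by simp
      moreover have "(\<integral>t. f' n t \<partial>?M) = f n T - f n 0"
        using ab by (intro integral_Ioo_FTC[OF df cf(1)]) simp
      ultimately show ?thesis unfolding f_def by (simp add: \<theta>(7,8))
    qed
    show "\<bar>t - a\<bar> \<le> 2 / k n" if "t \<in> {0<..<T}" "f' n t \<noteq> 0" for n t
    proof -
      have "\<not> k n * (t - a) - 1 \<le> 0" "\<not> k n * (t - a) - 1 \<ge> 1" using that(2) \<theta>(5,6) by (auto simp: f'_def)
      then have "1 < k n * (t - a)" "k n * (t - a) < 2" by auto
      then have "0 < k n * (t - a)" "(t - a) * k n < 2" by (auto simp: mult.commute)
      then have "0 < t - a" "t - a < 2 / k n" using k(1)[of n] by (auto simp: zero_less_mult_iff less_divide_eq)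
      then show ?thesis by simp
    qed
  qed
  have limg: "(\<lambda>n. \<integral>t. g' n t * h t \<partial>?M) \<longlonglongrightarrow> h b"
  proof (rule integral_approx_delta[OF h _ _ hint(4) _ hint(2) _ klim])
    show "b \<in> {0..T}" using ab by simp
    show "0 \<le> g' n t" for n t using k(1)[of n] \<theta>(4) by (simp add: g'_def)
    show "(\<integral>t. g' n t \<partial>?M) = 1" for n
    proof -
      have "k n * (b - a) \<le> k n * b" using ab k(1)[of n] by (intro mult_left_mono) auto
      then have "k n * (0 - b) + 2 \<le> 0" using k(2)[of n] by simp
      moreover have "k n * (T - b) \<ge> 0" using ab k(1)[of n] by (intro mult_nonneg_nonneg) auto
      then have "k n * (T - b) + 2 \<ge> 1" by simp
      moreover have "(\<integral>t. g' n t \<partial>?M) = g n T - g n 0"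
        using ab by (intro integral_Ioo_FTC[OF dg cf(2)]) simp
      ultimately show ?thesis unfolding g_def by (simp add: \<theta>(7,8))
    qed
    show "\<bar>t - b\<bar> \<le> 2 / k n" if "t \<in> {0<..<T}" "g' n t \<noteq> 0" for n t
    proof -
      have "\<not> k n * (t - b) + 2 \<le> 0" "\<not> k n * (t - b) + 2 \<ge> 1" using that(2) \<theta>(5,6) by (auto simp: g'_def)
      then have "0 < k n * (b - t)" "(b - t) * k n < 2" by (auto simp: algebra_simps)
      then have "0 < b - t" "b - t < 2 / k n" using k(1)[of n] by (auto simp: zero_less_mult_iff less_divide_eq)
      then show ?thesis by simp
    qed
  qed
  have "(\<lambda>n. \<integral>t. (f n t - g n t) * q t \<partial>?M) \<longlonglongrightarrow> (\<integral>t. indicator {a<..<b} t * q t \<partial>?M)"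
  proof (rule integral_dominated_convergence[where w="\<lambda>t. \<bar>q t\<bar>"])
    show "(\<lambda>t. indicator {a<..<b} t * q t) \<in> borel_measurable ?M"
      using q by (intro borel_measurable_times indicator_Ioo_measurable) auto
    show "(\<lambda>t. (f n t - g n t) * q t) \<in> borel_measurable ?M" for n
      using q by (intro borel_measurable_times test_function_borel_measurable[OF test]) auto
    show "AE t in ?M. norm ((f n t - g n t) * q t) \<le> \<bar>q t\<bar>" for n
    proof (rule AE_I2)
      fix t
      have "\<bar>f n t - g n t\<bar> \<le> 1"
        unfolding f_def g_def using \<theta>(9,10)[of "k n * (t - a) - 1"] \<theta>(9,10)[of "k n * (t - b) + 2"]
        by (simp add: abs_le_iff)
      then show "norm ((f n t - g n t) * q t) \<le> \<bar>q t\<bar>" by (simp add: abs_mult mult_left_le_one_le)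
    qed
    show "AE t in ?M. (\<lambda>n. (f n t - g n t) * q t) \<longlonglongrightarrow> indicator {a<..<b} t * q t"
    proof (intro AE_I2 tendsto_mult tendsto_const)
      fix t
      show "(\<lambda>n. f n t - g n t) \<longlonglongrightarrow> indicator {a<..<b} t"
      proof (cases "t \<in> {a<..<b}")
        case True
        then have "0 < min (t - a) (b - t)" by auto
        from order_tendstoD(2)[OF klim this]
        have "\<forall>\<^sub>F n in sequentially. f n t - g n t = 1"
        proof eventually_elim
          case (elim n)
          then have "2 < (t - a) * k n" "2 < (b - t) * k n" using k(1)[of n] by (auto simp: divide_less_eq)
          then have "k n * (t - a) - 1 \<ge> 1" "k n * (t - b) + 2 \<le> 0" by (auto simp: algebra_simps)
          then show ?case by (simp add: f_def g_def \<theta>)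
        qed
        then show ?thesis using True by (simp add: tendsto_eventually)
      next
        case False
        have "f n t - g n t = 0" for n
        proof (cases "t \<le> a")
          case True
          then have "k n * (t - a) \<le> 0" using k(1)[of n] by (intro mult_nonneg_nonpos) auto
          moreover from this have "k n * (t - b) + 2 \<le> 0" using k(2)[of n] by (simp add: algebra_simps)
          ultimately show ?thesis by (simp add: f_def g_def \<theta>)
        next
          case F: False
          then have "0 \<le> k n * (t - b)" using False k(1)[of n] by (intro mult_nonneg_nonneg) auto
          moreover from this have "k n * (t - a) - 1 \<ge> 1" using k(2)[of n] by (simp add: algebra_simps)
          ultimately show ?thesis by (simp add: f_def g_def \<theta>)
        qed
        then show ?thesis using False by simp
      qed
    qed
  qed (use q in auto)
  moreover have "(\<integral>t. (f n t - g n t) * q t \<partial>?M) = (\<integral>t. g' n t * h t \<partial>?M) - (\<integral>t. f' n t * h t \<partial>?M)" for n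
  proof -
    have "deriv (\<lambda>t. f n t - g n t) t = f' n t - g' n t" for t
      by (intro DERIV_imp_deriv DERIV_diff df dg)
    then have "(\<integral>t. f' n t * h t - g' n t * h t \<partial>?M) = - (\<integral>t. (f n t - g n t) * q t \<partial>?M)"
      using weak[OF test[of n]] by (simp add: left_diff_distrib)
    then show ?thesis using hint by simp
  qed
  ultimately have "(\<lambda>n. (\<integral>t. g' n t * h t \<partial>?M) - (\<integral>t. f' n t * h t \<partial>?M)) \<longlonglongrightarrow> (\<integral>t. indicator {a<..<b} t * q t \<partial>?M)"
    by simp
  from LIMSEQ_unique[OF this tendsto_diff[OF limg limf]] show ?thesis by simp
qed

section \<open>The energy identity\<close>

lemma difference_quotient_integral:
  fixes E :: "real \<Rightarrow> real"
  assumes E: "continuous_on UNIV E" and "0 \<le> T" and h: "h \<longlonglongrightarrow> 0" "\<And>n::nat. h n \<noteq> 0"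
  shows "(\<lambda>n. (\<integral>t. E (t + h n) - E t \<partial>lebesgue_on {0<..<T}) / h n) \<longlonglongrightarrow> E T - E 0"
proof -
  have "isCont E x" for x using E by (simp add: continuous_on_eq_continuous_at)
  then obtain F where F': "\<And>x. (F has_vector_derivative E x) (at x)"
    using einterval_antiderivative[of "-\<infinity>" \<infinity> E] by auto
  then have F: "(F has_real_derivative E x) (at x)" for x
    by (simp add: has_real_derivative_iff_has_vector_derivative)
  have hf: "filterlim h (at 0) sequentially" using h by (simp add: filterlim_at)
  have q: "(\<lambda>n. (F (x + h n) - F x) / h n) \<longlonglongrightarrow> E x" for x
    using filterlim_compose[OF _ hf, of "\<lambda>h. (F (x + h) - F x) / h"] F[of x] by (simp add: DERIV_def)
  have "(\<integral>t. E (t + h n) - E t \<partial>lebesgue_on {0<..<T}) = (F (T + h n) - F T) - (F (0 + h n) - F 0)" for n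
  proof -
    have "(\<integral>t. E (t + h n) - E t \<partial>lebesgue_on {0<..<T}) = (F (T + h n) - F T) - (F (0 + h n) - F 0)"
    proof (rule integral_Ioo_FTC)
      fix x
      show "((\<lambda>t. F (t + h n) - F t) has_real_derivative E (x + h n) - E x) (at x)"
        by (intro DERIV_diff F) (use F[of "x + h n"] in \<open>simp add: DERIV_shift\<close>)
      show "continuous_on UNIV (\<lambda>t. E (t + h n) - E t)"
        by (intro continuous_intros continuous_on_compose2[OF E] E) auto
    qed fact
    then show ?thesis .
  qed
  then show ?thesis
    using tendsto_diff[OF q[of T] q[of 0]] by (simp add: diff_divide_distrib)
qed

lemma continuous_on_inner_L2:
  assumes W: "\<And>s. s \<in> S \<Longrightarrow> W s \<in> L2 N" "\<And>s. s \<in> S \<Longrightarrow> V s \<in> L2 N"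
    and c: "\<And>s. s \<in> S \<Longrightarrow> ((\<lambda>r. norm_L2 N (\<lambda>x. W r x - W s x)) \<longlongrightarrow> 0) (at s within S)"
      "\<And>s. s \<in> S \<Longrightarrow> ((\<lambda>r. norm_L2 N (\<lambda>x. V r x - V s x)) \<longlongrightarrow> 0) (at s within S)"
  shows "continuous_on S (\<lambda>r. inner_L2 N (W r) (V r))"
  unfolding continuous_on_def
proof
  fix s assume s: "s \<in> S"
  \<comment> \<open>\<open>inner_L2_tendsto\<close> asks for membership in \<open>L2\<close> at
    every index, so values outside \<open>S\<close> are replaced; the limit within \<open>S\<close>
    does not see them.\<close>
  let ?W = "\<lambda>r. if r \<in> S then W r else W s" and ?V = "\<lambda>r. if r \<in> S then V r else V s"
  have "((\<lambda>r. norm_L2 N (\<lambda>x. ?W r x - W s x)) \<longlongrightarrow> 0) (at s within S)"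
    using c(1)[OF s] by (rule Lim_cong_within[THEN iffD1, rotated -1]) auto
  moreover have "((\<lambda>r. norm_L2 N (\<lambda>x. ?V r x - V s x)) \<longlongrightarrow> 0) (at s within S)"
    using c(2)[OF s] by (rule Lim_cong_within[THEN iffD1, rotated -1]) auto
  ultimately have "((\<lambda>r. inner_L2 N (?W r) (?V r)) \<longlongrightarrow> inner_L2 N (W s) (V s)) (at s within S)"
    using W s by (intro inner_L2_tendsto) auto
  then show "((\<lambda>r. inner_L2 N (W r) (V r)) \<longlongrightarrow> inner_L2 N (W s) (V s)) (at s within S)"
    by (rule Lim_cong_within[THEN iffD1, rotated -1]) auto
qed

text \<open>The gap is the square of the norm of \<open>b - a\<close>. With \<open>a\<close> the
  value at t and \<open>b\<close> a later or an earlier value, the same inequality serves both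
  directions.\<close>

lemma inner_L2_self_diff_ge:
  assumes "a \<in> L2 N" "b \<in> L2 N"
  shows "inner_L2 N b b - inner_L2 N a a \<ge> 2 * inner_L2 N (\<lambda>x. b x - a x) a"
proof -
  have "0 \<le> inner_L2 N (\<lambda>x. b x - a x) (\<lambda>x. b x - a x)" by (rule inner_L2_self_nonneg)
  also have "\<dots> = inner_L2 N b b - 2 * inner_L2 N b a + inner_L2 N a a"
    using assms by (simp add: inner_L2_diff_left inner_L2_diff_right L2_diff inner_L2_commute[of N a b])
  finally show ?thesis using assms by (simp add: inner_L2_diff_left)
qed

text \<open>\<open>N\<close> carries the values of \<open>W\<close>, and \<open>N'\<close> the
  pairing of \<open>p\<close> with the gradient \<open>D\<close>. In \<open>inc\<close> the
  quantifiers over a and b stand under the almost-everywhere quantifier, since one of them is set to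
  t.\<close>

lemma energy_identity:
  fixes W :: "real \<Rightarrow> 'a \<Rightarrow> 'b::euclidean_space" and p D :: "real \<Rightarrow> 'c \<Rightarrow> 'd::euclidean_space"
  assumes T: "0 < T" and W: "\<And>s. s \<in> {0..T} \<Longrightarrow> W s \<in> L2 N"
    and cont: "\<And>s. s \<in> {0..T} \<Longrightarrow> ((\<lambda>r. norm_L2 N (\<lambda>x. W r x - W s x)) \<longlongrightarrow> 0) (at s within {0..T})"
    and p: "p \<in> L2_bochner T N'" and D: "D \<in> L2_bochner T N'"
    and inc: "AE t in lebesgue_on {0<..<T}. \<forall>a b. 0 \<le> a \<and> a < b \<and> b \<le> T \<longrightarrow>
      inner_L2 N (\<lambda>x. W b x - W a x) (W t) =
      (\<integral>s. indicator {a<..<b} s * inner_L2 N' (p s) (D t) \<partial>lebesgue_on {0<..<T})"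
  shows "(norm_L2 N (W T))\<^sup>2 - (norm_L2 N (W 0))\<^sup>2 =
    2 * (\<integral>t. inner_L2 N' (p t) (D t) \<partial>lebesgue_on {0<..<T})"
proof -
  let ?M = "lebesgue_on {0<..<T}"
  \<comment> \<open>Freezing time at 0 and T makes the energy continuous on the whole line, so that
    increments past the ends are defined; they match averages that treat the integrand as 0
    there.\<close>
  define cl where "cl t = max 0 (min t T)" for t
  have cl: "cl t \<in> {0..T}" for t using T by (auto simp: cl_def)
  define E where "E t = inner_L2 N (W (cl t)) (W (cl t))" for t
  have "continuous_on {0..T} (\<lambda>r. inner_L2 N (W r) (W r))"
    by (intro continuous_on_inner_L2 W cont)
  moreover have "continuous_on UNIV cl" unfolding cl_def by (intro continuous_intros)
  ultimately have E: "continuous_on UNIV E"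
    unfolding E_def using cl by (intro continuous_on_compose2[of "{0..T}" "\<lambda>r. inner_L2 N (W r) (W r)" UNIV cl]) auto
  have EI: "integrable ?M (\<lambda>t. E (t + c) - E t)" for c
    by (intro continuous_Icc_integrable_Ioo continuous_intros continuous_on_compose2[OF E] continuous_on_subset[OF E]) auto
  define I where "I = (\<integral>t. inner_L2 N' (p t) (D t) \<partial>?M)"
  define h where "h n = 1 / real (Suc n)" for n
  have h: "h n > 0" for n by (simp add: h_def)
  have hlim: "h \<longlonglongrightarrow> 0" unfolding h_def using LIMSEQ_inverse_real_of_nat by (simp add: inverse_eq_divide)
  \<comment> \<open>Clamping the ends leaves the part of the interval inside (0, T) unchanged, hence
    also the integral over \<open>?M\<close>.\<close>
  have step: "inner_L2 N (\<lambda>x. W (cl b) x - W (cl a) x) (W t) =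
      (\<integral>s. indicator {a<..<b} s * inner_L2 N' (p s) (D t) \<partial>?M)"
    if "a < b" "a < T" "0 < b" "\<forall>a b. 0 \<le> a \<and> a < b \<and> b \<le> T \<longrightarrow>
      inner_L2 N (\<lambda>x. W b x - W a x) (W t) =
      (\<integral>s. indicator {a<..<b} s * inner_L2 N' (p s) (D t) \<partial>?M)" for a b t
  proof -
    have "inner_L2 N (\<lambda>x. W (cl b) x - W (cl a) x) (W t) =
      (\<integral>s. indicator {cl a<..<cl b} s * inner_L2 N' (p s) (D t) \<partial>?M)"
      using that T by (intro that(4)[rule_format]) (auto simp: cl_def)
    also have "\<dots> = (\<integral>s. indicator {a<..<b} s * inner_L2 N' (p s) (D t) \<partial>?M)"
      by (rule Bochner_Integration.integral_cong[OF refl]) (auto simp: indicator_def cl_def)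
    finally show ?thesis .
  qed
  have "E T - E 0 \<ge> 2 * I"
  proof -
    interpret S: steklov T "\<lambda>n. 0" h
      by standard (use h hlim in \<open>auto intro: less_imp_le\<close>)
    have ge: "2 * (\<integral>t. S.avg n (\<lambda>r. inner_L2 N' (p r) (D t)) t \<partial>?M) \<le> (\<integral>t. E (t + h n) - E t \<partial>?M) / h n" for n
    proof -
      have "(\<integral>t. 2 * S.avg n (\<lambda>r. inner_L2 N' (p r) (D t)) t \<partial>?M) \<le> (\<integral>t. (E (t + h n) - E t) / h n \<partial>?M)"
      proof (rule integral_mono_AE)
        show "integrable ?M (\<lambda>t. 2 * S.avg n (\<lambda>r. inner_L2 N' (p r) (D t)) t)"
          using S.avg_inner_integrable(1)[OF p D zero_less_one] by simp
        show "integrable ?M (\<lambda>t. (E (t + h n) - E t) / h n)" using EI by simp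
        show "AE t in ?M. 2 * S.avg n (\<lambda>r. inner_L2 N' (p r) (D t)) t \<le> (E (t + h n) - E t) / h n"
          using inc AE_Ioo
        proof eventually_elim
          case (elim t)
          have clt: "cl t = t" using elim by (auto simp: cl_def)
          have "2 * (h n * S.avg n (\<lambda>r. inner_L2 N' (p r) (D t)) t) = 2 * inner_L2 N (\<lambda>x. W (cl (t + h n)) x - W (cl t) x) (W t)"
            using step[of t "t + h n" t] elim h[of n] by (simp add: S.avg_def)
          also have "\<dots> \<le> E (t + h n) - E t"
            using inner_L2_self_diff_ge[OF W[OF cl[of t]] W[OF cl[of "t + h n"]]] by (simp add: E_def clt)
          finally show ?case using h[of n] by (simp add: pos_le_divide_eq algebra_simps)
        qed
      qed
      then show ?thesis by simp
    qed
    have L1: "(\<lambda>n. (\<integral>t. E (t + h n) - E t \<partial>?M) / h n) \<longlonglongrightarrow> E T - E 0"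
      by (rule difference_quotient_integral[OF E]) (use T h hlim in \<open>auto simp: less_imp_neq[symmetric]\<close>)
    have L2: "(\<lambda>n. 2 * (\<integral>t. S.avg n (\<lambda>r. inner_L2 N' (p r) (D t)) t \<partial>?M)) \<longlonglongrightarrow> 2 * I"
      unfolding I_def by (intro tendsto_mult tendsto_const S.avg_inner_tendsto p D)
    show ?thesis using ge by (intro LIMSEQ_le[OF L2 L1]) blast
  qed
  moreover have "E T - E 0 \<le> 2 * I"
  proof -
    interpret S: steklov T h "\<lambda>n. 0"
      by standard (use h hlim in \<open>auto intro: less_imp_le\<close>)
    \<comment> \<open>The quotient is written with the step \<open>- h n\<close>, so that
      \<open>difference_quotient_integral\<close> yields the same limit as before.\<close>
    have le: "(\<integral>t. E (t + - h n) - E t \<partial>?M) / (- h n) \<le> 2 * (\<integral>t. S.avg n (\<lambda>r. inner_L2 N' (p r) (D t)) t \<partial>?M)" for n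
    proof -
      have "(\<integral>t. (E (t + - h n) - E t) / (- h n) \<partial>?M) \<le> (\<integral>t. 2 * S.avg n (\<lambda>r. inner_L2 N' (p r) (D t)) t \<partial>?M)"
      proof (rule integral_mono_AE)
        show "integrable ?M (\<lambda>t. 2 * S.avg n (\<lambda>r. inner_L2 N' (p r) (D t)) t)"
          using S.avg_inner_integrable(1)[OF p D zero_less_one] by simp
        show "integrable ?M (\<lambda>t. (E (t + - h n) - E t) / (- h n))"
          by (intro integrable_divide EI)
        show "AE t in ?M. (E (t + - h n) - E t) / (- h n) \<le> 2 * S.avg n (\<lambda>r. inner_L2 N' (p r) (D t)) t"
          using inc AE_Ioo
        proof eventually_elim
          case (elim t)
          have clt: "cl t = t" using elim by (auto simp: cl_def)
          have "E t - E (t - h n) \<le> - 2 * inner_L2 N (\<lambda>x. W (cl (t - h n)) x - W (cl t) x) (W t)"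
            using inner_L2_self_diff_ge[OF W[OF cl[of t]] W[OF cl[of "t - h n"]]] by (simp add: E_def clt)
          also have "\<dots> = 2 * inner_L2 N (\<lambda>x. W (cl t) x - W (cl (t - h n)) x) (W t)"
            using W[OF cl[of t]] W[OF cl[of "t - h n"]] by (simp add: inner_L2_diff_left clt)
          also have "\<dots> = 2 * (h n * S.avg n (\<lambda>r. inner_L2 N' (p r) (D t)) t)"
            using step[of "t - h n" t t] elim h[of n] by (simp add: S.avg_def)
          finally have "(E t - E (t - h n)) / h n \<le> 2 * S.avg n (\<lambda>r. inner_L2 N' (p r) (D t)) t"
            using h[of n] by (simp add: pos_divide_le_eq mult.left_commute mult.commute)
          then show ?case by (simp add: diff_divide_distrib)
        qed
      qed
      then show ?thesis by simp
    qed
    have L1: "(\<lambda>n. (\<integral>t. E (t + - h n) - E t \<partial>?M) / (- h n)) \<longlonglongrightarrow> E T - E 0"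
      by (rule difference_quotient_integral[OF E])
        (use T h tendsto_minus[OF hlim] in \<open>auto simp: less_imp_neq[symmetric]\<close>)
    have L2: "(\<lambda>n. 2 * (\<integral>t. S.avg n (\<lambda>r. inner_L2 N' (p r) (D t)) t \<partial>?M)) \<longlonglongrightarrow> 2 * I"
      unfolding I_def by (intro tendsto_mult tendsto_const S.avg_inner_tendsto p D)
    show ?thesis using le by (intro LIMSEQ_le[OF L1 L2]) blast
  qed
  moreover have "cl T = T" "cl 0 = 0" using T by (auto simp: cl_def)
  ultimately show ?thesis by (simp add: E_def I_def norm_L2_sq)
qed

section \<open>Bochner spaces over the evolution triple\<close>

lemma L2_V_W12_D: "v \<in> L2_V \<Omega> \<Gamma>D T \<Longrightarrow> AE t in lebesgue_on {0<..<T}. v t \<in> W12_D \<Omega> \<Gamma>D"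
  by (simp add: L2_V_def bochner_L2_def)

text \<open>The gradient is an isometry on V with \<open>norm_V\<close>, so simple approximations of
  \<open>v\<close> become simple approximations of its gradient.\<close>

lemma grad_Q_L2_bochner:
  assumes \<Omega>: "open \<Omega>" "bounded \<Omega>" and v: "v \<in> L2_V \<Omega> \<Gamma>D T"
  shows "grad_Q \<Omega> v \<in> L2_bochner T (lebesgue_on \<Omega>)"
proof -
  obtain s where s: "\<And>k::nat. simple_function (lebesgue_on {0<..<T}) (s k)"
    "\<And>k. s k ` {0<..<T} \<subseteq> W12_D \<Omega> \<Gamma>D"
    "AE t in lebesgue_on {0<..<T}. (\<lambda>k. norm_V \<Omega> (v t - s k t)) \<longlonglongrightarrow> 0"
    and i: "integrable (lebesgue_on {0<..<T}) (\<lambda>t. (norm_V \<Omega> (v t))\<^sup>2)"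
    using v unfolding L2_V_def bochner_L2_def by blast
  have s': "s k t \<in> W12 \<Omega>" if "t \<in> {0<..<T}" for k t
    using s(2)[of k] that W12_D_W12 by blast
  have sL: "weak_grad \<Omega> (s k t) \<in> L2 (lebesgue_on \<Omega>)" if "0 < t" "t < T" for k t
    using s' that by (intro weak_grad_works) auto
  have "AE t in lebesgue_on {0<..<T}. grad_Q \<Omega> v t \<in> L2 (lebesgue_on \<Omega>)"
    using L2_V_W12_D[OF v] by eventually_elim (auto simp: grad_Q_def intro: weak_grad_works W12_D_W12)
  moreover have "AE t in lebesgue_on {0<..<T}.
      (\<lambda>k. norm_L2 (lebesgue_on \<Omega>) (\<lambda>x. grad_Q \<Omega> v t x - weak_grad \<Omega> (s k t) x)) \<longlonglongrightarrow> 0"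
    using s(3) L2_V_W12_D[OF v] AE_Ioo
  proof eventually_elim
    case (elim t)
    have "norm_V \<Omega> (v t - s k t) = norm_L2 (lebesgue_on \<Omega>) (\<lambda>x. grad_Q \<Omega> v t x - weak_grad \<Omega> (s k t) x)" for k
      using norm_V_diff[OF \<Omega> W12_D_W12[OF elim(2)] s'[OF elim(3)]] by (simp add: grad_Q_def fun_diff_def)
    then show ?case using elim(1) by simp
  qed
  ultimately have "bochner_meas T (lebesgue_on \<Omega>) (grad_Q \<Omega> v)"
    unfolding bochner_meas_def
    by (intro conjI exI[of _ "\<lambda>k t. weak_grad \<Omega> (s k t)"] allI image_subsetI)
      (auto intro: simple_function_compose1[OF s(1)] sL)
  then show ?thesis using i by (simp add: L2_bochner_iff norm_V_def grad_Q_def)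
qed

lemma V_dual_diff:
  assumes "l \<in> V_dual \<Omega> \<Gamma>D" "m \<in> V_dual \<Omega> \<Gamma>D"
  shows "l - m \<in> V_dual \<Omega> \<Gamma>D"
proof -
  obtain C C' where C: "\<And>v. v \<in> W12_D \<Omega> \<Gamma>D \<Longrightarrow> \<bar>l v\<bar> \<le> C * norm_V \<Omega> v"
    and C': "\<And>v. v \<in> W12_D \<Omega> \<Gamma>D \<Longrightarrow> \<bar>m v\<bar> \<le> C' * norm_V \<Omega> v"
    using assms unfolding V_dual_def by blast
  have "\<bar>(l - m) v\<bar> \<le> (C + C') * norm_V \<Omega> v" if "v \<in> W12_D \<Omega> \<Gamma>D" for v
    using C[OF that] C'[OF that] by (simp add: distrib_right)
  moreover have "(l - m) (\<lambda>x. a * v x + b * w x) = a * (l - m) v + b * (l - m) w"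
    if "v \<in> W12_D \<Omega> \<Gamma>D" "w \<in> W12_D \<Omega> \<Gamma>D" for v w a b
  proof -
    have "l (\<lambda>x. a * v x + b * w x) = a * l v + b * l w" "m (\<lambda>x. a * v x + b * w x) = a * m v + b * m w"
      using assms that unfolding V_dual_def by blast+
    then show ?thesis by (simp add: algebra_simps)
  qed
  ultimately show ?thesis unfolding V_dual_def by blast
qed

text \<open>Evaluation at a fixed element of V is continuous by \<open>V_dual_bound\<close>, so it
  turns the approximating simple functions into real simple functions that converge almost
  everywhere.\<close>

lemma L2_V_dual_integrable:
  assumes \<Omega>: "open \<Omega>" "bounded \<Omega>" and F: "F \<in> L2_V_dual \<Omega> \<Gamma>D T" and \<phi>: "\<phi> \<in> W12_D \<Omega> \<Gamma>D"
  shows "integrable (lebesgue_on {0<..<T}) (\<lambda>t. F t \<phi>)"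
proof -
  obtain s where s: "\<And>k::nat. simple_function (lebesgue_on {0<..<T}) (s k)"
    "\<And>k. s k ` {0<..<T} \<subseteq> V_dual \<Omega> \<Gamma>D"
    "AE t in lebesgue_on {0<..<T}. (\<lambda>k. norm_V_dual \<Omega> \<Gamma>D (F t - s k t)) \<longlonglongrightarrow> 0"
    and i: "integrable (lebesgue_on {0<..<T}) (\<lambda>t. (norm_V_dual \<Omega> \<Gamma>D (F t))\<^sup>2)"
    and V: "AE t in lebesgue_on {0<..<T}. F t \<in> V_dual \<Omega> \<Gamma>D"
    using F unfolding L2_V_dual_def bochner_L2_def by blast
  let ?n = "norm_V \<Omega> \<phi>"
  show ?thesis
  proof (rule Bochner_Integration.integrable_bound)
    show "integrable (lebesgue_on {0<..<T}) (\<lambda>t. ((norm_V_dual \<Omega> \<Gamma>D (F t))\<^sup>2 + ?n\<^sup>2) / 2)"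
      by (intro integrable_divide Bochner_Integration.integrable_add i
          finite_measure.integrable_const[OF finite_measure_Ioo])
    show "(\<lambda>t. F t \<phi>) \<in> borel_measurable (lebesgue_on {0<..<T})"
    proof (rule borel_measurable_lebesgue_on_AE_lim[OF Ioo_lebesgue])
      show "(\<lambda>t. s k t \<phi>) \<in> borel_measurable (lebesgue_on {0<..<T})" for k
        by (rule borel_measurable_simple_function[OF simple_function_compose1[OF s(1)]])
      show "AE t in lebesgue_on {0<..<T}. (\<lambda>k. s k t \<phi>) \<longlonglongrightarrow> F t \<phi>"
        using s(3) V AE_Ioo
      proof eventually_elim
        case (elim t)
        have "(\<lambda>k. s k t \<phi> - F t \<phi>) \<longlonglongrightarrow> 0"
        proof (rule Lim_null_comparison)
          show "(\<lambda>k. norm_V_dual \<Omega> \<Gamma>D (F t - s k t) * ?n) \<longlonglongrightarrow> 0"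
            by (rule tendsto_mult_left_zero[OF elim(1)])
          show "\<forall>\<^sub>F k in sequentially. norm (s k t \<phi> - F t \<phi>) \<le> norm_V_dual \<Omega> \<Gamma>D (F t - s k t) * ?n"
          proof (intro always_eventually allI)
            fix k
            have "s k t \<in> V_dual \<Omega> \<Gamma>D" using s(2)[of k] elim(3) by auto
            from V_dual_bound[OF \<Omega> V_dual_diff[OF elim(2) this] \<phi>]
            show "norm (s k t \<phi> - F t \<phi>) \<le> norm_V_dual \<Omega> \<Gamma>D (F t - s k t) * ?n"
              by (simp add: abs_minus_commute)
          qed
        qed
        then show ?case by (simp flip: Lim_null)
      qed
    qed
    show "AE t in lebesgue_on {0<..<T}. norm (F t \<phi>) \<le> norm (((norm_V_dual \<Omega> \<Gamma>D (F t))\<^sup>2 + ?n\<^sup>2) / 2)"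
      using V
    proof eventually_elim
      case (elim t)
      have "\<bar>F t \<phi>\<bar> \<le> norm_V_dual \<Omega> \<Gamma>D (F t) * ?n" by (rule V_dual_bound[OF \<Omega> elim \<phi>])
      also have "\<dots> \<le> ((norm_V_dual \<Omega> \<Gamma>D (F t))\<^sup>2 + ?n\<^sup>2) / 2"
        using sum_squares_bound[of "norm_V_dual \<Omega> \<Gamma>D (F t)" ?n] by simp
      finally show ?case by simp
    qed
  qed
qed

text \<open>The part of \<open>has_value\<close> that does not mention the point in time. Naming the
  representative allows one and the same to be used at 0, at T and in between.\<close>

definition continuous_rep ::
    "'a::euclidean_space set \<Rightarrow> real \<Rightarrow> (real \<Rightarrow> 'a \<Rightarrow> real) \<Rightarrow> (real \<Rightarrow> 'a \<Rightarrow> real) \<Rightarrow> bool" where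
  "continuous_rep \<Omega> T v w \<longleftrightarrow>
     (\<forall>s\<in>{0..T}. w s \<in> L2 (lebesgue_on \<Omega>)) \<and>
     (\<forall>s\<in>{0..T}. ((\<lambda>r. norm_L2 (lebesgue_on \<Omega>) (\<lambda>x. w r x - w s x)) \<longlongrightarrow> 0) (at s within {0..T})) \<and>
     (AE s in lebesgue_on {0<..<T}. AE x in lebesgue_on \<Omega>. v s x = w s x)"

lemma has_value_iff:
  "has_value \<Omega> T v t h \<longleftrightarrow> (\<exists>w. continuous_rep \<Omega> T v w \<and> (AE x in lebesgue_on \<Omega>. w t x = h x))"
  unfolding has_value_def continuous_rep_def fun_diff_def by blast

lemma continuous_rep_L2: "continuous_rep \<Omega> T v w \<Longrightarrow> s \<in> {0..T} \<Longrightarrow> w s \<in> L2 (lebesgue_on \<Omega>)"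
  and continuous_rep_tendsto: "continuous_rep \<Omega> T v w \<Longrightarrow> s \<in> {0..T} \<Longrightarrow>
    ((\<lambda>r. norm_L2 (lebesgue_on \<Omega>) (\<lambda>x. w r x - w s x)) \<longlongrightarrow> 0) (at s within {0..T})"
  and continuous_rep_AE: "continuous_rep \<Omega> T v w \<Longrightarrow>
    AE s in lebesgue_on {0<..<T}. AE x in lebesgue_on \<Omega>. v s x = w s x"
  by (auto simp: continuous_rep_def)

lemma continuous_rep_diff:
  assumes v: "continuous_rep \<Omega> T v w" and v': "continuous_rep \<Omega> T v' w'"
  shows "continuous_rep \<Omega> T (\<lambda>t x. v t x - v' t x) (\<lambda>t x. w t x - w' t x)"
  unfolding continuous_rep_def
proof (intro conjI ballI)
  fix s assume s: "s \<in> {0..T}"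
  note L = continuous_rep_L2[OF v] continuous_rep_L2[OF v']
  show "(\<lambda>x. w s x - w' s x) \<in> L2 (lebesgue_on \<Omega>)" using L s by (intro L2_diff)
  show "((\<lambda>r. norm_L2 (lebesgue_on \<Omega>) (\<lambda>x. w r x - w' r x - (w s x - w' s x))) \<longlongrightarrow> 0) (at s within {0..T})"
  proof (rule Lim_null_comparison)
    show "((\<lambda>r. norm_L2 (lebesgue_on \<Omega>) (\<lambda>x. w r x - w s x) + norm_L2 (lebesgue_on \<Omega>) (\<lambda>x. w' r x - w' s x)) \<longlongrightarrow> 0)
        (at s within {0..T})"
      by (rule tendsto_add_zero[OF continuous_rep_tendsto[OF v s] continuous_rep_tendsto[OF v' s]])
    have "norm (norm_L2 (lebesgue_on \<Omega>) (\<lambda>x. w r x - w' r x - (w s x - w' s x))) \<le>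
        norm_L2 (lebesgue_on \<Omega>) (\<lambda>x. w r x - w s x) + norm_L2 (lebesgue_on \<Omega>) (\<lambda>x. w' r x - w' s x)"
      if "r \<in> {0..T}" for r
    proof -
      have "(\<lambda>x. w r x - w' r x - (w s x - w' s x)) = (\<lambda>x. (w r x - w s x) - (w' r x - w' s x))" by auto
      then show ?thesis
        using norm_L2_diff_le[OF L2_diff[OF L(1)[OF that] L(1)[OF s]] L2_diff[OF L(2)[OF that] L(2)[OF s]]]
        by (simp add: norm_L2_nonneg)
    qed
    then show "\<forall>\<^sub>F r in at s within {0..T}. norm (norm_L2 (lebesgue_on \<Omega>) (\<lambda>x. w r x - w' r x - (w s x - w' s x))) \<le>
        norm_L2 (lebesgue_on \<Omega>) (\<lambda>x. w r x - w s x) + norm_L2 (lebesgue_on \<Omega>) (\<lambda>x. w' r x - w' s x)"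
      by (auto simp: eventually_at_filter)
  qed
next
  show "AE s in lebesgue_on {0<..<T}. AE x in lebesgue_on \<Omega>. v s x - v' s x = w s x - w' s x"
    using continuous_rep_AE[OF v] continuous_rep_AE[OF v'] by eventually_elim auto
qed

text \<open>The squared distance of the two representatives is continuous with vanishing weak derivative,
  hence constant, and it vanishes almost everywhere.\<close>

lemma continuous_rep_unique:
  assumes T: "0 < T" and w: "continuous_rep \<Omega> T v w" and w': "continuous_rep \<Omega> T v w'"
  shows "AE x in lebesgue_on \<Omega>. w T x = w' T x"
proof -
  let ?M = "lebesgue_on {0<..<T}" and ?N = "lebesgue_on \<Omega>"
  let ?d = "\<lambda>t x. w t x - w' t x"
  have d: "continuous_rep \<Omega> T (\<lambda>t x. v t x - v t x) ?d" by (rule continuous_rep_diff[OF w w'])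
  define e where "e t = inner_L2 ?N (?d t) (?d t)" for t
  have cont: "continuous_on {0..T} e"
    unfolding e_def using continuous_rep_L2[OF d] continuous_rep_tendsto[OF d]
    by (intro continuous_on_inner_L2) auto
  have ae: "AE t in ?M. e t = 0"
    using continuous_rep_AE[OF d]
  proof eventually_elim
    case (elim t)
    then have "AE x in ?N. ?d t x \<bullet> ?d t x = 0" by eventually_elim auto
    then show ?case unfolding e_def inner_L2_def by (rule integral_eq_zero_AE)
  qed
  have const: "e b - e a = 0" if "0 \<le> a" "a < b" "b \<le> T" for a b
  proof -
    have "e b - e a = (\<integral>t. indicator {a<..<b} t * 0 \<partial>?M)"
    proof (rule weak_derivative_FTC[OF cont _ _ that])
      fix \<psi> :: "real \<Rightarrow> real"
      have "AE t in ?M. deriv \<psi> t * e t = 0" using ae by eventually_elim simp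
      then show "(\<integral>t. deriv \<psi> t * e t \<partial>?M) = - (\<integral>t. \<psi> t * 0 \<partial>?M)"
        by (simp add: integral_eq_zero_AE)
    qed simp
    then show ?thesis by simp
  qed
  have "e T = 0"
  proof (rule ccontr)
    assume ne: "e T \<noteq> 0"
    have "AE t in ?M. False"
      using ae AE_Ioo
    proof eventually_elim
      case (elim t)
      then show False using const[of t T] ne by simp
    qed
    then have "emeasure ?M (space ?M) = 0" by (subst (asm) AE_iff_measurable[where N="space ?M"]) auto
    moreover have "emeasure ?M (space ?M) = ennreal T" using T by (simp add: emeasure_restrict_space)
    ultimately show False using T by simp
  qed
  then have "norm_L2 ?N (?d T) = 0" by (simp add: e_def norm_L2_eq)
  then have "AE x in ?N. ?d T x = 0"
    using norm_L2_eq_0_imp_AE[OF continuous_rep_L2[OF d, of T]] T by simp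
  then show ?thesis by eventually_elim simp
qed

text \<open>\<open>value_at\<close> is a choice and may stem from another representative, but all
  representatives agree at T almost everywhere; this also makes the chosen function
  measurable.\<close>

lemma norm_L2_value_at:
  assumes T: "0 < T" and \<Omega>: "\<Omega> \<in> sets lebesgue" and w: "continuous_rep \<Omega> T v w"
  shows "norm_L2 (lebesgue_on \<Omega>) (value_at \<Omega> T v T) = norm_L2 (lebesgue_on \<Omega>) (w T)"
proof -
  have "has_value \<Omega> T v T (w T)" using w by (auto simp: has_value_iff)
  then have "has_value \<Omega> T v T (value_at \<Omega> T v T)"
    unfolding value_at_def by (rule someI[where P="has_value \<Omega> T v T"])
  then obtain w' where w': "continuous_rep \<Omega> T v w'" "AE x in lebesgue_on \<Omega>. w' T x = value_at \<Omega> T v T x"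
    by (auto simp: has_value_iff)
  have ae: "AE x in lebesgue_on \<Omega>. w T x = value_at \<Omega> T v T x"
    using continuous_rep_unique[OF T w w'(1)] w'(2) by eventually_elim simp
  have m: "w T \<in> borel_measurable (lebesgue_on \<Omega>)"
    using continuous_rep_L2[OF w, of T] T by (auto intro: L2_measurable)
  show ?thesis
    using norm_L2_cong_AE[OF ae m borel_measurable_lebesgue_on_AE[OF \<Omega> m ae]] by simp
qed

section \<open>Time derivatives and integration by parts in \<open>W_space\<close>\<close>

lemma time_deriv_works:
  assumes "v \<in> W_space \<Omega> \<Gamma>D T"
  shows "time_deriv \<Omega> \<Gamma>D T v \<in> L2_V_dual \<Omega> \<Gamma>D T" "is_time_deriv \<Omega> \<Gamma>D T v (time_deriv \<Omega> \<Gamma>D T v)"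
proof -
  have "\<exists>F. F \<in> L2_V_dual \<Omega> \<Gamma>D T \<and> is_time_deriv \<Omega> \<Gamma>D T v F" using assms by (auto simp: W_space_def)
  from someI_ex[OF this]
  show "time_deriv \<Omega> \<Gamma>D T v \<in> L2_V_dual \<Omega> \<Gamma>D T" "is_time_deriv \<Omega> \<Gamma>D T v (time_deriv \<Omega> \<Gamma>D T v)"
    by (auto simp: time_deriv_def)
qed

lemma W_space_L2_V: "v \<in> W_space \<Omega> \<Gamma>D T \<Longrightarrow> v \<in> L2_V \<Omega> \<Gamma>D T"
  by (simp add: W_space_def)

text \<open>Against a fixed element of V, \<open>time_deriv\<close> is the weak derivative of a
  scalar function, which is continuous once \<open>v\<close> is replaced by its representative. So
  \<open>weak_derivative_FTC\<close> applies.\<close>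

lemma time_increment:
  assumes \<Omega>: "open \<Omega>" "bounded \<Omega>" and v: "v \<in> W_space \<Omega> \<Gamma>D T" and w: "continuous_rep \<Omega> T v w"
    and \<phi>: "\<phi> \<in> W12_D \<Omega> \<Gamma>D" and ab: "0 \<le> a" "a < b" "b \<le> T"
  shows "inner_L2 (lebesgue_on \<Omega>) (w b) \<phi> - inner_L2 (lebesgue_on \<Omega>) (w a) \<phi> =
    (\<integral>s. indicator {a<..<b} s * time_deriv \<Omega> \<Gamma>D T v s \<phi> \<partial>lebesgue_on {0<..<T})"
proof (rule weak_derivative_FTC[OF _ _ _ ab])
  let ?M = "lebesgue_on {0<..<T}" and ?N = "lebesgue_on \<Omega>"
  have \<phi>L: "\<phi> \<in> L2 ?N" by (intro W12_L2 W12_D_W12[OF \<phi>])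
  show cont: "continuous_on {0..T} (\<lambda>r. inner_L2 ?N (w r) \<phi>)"
    using continuous_on_inner_L2[of "{0..T}" w ?N "\<lambda>t. \<phi>"] continuous_rep_L2[OF w] continuous_rep_tendsto[OF w] \<phi>L
    by (simp add: norm_L2_def[of _ "\<lambda>x. 0"])
  show "integrable ?M (\<lambda>s. time_deriv \<Omega> \<Gamma>D T v s \<phi>)"
    by (rule L2_V_dual_integrable[OF \<Omega> time_deriv_works(1)[OF v] \<phi>])
  fix \<psi> :: "real \<Rightarrow> real" assume \<psi>: "test_function {0<..<T} \<psi>"
  \<comment> \<open>\<open>test_function\<close> is phrased with Frechet derivatives,
    \<open>is_time_deriv\<close> with \<open>deriv\<close>.\<close>
  have d: "frechet_derivative \<psi> (at t) 1 = deriv \<psi> t" for t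
  proof -
    have "\<psi> differentiable (at t)" using \<psi> by (elim test_functionE) (rule C_inf_differentiable)
    then have "(\<psi> has_derivative (*) (deriv \<psi> t)) (at t)"
      by (simp add: DERIV_deriv_iff_real_differentiable flip: has_field_derivative_def)
    then show ?thesis by (simp add: frechet_derivative_eqI)
  qed
  have t': "test_function {0<..<T} (\<lambda>t. deriv \<psi> t)"
    using test_function_partial[OF \<psi>, of 1] by (simp add: d)
  have "(\<integral>t. deriv \<psi> t * inner_L2 ?N (w t) \<phi> \<partial>?M) = (\<integral>t. deriv \<psi> t * (\<integral>x. v t x * \<phi> x \<partial>?N) \<partial>?M)"
  proof (rule integral_cong_AE_lebesgue_on[OF Ioo_lebesgue])
    show "(\<lambda>t. deriv \<psi> t * inner_L2 ?N (w t) \<phi>) \<in> borel_measurable ?M"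
      using test_function_borel_measurable[OF t'] continuous_Icc_integrable_Ioo[OF cont]
      by (intro borel_measurable_times) auto
    show "AE t in ?M. deriv \<psi> t * inner_L2 ?N (w t) \<phi> = deriv \<psi> t * (\<integral>x. v t x * \<phi> x \<partial>?N)"
      using continuous_rep_AE[OF w] L2_V_W12_D[OF W_space_L2_V[OF v]] AE_Ioo
    proof eventually_elim
      case (elim t)
      have "inner_L2 ?N (v t) \<phi> = inner_L2 ?N (w t) \<phi>"
        using elim continuous_rep_L2[OF w, of t] \<phi>L by (intro inner_L2_cong_AE) (auto intro: W12_L2 W12_D_W12)
      then show ?case by (simp add: inner_L2_def)
    qed
  qed
  then show "(\<integral>t. deriv \<psi> t * inner_L2 ?N (w t) \<phi> \<partial>?M) = - (\<integral>t. \<psi> t * time_deriv \<Omega> \<Gamma>D T v t \<phi> \<partial>?M)"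
    using time_deriv_works(2)[OF v] \<psi> \<phi> by (simp add: is_time_deriv_def)
qed

text \<open>Since \<open>p\<close> represents the time derivative of \<open>v - u\<close>,
  increments of the representatives are integrals of pairings of \<open>p\<close> with gradients,
  which is the hypothesis of \<open>energy_identity\<close>.\<close>

lemma W_space_integration_by_parts:
  assumes \<Omega>: "open \<Omega>" "bounded \<Omega>" and T: "0 < T"
    and v: "v \<in> W_space \<Omega> \<Gamma>D T" and u: "u \<in> W_space \<Omega> \<Gamma>D T"
    and wv: "continuous_rep \<Omega> T v wv" and wu: "continuous_rep \<Omega> T u wu"
    and p: "p \<in> L2_Y \<Omega> T"
    and deriv: "AE t in lebesgue_on {0<..<T}. V_dual_eq \<Omega> \<Gamma>D (L_adj \<Omega> (p t))
      (\<lambda>w. time_deriv \<Omega> \<Gamma>D T v t w - time_deriv \<Omega> \<Gamma>D T u t w)"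
  shows "(norm_L2 (lebesgue_on \<Omega>) (\<lambda>x. wv T x - wu T x))\<^sup>2 - (norm_L2 (lebesgue_on \<Omega>) (\<lambda>x. wv 0 x - wu 0 x))\<^sup>2 =
    2 * inner_Q \<Omega> T p (\<lambda>t x. grad_Q \<Omega> v t x - grad_Q \<Omega> u t x)"
proof -
  let ?M = "lebesgue_on {0<..<T}" and ?N = "lebesgue_on \<Omega>"
  let ?W = "\<lambda>t x. wv t x - wu t x" and ?D = "\<lambda>t x. grad_Q \<Omega> v t x - grad_Q \<Omega> u t x"
  have W: "continuous_rep \<Omega> T (\<lambda>t x. v t x - u t x) ?W" by (rule continuous_rep_diff[OF wv wu])
  have p': "p \<in> L2_bochner T ?N" using p by (simp add: L2_Y_eq)
  have gv: "grad_Q \<Omega> v \<in> L2_bochner T ?N" and gu: "grad_Q \<Omega> u \<in> L2_bochner T ?N"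
    by (rule grad_Q_L2_bochner[OF \<Omega> W_space_L2_V[OF v]], rule grad_Q_L2_bochner[OF \<Omega> W_space_L2_V[OF u]])
  \<comment> \<open>This holds for every \<open>\<phi>\<close> without exceptional times, as null
    sets are absorbed by the integral over s. Hence \<open>\<phi>\<close> may be chosen depending on
    t.\<close>
  have inc: "inner_L2 ?N (\<lambda>x. ?W b x - ?W a x) \<phi> = (\<integral>s. indicator {a<..<b} s * inner_L2 ?N (p s) (weak_grad \<Omega> \<phi>) \<partial>?M)"
    if \<phi>: "\<phi> \<in> W12_D \<Omega> \<Gamma>D" and ab: "0 \<le> a" "a < b" "b \<le> T" for \<phi> a b
  proof -
    note L = continuous_rep_L2[OF wv] continuous_rep_L2[OF wu]
    have \<phi>L: "\<phi> \<in> L2 ?N" by (intro W12_L2 W12_D_W12[OF \<phi>])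
    have Fv: "integrable ?M (\<lambda>s. indicator {a<..<b} s * time_deriv \<Omega> \<Gamma>D T v s \<phi>)"
      and Fu: "integrable ?M (\<lambda>s. indicator {a<..<b} s * time_deriv \<Omega> \<Gamma>D T u s \<phi>)"
      by (intro integrable_indicator_Ioo_mult L2_V_dual_integrable[OF \<Omega> time_deriv_works(1) \<phi>] v u)+
    have "inner_L2 ?N (\<lambda>x. ?W b x - ?W a x) \<phi> =
        (inner_L2 ?N (wv b) \<phi> - inner_L2 ?N (wv a) \<phi>) - (inner_L2 ?N (wu b) \<phi> - inner_L2 ?N (wu a) \<phi>)"
      using L(1)[of a] L(1)[of b] L(2)[of a] L(2)[of b] ab \<phi>L by (simp add: inner_L2_diff_left L2_diff)
    also have "\<dots> = (\<integral>s. indicator {a<..<b} s * time_deriv \<Omega> \<Gamma>D T v s \<phi> - indicator {a<..<b} s * time_deriv \<Omega> \<Gamma>D T u s \<phi> \<partial>?M)"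
      unfolding time_increment[OF \<Omega> v wv \<phi> ab] time_increment[OF \<Omega> u wu \<phi> ab]
      using Fv Fu by simp
    also have "\<dots> = (\<integral>s. indicator {a<..<b} s * inner_L2 ?N (p s) (weak_grad \<Omega> \<phi>) \<partial>?M)"
    proof (rule integral_cong_AE_lebesgue_on[OF Ioo_lebesgue])
      show "AE s in ?M. indicator {a<..<b} s * time_deriv \<Omega> \<Gamma>D T v s \<phi> - indicator {a<..<b} s * time_deriv \<Omega> \<Gamma>D T u s \<phi> =
          indicator {a<..<b} s * inner_L2 ?N (p s) (weak_grad \<Omega> \<phi>)"
        using deriv
      proof eventually_elim
        case (elim s)
        then have "inner_L2 ?N (p s) (weak_grad \<Omega> \<phi>) = time_deriv \<Omega> \<Gamma>D T v s \<phi> - time_deriv \<Omega> \<Gamma>D T u s \<phi>"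
          using \<phi> by (simp add: V_dual_eq_def L_adj_def inner_L2_def)
        then show ?case by (simp add: right_diff_distrib)
      qed
    qed (use Fv Fu in auto)
    finally show ?thesis .
  qed
  have "(norm_L2 ?N (?W T))\<^sup>2 - (norm_L2 ?N (?W 0))\<^sup>2 = 2 * (\<integral>t. inner_L2 ?N (p t) (?D t) \<partial>?M)"
  proof (rule energy_identity[OF T])
    show "?D \<in> L2_bochner T ?N" by (rule L2_bochner_diff[OF gv gu])
    show "AE t in ?M. \<forall>a b. 0 \<le> a \<and> a < b \<and> b \<le> T \<longrightarrow> inner_L2 ?N (\<lambda>x. ?W b x - ?W a x) (?W t) =
      (\<integral>s. indicator {a<..<b} s * inner_L2 ?N (p s) (?D t) \<partial>?M)"
      using continuous_rep_AE[OF W] L2_V_W12_D[OF W_space_L2_V[OF v]] L2_V_W12_D[OF W_space_L2_V[OF u]] AE_Ioo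
    proof eventually_elim
      case (elim t)
      show ?case
      proof (intro allI impI)
        fix a b assume ab: "0 \<le> a \<and> a < b \<and> b \<le> T"
        have Lab: "(\<lambda>x. ?W b x - ?W a x) \<in> L2 ?N"
          using ab continuous_rep_L2[OF W, of a] continuous_rep_L2[OF W, of b] by (intro L2_diff[of "?W b"]) auto
        have vt: "v t \<in> L2 ?N" and ut: "u t \<in> L2 ?N"
          using elim by (auto intro: W12_L2 W12_D_W12)
        have gvt: "weak_grad \<Omega> (v t) \<in> L2 ?N" and gut: "weak_grad \<Omega> (u t) \<in> L2 ?N"
          using elim by (auto intro: weak_grad_works W12_D_W12)
        have Wt: "?W t \<in> L2 ?N" using continuous_rep_L2[OF W, of t] elim by auto
        note I = integrable_indicator_Ioo_mult[OF L2_bochner_const_inner[OF p' gvt]] integrable_indicator_Ioo_mult[OF L2_bochner_const_inner[OF p' gut]]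
        \<comment> \<open>testing with \<open>v t\<close> and \<open>u t\<close> separately avoids showing that \<open>V\<close> is closed under differences\<close>
        have "inner_L2 ?N (\<lambda>x. ?W b x - ?W a x) (?W t) = inner_L2 ?N (\<lambda>x. v t x - u t x) (\<lambda>x. ?W b x - ?W a x)"
          using elim(1) by (subst inner_L2_commute, intro inner_L2_cong_AE Wt L2_diff[OF vt ut] Lab) (auto elim: eventually_mono)
        also have "\<dots> = inner_L2 ?N (\<lambda>x. ?W b x - ?W a x) (v t) - inner_L2 ?N (\<lambda>x. ?W b x - ?W a x) (u t)"
          by (subst inner_L2_commute, rule inner_L2_diff_right[OF vt ut Lab])
        also have "\<dots> = (\<integral>s. indicator {a<..<b} s * inner_L2 ?N (p s) (weak_grad \<Omega> (v t)) -
            indicator {a<..<b} s * inner_L2 ?N (p s) (weak_grad \<Omega> (u t)) \<partial>?M)"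
          using inc[OF elim(2), of a b] inc[OF elim(3), of a b] ab I by simp
        also have "\<dots> = (\<integral>s. indicator {a<..<b} s * inner_L2 ?N (p s) (?D t) \<partial>?M)"
        proof (rule integral_cong_AE_lebesgue_on[OF Ioo_lebesgue])
          show "AE s in ?M. indicator {a<..<b} s * inner_L2 ?N (p s) (weak_grad \<Omega> (v t)) -
            indicator {a<..<b} s * inner_L2 ?N (p s) (weak_grad \<Omega> (u t)) = indicator {a<..<b} s * inner_L2 ?N (p s) (?D t)"
            using L2_bochner_L2[OF p']
            by eventually_elim (simp add: grad_Q_def inner_L2_diff_right gvt gut right_diff_distrib)
        qed (use I in auto)
        finally show "inner_L2 ?N (\<lambda>x. ?W b x - ?W a x) (?W t) =
            (\<integral>s. indicator {a<..<b} s * inner_L2 ?N (p s) (?D t) \<partial>?M)" .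
      qed
    qed
  qed (use continuous_rep_L2[OF W] continuous_rep_tendsto[OF W] p' in auto)
  then show ?thesis by (simp add: inner_Q_def inner_L2_def)
qed

section \<open>The Bingham potential\<close>

text \<open>Test the subgradient inequality at \<open>a + \<tau> d\<close>, divide by
  \<open>\<tau>\<close> and let \<open>\<tau>\<close> tend to 0: the quadratic part contributes only
  its derivative, which leaves \<open>p \<bullet> d\<close> on one side and g times the change of
  the norm on the other. The direction \<open>- a\<close> and the bound for \<open>d = a\<close>
  give the equality, the direction \<open>p\<close> gives the norm bound.\<close>

lemma subdiff_phi_unfold:
  fixes a z :: "'a::euclidean_space"
  assumes z: "z \<in> subdiff (phi \<nu> g) a" and "0 < \<nu>" "0 < g"
  shows "norm (z - \<nu> *\<^sub>R a) \<le> g" and "(z - \<nu> *\<^sub>R a) \<bullet> a = g * norm a"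
proof -
  define p where "p = z - \<nu> *\<^sub>R a"
  have dir: "p \<bullet> d * \<tau> \<le> \<nu> / 2 * \<tau>\<^sup>2 * (norm d)\<^sup>2 + g * (norm (a + \<tau> *\<^sub>R d) - norm a)" for d \<tau>
  proof -
    have "phi \<nu> g a + z \<bullet> (\<tau> *\<^sub>R d) \<le> phi \<nu> g (a + \<tau> *\<^sub>R d)"
      using z unfolding subdiff_def by (auto dest: spec[where x="a + \<tau> *\<^sub>R d"])
    moreover have "(norm (a + \<tau> *\<^sub>R d))\<^sup>2 = (norm a)\<^sup>2 + 2 * \<tau> * (a \<bullet> d) + \<tau>\<^sup>2 * (norm d)\<^sup>2"
      unfolding power2_norm_eq_inner
      by (simp add: inner_add_left inner_add_right inner_commute[of d a] power2_eq_square algebra_simps)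
    ultimately show ?thesis
      by (simp add: phi_def p_def inner_diff_left algebra_simps)
  qed
  have lim: "x \<le> y" if "\<And>\<tau>::real. 0 < \<tau> \<Longrightarrow> \<tau> < 1 \<Longrightarrow> x \<le> c * \<tau> + y" for x y c :: real
  proof (rule tendsto_lowerbound)
    show "((\<lambda>\<tau>. c * \<tau> + y) \<longlongrightarrow> y) (at_right 0)"
      by (auto intro!: tendsto_eq_intros)
    show "\<forall>\<^sub>F \<tau> in at_right 0. x \<le> c * \<tau> + y"
      using that by (auto simp: eventually_at_right_field intro!: exI[of _ 1])
  qed simp
  have le: "p \<bullet> d \<le> g * norm d" for d
  proof (rule lim)
    fix \<tau> :: real assume \<tau>: "0 < \<tau>" "\<tau> < 1"
    have "norm (a + \<tau> *\<^sub>R d) - norm a \<le> \<tau> * norm d"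
      using norm_triangle_ineq[of a "\<tau> *\<^sub>R d"] \<tau> by simp
    then have "p \<bullet> d * \<tau> \<le> \<nu> / 2 * \<tau>\<^sup>2 * (norm d)\<^sup>2 + g * (\<tau> * norm d)"
      using dir[of d \<tau>] assms(3) by (smt (verit) mult_left_mono)
    also have "\<dots> = (\<nu> / 2 * (norm d)\<^sup>2 * \<tau> + g * norm d) * \<tau>"
      by (simp add: power2_eq_square algebra_simps)
    finally show "p \<bullet> d \<le> \<nu> / 2 * (norm d)\<^sup>2 * \<tau> + g * norm d" using \<tau> by simp
  qed
  have ge: "g * norm a \<le> p \<bullet> a"
  proof (rule lim)
    fix \<tau> :: real assume \<tau>: "0 < \<tau>" "\<tau> < 1"
    have "a + \<tau> *\<^sub>R (- a) = (1 - \<tau>) *\<^sub>R a" by (simp add: algebra_simps)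
    then have n: "norm (a + \<tau> *\<^sub>R (- a)) = (1 - \<tau>) * norm a" using \<tau> by simp
    have "(g * norm a) * \<tau> \<le> (\<nu> / 2 * (norm a)\<^sup>2 * \<tau> + p \<bullet> a) * \<tau>"
      using dir[of "- a" \<tau>] unfolding n by (simp add: power2_eq_square algebra_simps)
    then show "g * norm a \<le> \<nu> / 2 * (norm a)\<^sup>2 * \<tau> + p \<bullet> a" using \<tau> by simp
  qed
  show "(z - \<nu> *\<^sub>R a) \<bullet> a = g * norm a" using le[of a] ge by (simp add: p_def)
  have "norm p * norm p \<le> g * norm p" using le[of p] by (simp add: norm_eq_sqrt_inner)
  then show "norm (z - \<nu> *\<^sub>R a) \<le> g"
    using assms(3) by (cases "norm p = 0") (auto simp: p_def)
qed

text \<open>Among the points of the ball, \<open>z - \<nu> a\<close> maximises the inner product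
  with \<open>a\<close>. This is the variational inequality of the projection, and Cauchy-Schwarz
  turns it into minimal distance.\<close>

lemma subdiff_phi_closest_point:
  fixes a z :: "'a::euclidean_space"
  assumes z: "z \<in> subdiff (phi \<nu> g) a" and \<nu>: "0 < \<nu>" and g: "0 < g"
  shows "z - closest_point (cball 0 g) z = \<nu> *\<^sub>R a"
    and "closest_point (cball 0 g) z \<bullet> a = g * norm a"
proof -
  note p = subdiff_phi_unfold[OF assms]
  have eq: "z - \<nu> *\<^sub>R a = closest_point (cball 0 g) z"
  proof (rule closest_point_unique)
    show "z - \<nu> *\<^sub>R a \<in> cball 0 g" using p(1) by simp
    show "\<forall>q\<in>cball 0 g. dist z (z - \<nu> *\<^sub>R a) \<le> dist z q"
    proof
      fix q :: 'a assume q: "q \<in> cball 0 g"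
      have "q \<bullet> a \<le> norm q * norm a" by (rule norm_cauchy_schwarz)
      also have "\<dots> \<le> g * norm a" using q by (intro mult_right_mono) auto
      finally have "(z - q) \<bullet> a \<ge> (\<nu> *\<^sub>R a) \<bullet> a"
        using p(2) by (simp add: inner_diff_left)
      then have "(\<nu> *\<^sub>R a) \<bullet> (\<nu> *\<^sub>R a) \<le> (z - q) \<bullet> (\<nu> *\<^sub>R a)" using \<nu> by simp
      also have "\<dots> \<le> norm (z - q) * norm (\<nu> *\<^sub>R a)" by (rule norm_cauchy_schwarz)
      finally have "norm (\<nu> *\<^sub>R a) * norm (\<nu> *\<^sub>R a) \<le> norm (z - q) * norm (\<nu> *\<^sub>R a)"
        by (simp only: norm_eq_sqrt_inner[of "\<nu> *\<^sub>R a"] real_sqrt_mult_self abs_of_nonneg[OF inner_ge_zero])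
      then show "dist z (z - \<nu> *\<^sub>R a) \<le> dist z q"
        by (cases "norm (\<nu> *\<^sub>R a) = 0") (auto simp: dist_norm)
    qed
  qed auto
  show "z - closest_point (cball 0 g) z = \<nu> *\<^sub>R a" unfolding eq[symmetric] by simp
  show "closest_point (cball 0 g) z \<bullet> a = g * norm a" using p(2) unfolding eq .
qed

section \<open>Bilinearity of the inner product on the space-time cylinder\<close>

lemma inner_Q_eq: "inner_Q \<Omega> T a b = (\<integral>t. inner_L2 (lebesgue_on \<Omega>) (a t) (b t) \<partial>lebesgue_on {0<..<T})"
  by (simp add: inner_Q_def inner_L2_def)

lemma norm_Q_sq: "(norm_Q \<Omega> T a)\<^sup>2 = inner_Q \<Omega> T a a"
  by (simp add: norm_Q_def inner_Q_def power2_norm_eq_inner)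

lemma inner_Q_commute: "inner_Q \<Omega> T a b = inner_Q \<Omega> T b a"
  by (simp add: inner_Q_def inner_commute)

lemma inner_Q_scaleR_left: "inner_Q \<Omega> T (\<lambda>t x. r *\<^sub>R a t x) b = r * inner_Q \<Omega> T a b"
  by (simp add: inner_Q_def)

lemma inner_Q_cong_AE:
  assumes "a \<in> L2_Y \<Omega> T" "a' \<in> L2_Y \<Omega> T" "b \<in> L2_Y \<Omega> T"
    and "AE t in lebesgue_on {0<..<T}. AE x in lebesgue_on \<Omega>. a t x = a' t x"
  shows "inner_Q \<Omega> T a b = inner_Q \<Omega> T a' b"
  unfolding inner_Q_eq
proof (rule integral_cong_AE_lebesgue_on[OF Ioo_lebesgue])
  note L = assms(1-3)[unfolded L2_Y_eq]
  show "AE t in lebesgue_on {0<..<T}.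
      inner_L2 (lebesgue_on \<Omega>) (a t) (b t) = inner_L2 (lebesgue_on \<Omega>) (a' t) (b t)"
    using L2_bochner_L2[OF L(1)] L2_bochner_L2[OF L(2)] L2_bochner_L2[OF L(3)] assms(4)
    by eventually_elim (rule inner_L2_cong_AE)
  show "(\<lambda>t. inner_L2 (lebesgue_on \<Omega>) (a t) (b t)) \<in> borel_measurable (lebesgue_on {0<..<T})"
    using L2_bochner_integrable_inner[OF L(1,3)] by simp
qed

text \<open>A Bochner function may leave \<open>L2\<close> at exceptional times, so the inner
  integrals are additive only for almost every t, and measurability in t has to be supplied.\<close>

lemma inner_Q_diff_left:
  assumes "a \<in> L2_Y \<Omega> T" "b \<in> L2_Y \<Omega> T" "c \<in> L2_Y \<Omega> T"
  shows "inner_Q \<Omega> T (\<lambda>t x. a t x - b t x) c = inner_Q \<Omega> T a c - inner_Q \<Omega> T b c"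
proof -
  note L = assms[unfolded L2_Y_eq]
  note I = L2_bochner_integrable_inner[OF L(1,3)] L2_bochner_integrable_inner[OF L(2,3)]
  have "inner_Q \<Omega> T (\<lambda>t x. a t x - b t x) c = (\<integral>t. inner_L2 (lebesgue_on \<Omega>) (a t) (c t) -
      inner_L2 (lebesgue_on \<Omega>) (b t) (c t) \<partial>lebesgue_on {0<..<T})"
    unfolding inner_Q_eq
  proof (rule integral_cong_AE_lebesgue_on[OF Ioo_lebesgue])
    show "AE t in lebesgue_on {0<..<T}. inner_L2 (lebesgue_on \<Omega>) (\<lambda>x. a t x - b t x) (c t) =
        inner_L2 (lebesgue_on \<Omega>) (a t) (c t) - inner_L2 (lebesgue_on \<Omega>) (b t) (c t)"
      using L2_bochner_L2[OF L(1)] L2_bochner_L2[OF L(2)] L2_bochner_L2[OF L(3)]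
      by eventually_elim (rule inner_L2_diff_left)
    show "(\<lambda>t. inner_L2 (lebesgue_on \<Omega>) (\<lambda>x. a t x - b t x) (c t)) \<in> borel_measurable (lebesgue_on {0<..<T})"
      using L2_bochner_integrable_inner[OF L2_bochner_diff[OF L(1,2)] L(3)] by simp
  qed
  then show ?thesis using I by (simp add: inner_Q_eq)
qed

lemma inner_Q_diff_right:
  assumes "a \<in> L2_Y \<Omega> T" "b \<in> L2_Y \<Omega> T" "c \<in> L2_Y \<Omega> T"
  shows "inner_Q \<Omega> T c (\<lambda>t x. a t x - b t x) = inner_Q \<Omega> T c a - inner_Q \<Omega> T c b"
  using inner_Q_diff_left[OF assms] by (simp add: inner_Q_commute[of \<Omega> T c])

lemma L2_Y_diff: "a \<in> L2_Y \<Omega> T \<Longrightarrow> b \<in> L2_Y \<Omega> T \<Longrightarrow> (\<lambda>t x. a t x - b t x) \<in> L2_Y \<Omega> T"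
  by (simp add: L2_Y_eq L2_bochner_diff)

lemma L2_Y_scaleR: "a \<in> L2_Y \<Omega> T \<Longrightarrow> (\<lambda>t x. r *\<^sub>R a t x) \<in> L2_Y \<Omega> T"
  by (simp add: L2_Y_eq L2_bochner_scaleR)

text \<open>The projection onto a ball about the origin is nonexpansive and fixes 0.\<close>

lemma L2_Y_proj_Q:
  fixes y :: "real \<Rightarrow> 'a::euclidean_space \<Rightarrow> 'a"
  assumes "0 < g" "y \<in> L2_Y \<Omega> T"
  shows "proj_Q g y \<in> L2_Y \<Omega> T"
proof -
  have c: "norm (closest_point (cball 0 g) a - closest_point (cball 0 g) b) \<le> norm (a - b)" for a b :: 'a
    using closest_point_lipschitz[of "cball 0 g" a b] assms(1) by (simp add: dist_norm)
  have z: "closest_point (cball 0 g) (0::'a) = 0" using assms(1) by (simp add: closest_point_self)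
  show ?thesis
    using L2_bochner_contraction[where P="closest_point (cball 0 g)", OF assms(2)[unfolded L2_Y_eq] c z]
    by (simp only: proj_Q_def L2_Y_eq)
qed

text \<open>For empty \<open>S\<close> both sides are \<open>\<infinity>\<close>; the admissible set of the theorem may be empty.\<close>

lemma INF_ereal_add_const:
  "(INF y\<in>S. ereal (c + f y)) = ereal c + (INF y\<in>S. ereal (f y))"
proof (rule antisym)
  \<comment> \<open>Moving the finite constant to the other side is legitimate for infinite values
    as well.\<close>
  have "(INF y\<in>S. ereal (c + f y)) - ereal c \<le> (INF y\<in>S. ereal (f y))"
  proof (rule INF_greatest)
    fix y assume "y \<in> S"
    then have "(INF y\<in>S. ereal (c + f y)) \<le> ereal (c + f y)" by (rule INF_lower)
    then show "(INF y\<in>S. ereal (c + f y)) - ereal c \<le> ereal (f y)"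
      by (simp add: ereal_minus_le add.commute)
  qed
  then show "(INF y\<in>S. ereal (c + f y)) \<le> ereal c + (INF y\<in>S. ereal (f y))"
    by (simp add: ereal_minus_le add.commute)
  show "ereal c + (INF y\<in>S. ereal (f y)) \<le> (INF y\<in>S. ereal (c + f y))"
  proof (rule INF_greatest)
    fix y assume "y \<in> S"
    then have "ereal c + (INF y\<in>S. ereal (f y)) \<le> ereal c + ereal (f y)"
      by (intro add_left_mono INF_lower)
    then show "ereal c + (INF y\<in>S. ereal (f y)) \<le> ereal (c + f y)" by simp
  qed
qed

theorem lemma5p7:
  fixes \<Omega> \<Gamma>D \<Gamma>N :: "'a::euclidean_space set"
    and T \<nu> g :: real
    and f :: "real \<Rightarrow> ('a \<Rightarrow> real) \<Rightarrow> real"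
    and u0 :: "'a \<Rightarrow> real"
    and u v :: "real \<Rightarrow> 'a \<Rightarrow> real"
    and z :: "real \<Rightarrow> 'a \<Rightarrow> 'a"
  assumes "bounded_lipschitz_domain \<Omega>"
    and "boundary_partition \<Omega> \<Gamma>D \<Gamma>N"
    and "0 < T" and "0 < \<nu>" and "0 < g"
    and "f \<in> L2_V_dual \<Omega> \<Gamma>D T"
    and "u0 \<in> L2 (lebesgue_on \<Omega>)"
    and "bingham_solution \<Omega> \<Gamma>D T \<nu> g f u0 u"
    and "dual_flux \<Omega> \<Gamma>D T \<nu> g f u z"
    and "v \<in> W_space \<Omega> \<Gamma>D T"
    and "has_value \<Omega> T v 0 u0"
  shows
    "ereal (\<nu> / 2 * (norm_Q \<Omega> T (grad_Q \<Omega> (v - u)))\<^sup>2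
        + (g * norm1_Q \<Omega> T (grad_Q \<Omega> v) - inner_Q \<Omega> T (proj_Q g z) (grad_Q \<Omega> v))
        + 1 / 2 * (norm_L2 (lebesgue_on \<Omega>) (value_at \<Omega> T (v - u) T))\<^sup>2)
      + (INF y\<in>dual_admissible \<Omega> \<Gamma>D T f v. ereal
          (1 / (2 * \<nu>) * (norm_Q \<Omega> T (\<lambda>t x. y t x - proj_Q g y t x - \<nu> *\<^sub>R grad_Q \<Omega> u t x))\<^sup>2
            + (g * norm1_Q \<Omega> T (grad_Q \<Omega> u) - inner_Q \<Omega> T (proj_Q g y) (grad_Q \<Omega> u))))
     = (INF y\<in>dual_admissible \<Omega> \<Gamma>D T f v. ereal
          (1 / (2 * \<nu>) * (norm_Q \<Omega> T (\<lambda>t x. y t x - proj_Q g y t x - \<nu> *\<^sub>R grad_Q \<Omega> v t x))\<^sup>2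
            + (g * norm1_Q \<Omega> T (grad_Q \<Omega> v) - inner_Q \<Omega> T (proj_Q g y) (grad_Q \<Omega> v))))"
proof -
  note T = \<open>0 < T\<close> and \<nu> = \<open>0 < \<nu>\<close> and g = \<open>0 < g\<close> and v = \<open>v \<in> W_space \<Omega> \<Gamma>D T\<close>
  let ?M = "lebesgue_on {0<..<T}" and ?N = "lebesgue_on \<Omega>"
  let ?I = "inner_Q \<Omega> T :: (real \<Rightarrow> 'a \<Rightarrow> 'a) \<Rightarrow> _"
  define A where "A = grad_Q \<Omega> v"
  define B where "B = grad_Q \<Omega> u"
  have \<Omega>: "open \<Omega>" "bounded \<Omega>" using assms(1) by (auto simp: bounded_lipschitz_domain_def)
  have u: "u \<in> W_space \<Omega> \<Gamma>D T" and u0: "has_value \<Omega> T u 0 u0"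
    using assms(8) by (auto simp: bingham_solution_def)
  have z: "z \<in> L2_Y \<Omega> T"
    and zsub: "AE t in ?M. AE x in ?N. z t x \<in> subdiff (phi \<nu> g) (B t x)"
    and zeq: "AE t in ?M. V_dual_eq \<Omega> \<Gamma>D (\<lambda>w. time_deriv \<Omega> \<Gamma>D T u t w + L_adj \<Omega> (z t) w) (f t)"
    using assms(9) by (auto simp: dual_flux_def B_def)
  have A: "A \<in> L2_Y \<Omega> T" and B: "B \<in> L2_Y \<Omega> T"
    unfolding A_def B_def L2_Y_eq
    by (rule grad_Q_L2_bochner[OF \<Omega> W_space_L2_V[OF v]], rule grad_Q_L2_bochner[OF \<Omega> W_space_L2_V[OF u]])
  have AB: "(\<lambda>t x. A t x - B t x) \<in> L2_Y \<Omega> T" by (rule L2_Y_diff[OF A B])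
  have Pz: "proj_Q g z \<in> L2_Y \<Omega> T" by (rule L2_Y_proj_Q[OF g z])
  obtain wv where wv: "continuous_rep \<Omega> T v wv" "AE x in ?N. wv 0 x = u0 x"
    using assms(11) by (auto simp: has_value_iff)
  obtain wu where wu: "continuous_rep \<Omega> T u wu" "AE x in ?N. wu 0 x = u0 x"
    using u0 by (auto simp: has_value_iff)
  define K where "K = (norm_L2 ?N (value_at \<Omega> T (v - u) T))\<^sup>2"
  have K: "K = (norm_L2 ?N (\<lambda>x. wv T x - wu T x))\<^sup>2"
    using norm_L2_value_at[OF T _ continuous_rep_diff[OF wv(1) wu(1)]] \<Omega>
    by (simp add: K_def fun_diff_def)
  have init: "norm_L2 ?N (\<lambda>x. wv 0 x - wu 0 x) = 0"
  proof -
    have "AE x in ?N. (norm (wv 0 x - wu 0 x))\<^sup>2 = 0" using wv(2) wu(2) by eventually_elim simp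
    then show ?thesis unfolding norm_L2_def by (simp add: integral_eq_zero_AE)
  qed
  have grad_diff: "(norm_Q \<Omega> T (grad_Q \<Omega> (v - u)))\<^sup>2 = ?I A A - 2 * ?I A B + ?I B B"
  proof -
    \<comment> \<open>\<open>grad_Q\<close> of \<open>v - u\<close> is a choice of its own and
      agrees with the difference of the gradients almost everywhere.\<close>
    have ae: "AE t in ?M. AE x in ?N. grad_Q \<Omega> (v - u) t x = A t x - B t x"
      using L2_V_W12_D[OF W_space_L2_V[OF v]] L2_V_W12_D[OF W_space_L2_V[OF u]]
    proof eventually_elim
      case (elim t)
      show ?case
        using weak_grad_diff(2)[OF \<Omega> W12_D_W12[OF elim(1)] W12_D_W12[OF elim(2)]]
        by (simp add: grad_Q_def A_def B_def fun_diff_def)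
    qed
    have "norm_Q \<Omega> T (grad_Q \<Omega> (v - u)) = norm_Q \<Omega> T (\<lambda>t x. A t x - B t x)"
      unfolding norm_Q_def
    proof (intro arg_cong[where f=sqrt] integral_cong_AE_lebesgue_on[OF Ioo_lebesgue, symmetric])
      show "(\<lambda>t. \<integral>x. (norm (A t x - B t x))\<^sup>2 \<partial>?N) \<in> borel_measurable ?M"
        using L2_bochner_integrable_inner[OF AB[unfolded L2_Y_eq] AB[unfolded L2_Y_eq]]
        by (simp add: inner_L2_def power2_norm_eq_inner)
      show "AE t in ?M. (\<integral>x. (norm (A t x - B t x))\<^sup>2 \<partial>?N) = (\<integral>x. (norm (grad_Q \<Omega> (v - u) t x))\<^sup>2 \<partial>?N)"
        using ae L2_bochner_L2[OF AB[unfolded L2_Y_eq]]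
      proof eventually_elim
        case (elim t)
        show ?case
        proof (rule integral_cong_AE_lebesgue_on)
          show "\<Omega> \<in> sets lebesgue" using \<Omega> by simp
          show "AE x in ?N. (norm (A t x - B t x))\<^sup>2 = (norm (grad_Q \<Omega> (v - u) t x))\<^sup>2"
            using elim(1) by eventually_elim simp
          show "(\<lambda>x. (norm (A t x - B t x))\<^sup>2) \<in> borel_measurable ?N"
            using L2_integrable_sq[OF elim(2)] by simp
        qed
      qed
    qed
    then show ?thesis
      by (simp add: norm_Q_sq inner_Q_diff_left inner_Q_diff_right A B AB inner_Q_commute[of \<Omega> T B A])
  qed
  have zproj: "?I (\<lambda>t x. z t x - proj_Q g z t x) w = \<nu> * ?I B w" if w: "w \<in> L2_Y \<Omega> T" for w
  proof -
    have "AE t in ?M. AE x in ?N. z t x - proj_Q g z t x = \<nu> *\<^sub>R B t x"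
      using zsub by eventually_elim
        (auto elim!: eventually_mono simp: proj_Q_def subdiff_phi_closest_point[OF _ \<nu> g])
    then have "?I (\<lambda>t x. z t x - proj_Q g z t x) w = ?I (\<lambda>t x. \<nu> *\<^sub>R B t x) w"
      by (intro inner_Q_cong_AE L2_Y_diff L2_Y_scaleR z Pz B w)
    then show ?thesis by (simp add: inner_Q_scaleR_left)
  qed
  have n1: "g * norm1_Q \<Omega> T B = ?I (proj_Q g z) B"
  proof -
    have "?I (proj_Q g z) B = (\<integral>t. g * (\<integral>x. norm (B t x) \<partial>?N) \<partial>?M)"
      unfolding inner_Q_def
    proof (rule integral_cong_AE_lebesgue_on[OF Ioo_lebesgue])
      show "(\<lambda>t. \<integral>x. proj_Q g z t x \<bullet> B t x \<partial>?N) \<in> borel_measurable ?M"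
        using L2_bochner_integrable_inner[OF Pz[unfolded L2_Y_eq] B[unfolded L2_Y_eq]] by (simp add: inner_L2_def)
      show "AE t in ?M. (\<integral>x. proj_Q g z t x \<bullet> B t x \<partial>?N) = g * (\<integral>x. norm (B t x) \<partial>?N)"
        using zsub L2_bochner_L2[OF Pz[unfolded L2_Y_eq]] L2_bochner_L2[OF B[unfolded L2_Y_eq]]
      proof eventually_elim
        case (elim t)
        have "(\<integral>x. proj_Q g z t x \<bullet> B t x \<partial>?N) = (\<integral>x. g * norm (B t x) \<partial>?N)"
        proof (rule integral_cong_AE_lebesgue_on)
          show "\<Omega> \<in> sets lebesgue" using \<Omega> by simp
          show "AE x in ?N. proj_Q g z t x \<bullet> B t x = g * norm (B t x)"
            using elim(1) by eventually_elim (simp add: proj_Q_def subdiff_phi_closest_point[OF _ \<nu> g])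
          show "(\<lambda>x. proj_Q g z t x \<bullet> B t x) \<in> borel_measurable ?N"
            using L2_integrable_inner[OF elim(2,3)] by simp
        qed
        then show ?case by simp
      qed
    qed
    then show ?thesis by (simp add: norm1_Q_def)
  qed
  let ?c = "\<nu> / 2 * (norm_Q \<Omega> T (grad_Q \<Omega> (v - u)))\<^sup>2 + (g * norm1_Q \<Omega> T A - ?I (proj_Q g z) A) + 1 / 2 * K"
  let ?G = "\<lambda>W y. 1 / (2 * \<nu>) * (norm_Q \<Omega> T (\<lambda>t x. y t x - proj_Q g y t x - \<nu> *\<^sub>R W t x))\<^sup>2
            + (g * norm1_Q \<Omega> T W - ?I (proj_Q g y) W)"
  have main: "?G A y = ?c + ?G B y" if y: "y \<in> dual_admissible \<Omega> \<Gamma>D T f v" for y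
  proof -
    have yL: "y \<in> L2_Y \<Omega> T" and yeq: "AE t in ?M. V_dual_eq \<Omega> \<Gamma>D (L_adj \<Omega> (y t)) (\<lambda>w. f t w - time_deriv \<Omega> \<Gamma>D T v t w)"
      using y by (auto simp: dual_admissible_def)
    have Py: "proj_Q g y \<in> L2_Y \<Omega> T" by (rule L2_Y_proj_Q[OF g yL])
    define C where "C = (\<lambda>t x. y t x - proj_Q g y t x)"
    have C: "C \<in> L2_Y \<Omega> T" unfolding C_def by (rule L2_Y_diff[OF yL Py])
    \<comment> \<open>The source f cancels: \<open>y\<close> and \<open>z\<close> represent f minus
      the time derivative of \<open>v\<close> and of \<open>u\<close>, respectively.\<close>
    have "AE t in ?M. V_dual_eq \<Omega> \<Gamma>D (L_adj \<Omega> (\<lambda>x. z t x - y t x))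
        (\<lambda>w. time_deriv \<Omega> \<Gamma>D T v t w - time_deriv \<Omega> \<Gamma>D T u t w)"
      using yeq zeq L2_bochner_L2[OF z[unfolded L2_Y_eq]] L2_bochner_L2[OF yL[unfolded L2_Y_eq]]
    proof eventually_elim
      case (elim t)
      show ?case unfolding V_dual_eq_def
      proof
        fix w assume w: "w \<in> W12_D \<Omega> \<Gamma>D"
        have gw: "weak_grad \<Omega> w \<in> L2 ?N" by (intro weak_grad_works W12_D_W12[OF w])
        have "L_adj \<Omega> (\<lambda>x. z t x - y t x) w = L_adj \<Omega> (z t) w - L_adj \<Omega> (y t) w"
          using inner_L2_diff_left[OF elim(3,4) gw] by (simp add: L_adj_def inner_L2_def)
        then show "L_adj \<Omega> (\<lambda>x. z t x - y t x) w = time_deriv \<Omega> \<Gamma>D T v t w - time_deriv \<Omega> \<Gamma>D T u t w"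
          using elim(1,2) w unfolding V_dual_eq_def by fastforce
      qed
    qed
    from W_space_integration_by_parts[OF \<Omega> T v u wv(1) wu(1) L2_Y_diff[OF z yL] this]
    have "K = 2 * ?I (\<lambda>t x. z t x - y t x) (\<lambda>t x. A t x - B t x)"
      by (simp add: K init A_def B_def)
    then have Keq: "K = 2 * (?I z A - ?I y A - ?I z B + ?I y B)"
      by (simp add: inner_Q_diff_left inner_Q_diff_right A B AB z yL)
    have sq: "(norm_Q \<Omega> T (\<lambda>t x. C t x - \<nu> *\<^sub>R W t x))\<^sup>2 = ?I C C - 2 * \<nu> * (?I y W - ?I (proj_Q g y) W) + \<nu>\<^sup>2 * ?I W W"
      if W: "W \<in> L2_Y \<Omega> T" for W
    proof -
      note sW = L2_Y_scaleR[OF W, of \<nu>]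
      have "(norm_Q \<Omega> T (\<lambda>t x. C t x - \<nu> *\<^sub>R W t x))\<^sup>2 = ?I C C - ?I C (\<lambda>t x. \<nu> *\<^sub>R W t x) -
          (?I (\<lambda>t x. \<nu> *\<^sub>R W t x) C - ?I (\<lambda>t x. \<nu> *\<^sub>R W t x) (\<lambda>t x. \<nu> *\<^sub>R W t x))"
        unfolding norm_Q_sq inner_Q_diff_left[OF C sW L2_Y_diff[OF C sW]]
        by (simp only: inner_Q_diff_right[OF C sW C] inner_Q_diff_right[OF C sW sW])
      also have "\<dots> = ?I C C - 2 * \<nu> * ?I C W + \<nu>\<^sup>2 * ?I W W"
        unfolding inner_Q_scaleR_left inner_Q_commute[of \<Omega> T C "\<lambda>t x. \<nu> *\<^sub>R W t x"]
          inner_Q_commute[of \<Omega> T W "\<lambda>t x. \<nu> *\<^sub>R W t x"] inner_Q_commute[of \<Omega> T W C]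
        by (simp add: power2_eq_square)
      also have "?I C W = ?I y W - ?I (proj_Q g y) W"
        unfolding C_def by (rule inner_Q_diff_left[OF yL Py W])
      finally show ?thesis .
    qed
    have zA: "?I z A - ?I (proj_Q g z) A = \<nu> * ?I A B"
      using zproj[OF A] inner_Q_diff_left[OF z Pz A] by (simp add: inner_Q_commute[of \<Omega> T A B])
    have zB: "?I z B - ?I (proj_Q g z) B = \<nu> * ?I B B"
      using zproj[OF B] inner_Q_diff_left[OF z Pz B] by simp
    \<comment> \<open>The cross term of the square cancels the product of \<open>proj_Q g y\<close>
      with \<open>W\<close>.\<close>
    have expand: "?G W y = ?I C C / (2 * \<nu>) - ?I y W + \<nu> / 2 * ?I W W + g * norm1_Q \<Omega> T W"
      if W: "W \<in> L2_Y \<Omega> T" for W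
    proof -
      have lin: "1 / (2 * \<nu>) * (c - 2 * \<nu> * (p - q) + \<nu>\<^sup>2 * r) = c / (2 * \<nu>) - (p - q) + \<nu> / 2 * r" for c p q r :: real
        using \<nu> by (simp add: field_simps power2_eq_square)
      have "?G W y = 1 / (2 * \<nu>) * (?I C C - 2 * \<nu> * (?I y W - ?I (proj_Q g y) W) + \<nu>\<^sup>2 * ?I W W)
          + (g * norm1_Q \<Omega> T W - ?I (proj_Q g y) W)"
        using sq[OF W] by (simp only: C_def)
      then show ?thesis unfolding lin by simp
    qed
    \<comment> \<open>\<open>Keq\<close> absorbs the products with \<open>y\<close>;
      \<open>zA\<close>, \<open>zB\<close> and \<open>n1\<close> then eliminate those with
      \<open>z\<close> and \<open>proj_Q g z\<close>.\<close>
    show ?thesis unfolding expand[OF A] expand[OF B] unfolding grad_diff Keq n1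
      using zA zB by (simp add: algebra_simps)
  qed
  have "(INF y\<in>dual_admissible \<Omega> \<Gamma>D T f v. ereal (?G A y)) = (INF y\<in>dual_admissible \<Omega> \<Gamma>D T f v. ereal (?c + ?G B y))"
    using main by (intro INF_cong) auto
  also have "\<dots> = ereal ?c + (INF y\<in>dual_admissible \<Omega> \<Gamma>D T f v. ereal (?G B y))"
    by (rule INF_ereal_add_const)
  finally show ?thesis unfolding A_def B_def K_def by (rule sym)
qed

end
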